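(* Let $1\le p,q\le\infty$ and $s\in\mathbb{R}$, and let $\mu$ be the mean-zero Wiener measure on $\mathbb{T}$. Then $(M^{p,q}_s(\mathbb{T}),\mu)$, $(W^{p,q}_s(\mathbb{T}),\mu)$ and $(\mathcal{F}L^{s,q}(\mathbb{T}),\mu)$ are abstract Wiener spaces for $(s-1)q<-1$. Also, $(\widehat{b}^s_{p,q}(\mathbb{T}),\mu)$ is an abstract Wiener space for $(s-1)p<-1$. (When $q=\infty$ in the first condition, or $p=\infty$ in the second, the condition is read as $s<1$.)
   Context: $\mathbb{T}=\mathbb{R}/2\pi\mathbb{Z}$, $\langle n\rangle=(1+|n|^2)^{1/2}$, and $\widehat{u}(n)$, $n\in\mathbb{Z}$, denote Fourier coefficients (factors of $2\pi$ are ignored). Let $H=\dot H^1(\mathbb{T})$: complex-valued mean-zero functions $u=\sum_{n\ne0}\widehat{u}(n)e^{int}$ with $\|u\|_{H}^2=\sum_{n\neq0}|n|^2|\widehat{u}(n)|^2<\infty$, regarded as a real separable Hilbert space. Abstract Wiener spaces: let $\mathcal{F}$ be the set of finite-dimensional orthogonal projections of $H$. A cylinder set is $E=\{u\in H:\mathbb{P}u\in F\}$ with $\mathbb{P}\in\mathcal{F}$ and $F$ a Borel subset of $\mathbb{P}H$. The (finitely additive) Gaussian measure on cylinder sets is $\mu(E)=(2\pi)^{-n/2}\int_F e^{-\frac12\|u\|_H^2}du$, where $n=\dim\mathbb{P}H$ and $du$ is Lebesgue measure on $\mathbb{P}H$. A seminorm $|||\cdot|||$ on $H$ is measurable if for every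 $\varepsilon>0$ there exists $\mathbb{P}_\varepsilon\in\mathcal{F}$ such that $\mu(|||\mathbb{P}u|||>\varepsilon)<\varepsilon$ for all $\mathbb{P}\in\mathcal{F}$ orthogonal to $\mathbb{P}_\varepsilon$. If $|||\cdot|||$ is measurable, $B$ is the completion of $H$ with respect to $|||\cdot|||$, and $i:H\to B$ is the inclusion, then the triple $(i,H,B)$ is called an abstract Wiener space; the pair $(B,\mu)$ is also called an abstract Wiener space, where $\mu$ is extended to cylinder sets of $B$ by $\mu(\{u\in B:((u,v_1),\dots,(u,v_n))\in F\})=\mu(\{u\in H:(\langle u,v_1\rangle_H,\dots,\langle u,v_n\rangle_H)\in F\})$ for $v_j\in B^*\subset H^*\equiv H$ and $F\subset\mathbb{R}^n$ Borel. In the claim, for each function space $X$, the assertion that $(X,\mu)$ is an abstract Wiener space is understood with $|||\cdot|||=\|\cdot\|_X$, so $B$ is the completion of $H$ in the norm of $X$ (the closure of $H$ in $X$). Mean-zero Wiener measure $\mu$ on $\mathbb{T}$: the law of $u(x,\omega)=\sum_{n\ne0}\frac{g_n(\omega)}{n}e^{inx}$, where $\{g_n\}_{n\neq0}$ are independent and $\mathrm{Re}\,g_n$, $\mathrm{Im}\,g_n$ are independent standard real Gaussians; formally $d\mu=Z^{-1}\exp\big(-\frac12\sum_{n\neq0}|n|^2|\widehat{u}(n)|^2\big)\prod_{n\neq0}d\widehat{u}(n)$, i.e. the Gaussian measure associated with $H=\dot H^1(\mathbb{T})$, given on cylinder sets $E=\{u\in H:\mathbb{P}u\in F\}$ of $H$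 by $\mu(E)=(2\pi)^{-n/2}\int_F e^{-\frac12\|u\|_H^2}du$ with $n=\dim\mathbb{P}H$, and extended to $B$. Function spaces: $\|u\|_{M^{p,q}_s(\mathbb{T})}=\big\|\langle n\rangle^s\|\psi(D-n)u\|_{L^p_x(\mathbb{T})}\big\|_{\ell^q_n(\mathbb{Z})}$ and $\|u\|_{W^{p,q}_s(\mathbb{T})}=\big\|\,\|\langle n\rangle^s\psi(D-n)u\|_{\ell^q_n(\mathbb{Z})}\big\|_{L^p_x(\mathbb{T})}$, where $\psi:\mathbb{Z}\to\mathbb{C}$ is finitely supported with $\sum_{n\in\mathbb{Z}}\psi(k-n)=1$ for all $k\in\mathbb{Z}$, and $\psi(D-n)u$ is the trigonometric polynomial with Fourier coefficients $\psi(k-n)\widehat{u}(k)$; $\|u\|_{\mathcal{F}L^{s,q}(\mathbb{T})}=\|\langle n\rangle^s\widehat{u}(n)\|_{\ell^q_n(\mathbb{Z})}$. For all $1\le p,q\le\infty$ these three spaces coincide with equivalent norms. Fourier-Besov space: let $\varphi_0,\varphi\in\mathcal{S}(\mathbb{R})$ with $\mathrm{supp}\,\varphi_0\subset\{|\xi|\le2\}$, $\mathrm{supp}\,\varphi\subset\{\frac12\le|\xi|\le2\}$, $\varphi_0(\xi)+\sum_{j\ge1}\varphi(2^{-j}\xi)\equiv1$, and $\varphi_j(\xi)=\varphi(2^{-j}\xi)$ for $j\ge1$. Then $\|u\|_{\widehat{b}^s_{p,q}(\mathbb{T})}=\big\|\,\|\langle n\rangle^s\varphi_j(n)\widehat{u}(n)\|_{\ell^p_n(\mathbb{Z})}\big\|_{\ell^q_j(\mathbb{Z}_{\ge0})}$.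 *)

theory Defs
  imports "HOL-Probability.Probability" "HOL-Library.Function_Algebras"
begin

section \<open>Functions as a real vector space\<close>

instantiation "fun" :: (type, scaleR) scaleR
begin
definition scaleR_fun :: "real \<Rightarrow> ('a \<Rightarrow> 'b) \<Rightarrow> 'a \<Rightarrow> 'b"
  where "scaleR_fun c f = (\<lambda>x. c *\<^sub>R f x)"
instance ..
end

instance "fun" :: (type, real_vector) real_vector
  by standard (auto simp: scaleR_fun_def fun_eq_iff scaleR_add_right scaleR_add_left)


section \<open>Gaussian cylinder measure and abstract Wiener spaces\<close>

definition fin_proj :: "('h::real_inner \<Rightarrow> 'h) set"
  where "fin_proj = {P. bounded_linear P \<and> P \<circ> P = P \<and> (\<forall>u v. P u \<bullet> v = u \<bullet> P v)
                       \<and> (\<exists>S. finite S \<and> range P = span S)}"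

definition orth_proj :: "('h::real_inner \<Rightarrow> 'h) \<Rightarrow> ('h \<Rightarrow> 'h) \<Rightarrow> bool"
  where "orth_proj P Q \<longleftrightarrow> (\<forall>u v. P u \<bullet> Q v = 0)"

definition onb_of :: "'h::real_inner set \<Rightarrow> (nat \<Rightarrow> 'h) \<Rightarrow> bool"
  where "onb_of V e \<longleftrightarrow> (\<forall>i<dim V. \<forall>j<dim V. e i \<bullet> e j = (if i = j then 1 else 0))
                      \<and> span (e ` {..<dim V}) = V"

text \<open>Lebesgue measure on a finite-dimensional subspace, transported from coordinates in an
  orthonormal basis; by rotation invariance it does not depend on the basis. It is a measure on
  the Borel sets of the whole space, carried by \<open>V\<close>.\<close>

definition subspace_lborel :: "'h::{real_inner,polish_space} set \<Rightarrow> 'h measure"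
  where "subspace_lborel V =
    (let e = (SOME e. onb_of V e)
     in distr (PiM {..<dim V} (\<lambda>_. lborel :: real measure)) borel (\<lambda>c. \<Sum>i<dim V. c i *\<^sub>R e i))"

definition gauss_fd :: "'h::{real_inner,polish_space} set \<Rightarrow> 'h set \<Rightarrow> real"
  where "gauss_fd V F = (2 * pi) powr (- real (dim V) / 2)
                        * (LINT u:F|subspace_lborel V. exp (- (norm u)\<^sup>2 / 2))"

text \<open>A cylinder set has many representations \<open>{u. P u \<in> F}\<close>; all give the same value.\<close>

definition gauss_cyl :: "'h::{real_inner,polish_space} set \<Rightarrow> real"
  where "gauss_cyl E = (THE m. \<exists>P\<in>fin_proj. \<exists>F\<in>sets borel. F \<subseteq> range P
                           \<and> E = {u. P u \<in> F} \<and> m = gauss_fd (range P) F)"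

definition seminorm_on :: "'b::real_vector set \<Rightarrow> ('b \<Rightarrow> real) \<Rightarrow> bool"
  where "seminorm_on V N \<longleftrightarrow> subspace V \<and> (\<forall>x\<in>V. \<forall>y\<in>V. N (x + y) \<le> N x + N y)
                           \<and> (\<forall>c. \<forall>x\<in>V. N (c *\<^sub>R x) = \<bar>c\<bar> * N x)"

definition norm_on :: "'b::real_vector set \<Rightarrow> ('b \<Rightarrow> real) \<Rightarrow> bool"
  where "norm_on V N \<longleftrightarrow> seminorm_on V N \<and> (\<forall>x\<in>V. N x = 0 \<longrightarrow> x = 0)"

definition measurable_seminorm :: "('h::{real_inner,polish_space} \<Rightarrow> real) \<Rightarrow> bool"
  where "measurable_seminorm N \<longleftrightarrow> seminorm_on UNIV N \<and>
    (\<forall>\<epsilon>>0. \<exists>P\<^sub>\<epsilon>\<in>fin_proj. \<forall>P\<in>fin_proj. orth_proj P P\<^sub>\<epsilon> \<longrightarrow> gauss_cyl {u. N (P u) > \<epsilon>} < \<epsilon>)"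

definition complete_norm_on :: "'b::real_vector set \<Rightarrow> ('b \<Rightarrow> real) \<Rightarrow> bool"
  where "complete_norm_on B N \<longleftrightarrow> norm_on B N \<and>
    (\<forall>x :: nat \<Rightarrow> 'b. (\<forall>k. x k \<in> B) \<and> (\<forall>\<epsilon>>0. \<exists>K. \<forall>k\<ge>K. \<forall>l\<ge>K. N (x k - x l) < \<epsilon>)
       \<longrightarrow> (\<exists>y\<in>B. (\<lambda>k. N (x k - y)) \<longlonglongrightarrow> 0))"

text \<open>\<open>(B, N)\<close> is, via \<open>i\<close>, the completion of \<open>'h\<close> with respect to the seminorm \<open>u \<mapsto> N (i u)\<close>.\<close>

definition completion_via :: "('h::real_vector \<Rightarrow> 'b::real_vector) \<Rightarrow> 'b set \<Rightarrow> ('b \<Rightarrow> real) \<Rightarrow> bool"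
  where "completion_via i B N \<longleftrightarrow> complete_norm_on B N \<and> linear i \<and> range i \<subseteq> B \<and>
    (\<forall>x\<in>B. \<forall>\<epsilon>>0. \<exists>u. N (x - i u) < \<epsilon>)"

definition abstract_wiener_triple ::
    "('h::{real_inner,polish_space} \<Rightarrow> 'b::real_vector) \<Rightarrow> 'b set \<Rightarrow> ('b \<Rightarrow> real) \<Rightarrow> bool"
  where "abstract_wiener_triple i B N \<longleftrightarrow>
    inj i \<and> measurable_seminorm (\<lambda>u. N (i u)) \<and> completion_via i B N"

definition dual_on :: "'b::real_vector set \<Rightarrow> ('b \<Rightarrow> real) \<Rightarrow> ('b \<Rightarrow> real) set"
  where "dual_on B N = {f. (\<forall>x\<in>B. \<forall>y\<in>B. f (x + y) = f x + f y) \<and>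
                          (\<forall>c. \<forall>x\<in>B. f (c *\<^sub>R x) = c * f x) \<and>
                          (\<exists>C. \<forall>x\<in>B. \<bar>f x\<bar> \<le> C * N x)}"

text \<open>The set function \<open>\<mu>\<close> extends the Gaussian cylinder measure to the cylinder sets of \<open>B\<close>. The
  inclusion of \<open>B\<^sup>*\<close> in \<open>'h\<close> sends a functional \<open>f\<close> to the vector \<open>v\<close> with
  \<open>f \<circ> i = (\<lambda>u. u \<bullet> v)\<close>. Borel subsets of the \<open>n\<close>-dimensional real space are taken in the
  extensional functions on \<open>{..<n}\<close>.\<close>

definition extends_gauss_cyl ::
    "('h::{real_inner,polish_space} \<Rightarrow> 'b::real_vector) \<Rightarrow> 'b set \<Rightarrow> ('b \<Rightarrow> real) \<Rightarrow> ('b set \<Rightarrow> real) \<Rightarrow> bool"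
  where "extends_gauss_cyl i B N \<mu> \<longleftrightarrow>
    (\<forall>n. \<forall>f v. \<forall>F\<in>sets (PiM {..<n::nat} (\<lambda>_. borel :: real measure)).
       (\<forall>j<n. f j \<in> dual_on B N \<and> (\<forall>u. f j (i u) = u \<bullet> v j)) \<longrightarrow>
       \<mu> {x\<in>B. (\<lambda>j\<in>{..<n}. f j x) \<in> F} = gauss_cyl {u. (\<lambda>j\<in>{..<n}. u \<bullet> v j) \<in> F})"

definition abstract_wiener_space ::
    "('h::{real_inner,polish_space} \<Rightarrow> 'b::real_vector) \<Rightarrow> 'b set \<Rightarrow> ('b \<Rightarrow> real) \<Rightarrow> ('b set \<Rightarrow> real) \<Rightarrow> bool"
  where "abstract_wiener_space i B N \<mu> \<longleftrightarrow>
    abstract_wiener_triple i B N \<and> extends_gauss_cyl i B N \<mu>"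


section \<open>The homogeneous Sobolev space of order one on the torus\<close>

text \<open>Distributions on the torus are represented by their Fourier coefficients.\<close>

typedef hdot1 = "{a :: int \<Rightarrow> complex. a 0 = 0 \<and>
    (\<lambda>n. (of_int n)\<^sup>2 * (cmod (a n))\<^sup>2) summable_on UNIV}"
  morphisms fcoeff Abs_hdot1
  by (intro exI[of _ "\<lambda>_. 0"]) auto

setup_lifting type_definition_hdot1

lemma fcoeff_0 [simp]: "fcoeff u 0 = 0"
  using fcoeff[of u] by simp

lemma fcoeff_summable: "(\<lambda>n. (of_int n)\<^sup>2 * (cmod (fcoeff u n))\<^sup>2) summable_on UNIV"
  using fcoeff[of u] by simp

lemma cmod_add_sq_le: "(cmod (x + y))\<^sup>2 \<le> 2 * (cmod x)\<^sup>2 + 2 * (cmod y)\<^sup>2"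
proof -
  have "(cmod (x + y))\<^sup>2 \<le> (cmod x + cmod y)\<^sup>2"
    by (intro power_mono norm_triangle_ineq) auto
  also have "\<dots> \<le> 2 * (cmod x)\<^sup>2 + 2 * (cmod y)\<^sup>2"
    using sum_squares_ge_zero[of "cmod x - cmod y" 0] by (simp add: power2_eq_square algebra_simps)
  finally show ?thesis .
qed

lemma h1_summable_add:
  fixes a b :: "int \<Rightarrow> complex"
  assumes "(\<lambda>n. (of_int n)\<^sup>2 * (cmod (a n))\<^sup>2) summable_on (UNIV::int set)"
    and "(\<lambda>n. (of_int n)\<^sup>2 * (cmod (b n))\<^sup>2) summable_on (UNIV::int set)"
  shows "(\<lambda>n. (of_int n)\<^sup>2 * (cmod (a n + b n))\<^sup>2 :: real) summable_on (UNIV::int set)"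
proof (rule summable_on_comparison_test)
  show "(\<lambda>n. 2 * ((of_int n)\<^sup>2 * (cmod (a n))\<^sup>2) + 2 * ((of_int n)\<^sup>2 * (cmod (b n))\<^sup>2)) summable_on UNIV"
    by (intro summable_on_add summable_on_cmult_right assms)
  show "(of_int n)\<^sup>2 * (cmod (a n + b n))\<^sup>2
      \<le> 2 * ((of_int n)\<^sup>2 * (cmod (a n))\<^sup>2) + 2 * ((of_int n)\<^sup>2 * (cmod (b n))\<^sup>2)" for n
    using mult_left_mono[OF cmod_add_sq_le[of "a n" "b n"], of "(of_int n)\<^sup>2"]
    by (simp add: algebra_simps)
qed auto

instantiation hdot1 :: real_vector
begin

lift_definition zero_hdot1 :: hdot1 is "\<lambda>_. 0" by simp

lift_definition plus_hdot1 :: "hdot1 \<Rightarrow> hdot1 \<Rightarrow> hdot1" is "\<lambda>a b n. a n + b n"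
  using h1_summable_add by auto

lift_definition uminus_hdot1 :: "hdot1 \<Rightarrow> hdot1" is "\<lambda>a n. - a n" by simp

lift_definition minus_hdot1 :: "hdot1 \<Rightarrow> hdot1 \<Rightarrow> hdot1" is "\<lambda>a b n. a n - b n"
  subgoal for a b using h1_summable_add[of a "\<lambda>n. - b n"] by auto
  done

lift_definition scaleR_hdot1 :: "real \<Rightarrow> hdot1 \<Rightarrow> hdot1" is "\<lambda>c a n. c *\<^sub>R a n"
  subgoal for c a
    using summable_on_cmult_right[of "\<lambda>n. (of_int n)\<^sup>2 * (cmod (a n))\<^sup>2" UNIV "c\<^sup>2"]
    by (auto simp: power_mult_distrib algebra_simps)
  done

instance
  by standard (transfer; auto simp: fun_eq_iff algebra_simps scaleR_add_right scaleR_add_left)+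

end

lemma h1_inner_summable:
  "(\<lambda>n. (of_int n)\<^sup>2 * Re (fcoeff u n * cnj (fcoeff v n))) summable_on UNIV"
proof (rule abs_summable_summable, rule summable_on_comparison_test)
  show "(\<lambda>n. (of_int n)\<^sup>2 * (cmod (fcoeff u n))\<^sup>2 + (of_int n)\<^sup>2 * (cmod (fcoeff v n))\<^sup>2) summable_on UNIV"
    by (intro summable_on_add fcoeff_summable)
  show "norm ((of_int n)\<^sup>2 * Re (fcoeff u n * cnj (fcoeff v n)))
      \<le> (of_int n)\<^sup>2 * (cmod (fcoeff u n))\<^sup>2 + (of_int n)\<^sup>2 * (cmod (fcoeff v n))\<^sup>2" for n
  proof -
    have "\<bar>Re (fcoeff u n * cnj (fcoeff v n))\<bar> \<le> cmod (fcoeff u n) * cmod (fcoeff v n)"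
      using abs_Re_le_cmod[of "fcoeff u n * cnj (fcoeff v n)"] by (simp add: norm_mult)
    also have "\<dots> \<le> (cmod (fcoeff u n))\<^sup>2 + (cmod (fcoeff v n))\<^sup>2"
      using sum_squares_bound[of "cmod (fcoeff u n)" "cmod (fcoeff v n)"]
        mult_nonneg_nonneg[OF norm_ge_zero norm_ge_zero, of "fcoeff u n" "fcoeff v n"]
      by linarith
    finally have "(of_int n)\<^sup>2 * \<bar>Re (fcoeff u n * cnj (fcoeff v n))\<bar>
        \<le> (of_int n)\<^sup>2 * ((cmod (fcoeff u n))\<^sup>2 + (cmod (fcoeff v n))\<^sup>2)"
      by (rule mult_left_mono) simp
    thus ?thesis unfolding real_norm_def abs_mult distrib_left by simp
  qed
qed auto

instantiation hdot1 :: real_inner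
begin

definition inner_hdot1 :: "hdot1 \<Rightarrow> hdot1 \<Rightarrow> real"
  where "inner_hdot1 u v = (\<Sum>\<^sub>\<infinity>n. (of_int n)\<^sup>2 * Re (fcoeff u n * cnj (fcoeff v n)))"
definition norm_hdot1 :: "hdot1 \<Rightarrow> real"
  where "norm_hdot1 u = sqrt (inner u u)"
definition sgn_hdot1 :: "hdot1 \<Rightarrow> hdot1"
  where "sgn_hdot1 u = u /\<^sub>R norm u"
definition dist_hdot1 :: "hdot1 \<Rightarrow> hdot1 \<Rightarrow> real"
  where "dist_hdot1 u v = norm (u - v)"
definition uniformity_hdot1 :: "(hdot1 \<times> hdot1) filter"
  where "uniformity_hdot1 = (INF e\<in>{0<..}. principal {(x, y). dist x y < e})"
definition open_hdot1 :: "hdot1 set \<Rightarrow> bool"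
  where "open_hdot1 U = (\<forall>x\<in>U. eventually (\<lambda>(x', y). x' = x \<longrightarrow> y \<in> U) uniformity)"

instance
proof
  fix x y z :: hdot1 and r :: real
  show "inner x y = inner y x"
    unfolding inner_hdot1_def by (intro infsum_cong) (simp add: mult.commute)
  show "inner (x + y) z = inner x z + inner y z"
    unfolding inner_hdot1_def
    by (subst infsum_add[symmetric, OF h1_inner_summable h1_inner_summable])
       (intro infsum_cong, simp add: plus_hdot1.rep_eq algebra_simps)
  show "inner (r *\<^sub>R x) y = r * inner x y"
    unfolding inner_hdot1_def
    by (subst infsum_cmult_right'[symmetric])
       (intro infsum_cong, simp add: scaleR_hdot1.rep_eq algebra_simps)
  have sq: "(of_int n)\<^sup>2 * Re (fcoeff x n * cnj (fcoeff x n)) = (of_int n)\<^sup>2 * (cmod (fcoeff x n))\<^sup>2" for n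
    by (simp add: complex_mult_cnj cmod_power2)
  show "0 \<le> inner x x"
    unfolding inner_hdot1_def sq by (intro infsum_nonneg) auto
  show "inner x x = 0 \<longleftrightarrow> x = 0"
  proof
    assume "inner x x = 0"
    hence "(of_int n)\<^sup>2 * (cmod (fcoeff x n))\<^sup>2 = 0" for n
      using nonneg_infsum_le_0D[OF _ fcoeff_summable[of x], of n]
      unfolding inner_hdot1_def sq by auto
    hence "fcoeff x n = 0" for n
      by (cases "n = 0") auto
    thus "x = 0" by (intro fcoeff_inject[THEN iffD1]) (auto simp: zero_hdot1.rep_eq)
  next
    assume "x = 0"
    thus "inner x x = 0" by (simp add: inner_hdot1_def zero_hdot1.rep_eq)
  qed
qed (simp_all add: norm_hdot1_def sgn_hdot1_def dist_hdot1_def uniformity_hdot1_def open_hdot1_def)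

end

lemma norm_hdot1_sq: "(norm u)\<^sup>2 = (\<Sum>\<^sub>\<infinity>n. (of_int n)\<^sup>2 * (cmod (fcoeff u n))\<^sup>2)"
proof -
  have "(norm u)\<^sup>2 = inner u u" by (simp add: power2_norm_eq_inner)
  also have "\<dots> = (\<Sum>\<^sub>\<infinity>n. (of_int n)\<^sup>2 * (cmod (fcoeff u n))\<^sup>2)"
    unfolding inner_hdot1_def by (intro infsum_cong) (simp add: complex_mult_cnj cmod_power2)
  finally show ?thesis .
qed

lemma finite_sum_le_norm_hdot1:
  assumes "finite S"
  shows "(\<Sum>n\<in>S. (of_int n)\<^sup>2 * (cmod (fcoeff u n))\<^sup>2) \<le> (norm u)\<^sup>2"
  unfolding norm_hdot1_sq
  by (rule finite_sum_le_infsum[OF fcoeff_summable assms]) auto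

lemma fcoeff_le_norm: "cmod (fcoeff u n) \<le> norm u"
proof (cases "n = 0")
  case False
  have "1 * (cmod (fcoeff u n))\<^sup>2 \<le> (of_int n)\<^sup>2 * (cmod (fcoeff u n))\<^sup>2"
  proof (intro mult_right_mono)
    have "1 \<le> \<bar>n\<bar>" using False by linarith
    hence "(1::int) \<le> n\<^sup>2" by (metis abs_le_square_iff abs_one one_power2)
    thus "(1::real) \<le> (of_int n)\<^sup>2"
      by (metis of_int_1_le_iff of_int_power)
  qed auto
  also have "\<dots> \<le> (norm u)\<^sup>2" using finite_sum_le_norm_hdot1[of "{n}" u] by simp
  finally show ?thesis by (intro power2_le_imp_le[of "cmod (fcoeff u n)" "norm u"]) simp_all
qed auto

lemma fcoeff_diff: "fcoeff (u - v) n = fcoeff u n - fcoeff v n"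
  by (simp add: minus_hdot1.rep_eq)

instance hdot1 :: complete_space
proof
  fix X :: "nat \<Rightarrow> hdot1"
  assume X: "Cauchy X"
  have "Cauchy (\<lambda>m. fcoeff (X m) n)" for n
    unfolding Cauchy_def
  proof (intro allI impI)
    fix e :: real assume "e > 0"
    then obtain M where "\<forall>m\<ge>M. \<forall>k\<ge>M. dist (X m) (X k) < e"
      using X unfolding Cauchy_def by blast
    moreover have "dist (fcoeff (X m) n) (fcoeff (X k) n) \<le> dist (X m) (X k)" for m k
      using fcoeff_le_norm[of "X m - X k" n] by (simp add: dist_norm fcoeff_diff)
    ultimately show "\<exists>M. \<forall>m\<ge>M. \<forall>k\<ge>M. dist (fcoeff (X m) n) (fcoeff (X k) n) < e"
      by (meson order_le_less_trans)
  qed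
  hence "\<forall>n. \<exists>l. (\<lambda>m. fcoeff (X m) n) \<longlonglongrightarrow> l"
    using Cauchy_convergent convergent_def by blast
  then obtain a where a: "\<And>n. (\<lambda>m. fcoeff (X m) n) \<longlonglongrightarrow> a n" by metis
  have a0: "a 0 = 0" using a[of 0] by (simp add: LIMSEQ_const_iff)
  have bound: "(\<Sum>n\<in>S. (of_int n)\<^sup>2 * (cmod (fcoeff (X m) n - a n))\<^sup>2) \<le> e\<^sup>2"
    if M: "\<forall>m\<ge>M. \<forall>k\<ge>M. dist (X m) (X k) < e" and m: "m \<ge> M" and S: "finite S" for e M m S
  proof (rule LIMSEQ_le_const2)
    show "(\<lambda>k. \<Sum>n\<in>S. (of_int n)\<^sup>2 * (cmod (fcoeff (X m) n - fcoeff (X k) n))\<^sup>2)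
        \<longlonglongrightarrow> (\<Sum>n\<in>S. (of_int n)\<^sup>2 * (cmod (fcoeff (X m) n - a n))\<^sup>2)"
      by (intro tendsto_intros a)
    show "\<exists>N. \<forall>k\<ge>N. (\<Sum>n\<in>S. (of_int n)\<^sup>2 * (cmod (fcoeff (X m) n - fcoeff (X k) n))\<^sup>2) \<le> e\<^sup>2"
    proof (intro exI[of _ M] allI impI)
      fix k assume "k \<ge> M"
      hence "norm (X m - X k) \<le> e" using M m by (auto simp: dist_norm less_imp_le)
      hence "(norm (X m - X k))\<^sup>2 \<le> e\<^sup>2" by (intro power_mono) auto
      thus "(\<Sum>n\<in>S. (of_int n)\<^sup>2 * (cmod (fcoeff (X m) n - fcoeff (X k) n))\<^sup>2) \<le> e\<^sup>2"
        using finite_sum_le_norm_hdot1[OF S, of "X m - X k"] by (simp add: fcoeff_diff)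
    qed
  qed
  have summ: "(\<lambda>n. (of_int n)\<^sup>2 * (cmod (fcoeff (X m) n - a n))\<^sup>2) summable_on UNIV"
    if M: "\<forall>m\<ge>M. \<forall>k\<ge>M. dist (X m) (X k) < e" and m: "m \<ge> M" for e M m
    by (rule nonneg_bdd_above_summable_on)
       (auto intro!: bdd_aboveI[of _ "e\<^sup>2"] bound[OF M m])
  obtain M0 where M0: "\<forall>m\<ge>M0. \<forall>k\<ge>M0. dist (X m) (X k) < 1"
    using X unfolding Cauchy_def by (meson zero_less_one)
  have "(\<lambda>n. (of_int n)\<^sup>2 * (cmod (fcoeff (X M0) n + - (fcoeff (X M0) n - a n)))\<^sup>2) summable_on UNIV"
    by (intro h1_summable_add fcoeff_summable) (use summ[OF M0, of M0] in \<open>simp add: norm_minus_commute\<close>)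
  hence "a \<in> {a. a 0 = 0 \<and> (\<lambda>n. (of_int n)\<^sup>2 * (cmod (a n))\<^sup>2) summable_on UNIV}"
    using a0 by simp
  then have "fcoeff (Abs_hdot1 a) = a" by (rule Abs_hdot1_inverse)
  then obtain x where x: "fcoeff x = a" ..
  have "X \<longlonglongrightarrow> x"
  proof (rule metric_LIMSEQ_I)
    fix r :: real assume "r > 0"
    then obtain M where M: "\<forall>m\<ge>M. \<forall>k\<ge>M. dist (X m) (X k) < r / 2"
      using X unfolding Cauchy_def by (meson half_gt_zero)
    have "dist (X m) x < r" if "m \<ge> M" for m
    proof -
      have "(norm (X m - x))\<^sup>2 \<le> (r / 2)\<^sup>2"
        unfolding norm_hdot1_sq fcoeff_diff x
        by (rule infsum_le_finite_sums[OF summ[OF M that]]) (rule bound[OF M that])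
      hence "norm (X m - x) \<le> r / 2"
        by (rule power2_le_imp_le) (use \<open>r > 0\<close> in simp)
      thus ?thesis using \<open>r > 0\<close> by (simp add: dist_norm)
    qed
    thus "\<exists>no. \<forall>n\<ge>no. dist (X n) x < r" by blast
  qed
  thus "convergent X" by (auto simp: convergent_def)
qed

lemma hdot1_countable_dense:
  "\<exists>D :: hdot1 set. countable D \<and> (\<forall>u. \<forall>e>0. \<exists>d\<in>D. dist u d < e)"
proof -
  obtain Q :: "complex set" where Q: "countable Q" "\<And>U. open U \<Longrightarrow> U \<noteq> {} \<Longrightarrow> \<exists>q\<in>Q. q \<in> U"
    using countable_dense_exists by blast
  define mk :: "(int \<times> complex) list \<Rightarrow> hdot1" where
    "mk xs = Abs_hdot1 (\<lambda>n. if n = 0 then 0 else case map_of xs n of None \<Rightarrow> 0 | Some c \<Rightarrow> c)" for xs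
  have mk: "fcoeff (mk xs) = (\<lambda>n. if n = 0 then 0 else case map_of xs n of None \<Rightarrow> 0 | Some c \<Rightarrow> c)" for xs
    unfolding mk_def
  proof (rule Abs_hdot1_inverse, simp)
    let ?f = "\<lambda>n. (of_int n)\<^sup>2 * (cmod (if n = 0 then 0 else case map_of xs n of None \<Rightarrow> 0 | Some c \<Rightarrow> c))\<^sup>2 :: real"
    have "?f summable_on dom (map_of xs)" by (simp add: finite_dom_map_of)
    moreover have "?f summable_on dom (map_of xs) \<longleftrightarrow> ?f summable_on UNIV"
      by (rule summable_on_cong_neutral) (auto simp: domIff split: option.splits)
    ultimately show "?f summable_on UNIV" by blast
  qed
  show ?thesis
  proof (intro exI[of _ "mk ` lists (UNIV \<times> Q)"] conjI allI impI)
    show "countable (mk ` lists (UNIV \<times> Q))" using Q(1) by blast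
    fix u :: hdot1 and e :: real assume e: "e > 0"
    let ?w = "\<lambda>n. (of_int n)\<^sup>2 * (cmod (fcoeff u n))\<^sup>2 :: real"
    have "(?w has_sum (norm u)\<^sup>2) UNIV"
      unfolding norm_hdot1_sq using fcoeff_summable has_sum_infsum by blast
    hence "eventually (\<lambda>S. dist (sum ?w S) ((norm u)\<^sup>2) < e\<^sup>2 / 2) (finite_subsets_at_top UNIV)"
      unfolding has_sum_def using e by (intro tendstoD) auto
    then obtain S where S: "finite S" "dist (sum ?w S) ((norm u)\<^sup>2) < e\<^sup>2 / 2"
      unfolding eventually_finite_subsets_at_top by blast
    define C where "C = (\<Sum>n\<in>S. (of_int n)\<^sup>2 :: real) + 1"
    have C: "C > 0" unfolding C_def by (intro add_nonneg_pos sum_nonneg) auto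
    have "\<exists>q\<in>Q. q \<in> ball (fcoeff u n) (e / sqrt (2 * C))" for n
    proof (rule Q(2))
      have "e / sqrt (2 * C) > 0" using e C by simp
      thus "ball (fcoeff u n) (e / sqrt (2 * C)) \<noteq> {}" by (metis ball_eq_empty not_less)
    qed simp
    then obtain c where c: "\<And>n. c n \<in> Q" "\<And>n. dist (fcoeff u n) (c n) < e / sqrt (2 * C)"
      unfolding mem_ball by metis
    obtain l where l: "set l = S" using finite_list[OF S(1)] by blast
    define xs where "xs = map (\<lambda>n. (n, c n)) l"
    have xs: "map_of xs n = (if n \<in> S then Some (c n) else None)" for n
      unfolding xs_def map_of_map_restrict using l by (auto simp: restrict_map_def)
    have in_D: "mk xs \<in> mk ` lists (UNIV \<times> Q)"
      by (rule imageI) (use c(1) in \<open>auto simp: xs_def\<close>)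
    let ?d = "\<lambda>n. (of_int n)\<^sup>2 * (cmod (fcoeff (u - mk xs) n))\<^sup>2 :: real"
    have ds: "?d summable_on A" for A
      by (rule summable_on_subset_banach[OF fcoeff_summable]) simp
    have ws: "?w summable_on A" for A
      by (rule summable_on_subset_banach[OF fcoeff_summable]) simp
    have n1: "(norm (u - mk xs))\<^sup>2 = infsum ?d S + infsum ?d (- S)"
      using infsum_Un_disjoint[OF ds ds, of S "- S"] unfolding norm_hdot1_sq by simp
    have n2: "(norm u)\<^sup>2 = infsum ?w S + infsum ?w (- S)"
      using infsum_Un_disjoint[OF ws ws, of S "- S"] unfolding norm_hdot1_sq by simp
    have n3: "infsum ?d (- S) = infsum ?w (- S)"
      by (rule infsum_cong) (simp add: fcoeff_diff mk xs)
    have n4: "infsum ?d S = sum ?d S" "infsum ?w S = sum ?w S"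
      using S(1) by simp_all
    have tail: "(norm (u - mk xs))\<^sup>2 < sum ?d S + e\<^sup>2 / 2"
      using n1 n2 n3 S(2) unfolding n4 dist_real_def by linarith
    have "sum ?d S \<le> (\<Sum>n\<in>S. (of_int n)\<^sup>2 * (e / sqrt (2 * C))\<^sup>2)"
    proof (rule sum_mono)
      fix n assume n: "n \<in> S"
      have "cmod (fcoeff (u - mk xs) n) \<le> e / sqrt (2 * C)"
      proof (cases "n = 0")
        case True
        have "0 \<le> e / sqrt (2 * C)" using e C by simp
        thus ?thesis unfolding True fcoeff_0 norm_zero .
      next
        case False
        hence "fcoeff (mk xs) n = c n" using n by (simp add: mk xs)
        thus ?thesis using c(2)[of n] unfolding fcoeff_diff dist_norm by simp
      qed
      hence "(cmod (fcoeff (u - mk xs) n))\<^sup>2 \<le> (e / sqrt (2 * C))\<^sup>2"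
        by (rule power_mono) simp
      thus "?d n \<le> (of_int n)\<^sup>2 * (e / sqrt (2 * C))\<^sup>2"
        by (rule mult_left_mono) simp
    qed
    also have "\<dots> = (C - 1) * (e\<^sup>2 / (2 * C))"
    proof -
      have "(e / sqrt (2 * C))\<^sup>2 = e\<^sup>2 / (2 * C)" using C by (simp add: power_divide)
      moreover have "(\<Sum>n\<in>S. (of_int n)\<^sup>2) = C - 1" by (simp add: C_def)
      ultimately show ?thesis unfolding sum_distrib_right[symmetric] by simp
    qed
    also have "\<dots> \<le> C * (e\<^sup>2 / (2 * C))" by (rule mult_right_mono) (use C in simp_all)
    also have "\<dots> = e\<^sup>2 / 2" using C by simp
    finally have "(norm (u - mk xs))\<^sup>2 < e\<^sup>2" using tail by linarith
    hence "dist u (mk xs) < e" unfolding dist_norm by (rule power2_less_imp_less) (use e in simp)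
    thus "\<exists>d\<in>mk ` lists (UNIV \<times> Q). dist u d < e" using in_D by blast
  qed
qed

instance hdot1 :: second_countable_topology
proof
  obtain D :: "hdot1 set" where D: "countable D" "\<And>u e. e > 0 \<Longrightarrow> \<exists>d\<in>D. dist u d < e"
    using hdot1_countable_dense by blast
  define B where "B = (\<lambda>(d, k). ball d (1 / real (Suc k))) ` (D \<times> UNIV)"
  have "topological_basis B"
  proof (rule topological_basisI)
    show "open b" if "b \<in> B" for b using that by (auto simp: B_def)
    fix U and u :: hdot1 assume "open U" "u \<in> U"
    then obtain e where e: "e > 0" "ball u e \<subseteq> U" by (meson openE)
    obtain k where k: "1 / real (Suc k) < e / 2"
      using e(1) nat_approx_posE[of "e / 2"] by auto
    obtain d where d: "d \<in> D" "dist u d < 1 / real (Suc k)"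
      using D(2)[of "1 / real (Suc k)" u] by auto
    have "ball d (1 / real (Suc k)) \<subseteq> ball u e"
    proof
      fix y assume "y \<in> ball d (1 / real (Suc k))"
      hence "dist u y < e" using d(2) k dist_triangle[of u y d] by (simp add: mem_ball)
      thus "y \<in> ball u e" by (simp add: mem_ball)
    qed
    thus "\<exists>b\<in>B. u \<in> b \<and> b \<subseteq> U"
      using d e(2) by (intro bexI[of _ "ball d (1 / real (Suc k))"])
                      (auto simp: B_def mem_ball dist_commute)
  qed
  moreover have "countable B" using D(1) by (auto simp: B_def)
  ultimately show "\<exists>B::hdot1 set set. countable B \<and> open = generate_topology B"
    using topological_basis_imp_subbasis by blast
qed

instance hdot1 :: polish_space ..


section \<open>Mean-zero Wiener measure\<close>

definition std_complex_normal :: "complex measure"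
  where "std_complex_normal =
    distr (density lborel std_normal_density \<Otimes>\<^sub>M density lborel std_normal_density) borel
          (\<lambda>(x, y). Complex x y)"

text \<open>The law of the coefficient sequence of \<open>\<Sum>n\<noteq>0. g n / n * e\<^sup>i\<^sup>n\<^sup>x\<close>, where the \<open>g n\<close> are the
  coordinates of the product space, hence independent.\<close>

definition wiener_measure :: "(int \<Rightarrow> complex) measure"
  where "wiener_measure =
    distr (PiM (UNIV - {0}) (\<lambda>_. std_complex_normal)) (PiM UNIV (\<lambda>_. borel))
          (\<lambda>g n. if n = 0 then 0 else g n / of_int n)"


section \<open>Function spaces on the torus\<close>

definition jap :: "int \<Rightarrow> real"
  where "jap n = sqrt (1 + (of_int n)\<^sup>2)"

definition ennpowr :: "ennreal \<Rightarrow> real \<Rightarrow> ennreal"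
  where "ennpowr x r = (if x = \<infinity> then \<infinity> else ennreal (enn2real x powr r))"

definition Lp_norm :: "ennreal \<Rightarrow> 'a measure \<Rightarrow> ('a \<Rightarrow> ennreal) \<Rightarrow> ennreal"
  where "Lp_norm p M f =
    (if p = \<infinity> then esssup M f
     else ennpowr (\<integral>\<^sup>+x. ennpowr (f x) (enn2real p) \<partial>M) (1 / enn2real p))"

abbreviation lp_norm :: "ennreal \<Rightarrow> ('a \<Rightarrow> ennreal) \<Rightarrow> ennreal"
  where "lp_norm p f \<equiv> Lp_norm p (count_space UNIV) f"

definition torus :: "real measure"
  where "torus = restrict_space lborel {0..<2 * pi}"

text \<open>The trigonometric polynomial \<open>\<psi>(D - n) u\<close>, for finitely supported \<open>\<psi>\<close>.\<close>

definition freq_loc :: "(int \<Rightarrow> complex) \<Rightarrow> int \<Rightarrow> (int \<Rightarrow> complex) \<Rightarrow> real \<Rightarrow> complex"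
  where "freq_loc \<psi> n a x = (\<Sum>k | \<psi> (k - n) \<noteq> 0. \<psi> (k - n) * a k * cis (of_int k * x))"

definition modulation_norm ::
    "(int \<Rightarrow> complex) \<Rightarrow> ennreal \<Rightarrow> ennreal \<Rightarrow> real \<Rightarrow> (int \<Rightarrow> complex) \<Rightarrow> ennreal"
  where "modulation_norm \<psi> p q s a =
    lp_norm q (\<lambda>n. ennreal (jap n powr s) * Lp_norm p torus (\<lambda>x. ennreal (cmod (freq_loc \<psi> n a x))))"

definition amalgam_norm ::
    "(int \<Rightarrow> complex) \<Rightarrow> ennreal \<Rightarrow> ennreal \<Rightarrow> real \<Rightarrow> (int \<Rightarrow> complex) \<Rightarrow> ennreal"
  where "amalgam_norm \<psi> p q s a =
    Lp_norm p torus (\<lambda>x. lp_norm q (\<lambda>n. ennreal (jap n powr s * cmod (freq_loc \<psi> n a x))))"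

definition fourier_lebesgue_norm :: "real \<Rightarrow> ennreal \<Rightarrow> (int \<Rightarrow> complex) \<Rightarrow> ennreal"
  where "fourier_lebesgue_norm s q a = lp_norm q (\<lambda>n. ennreal (jap n powr s * cmod (a n)))"

definition schwartz :: "(real \<Rightarrow> complex) \<Rightarrow> bool"
  where "schwartz f \<longleftrightarrow>
    (let D = (\<lambda>k. ((\<lambda>g x. vector_derivative g (at x)) ^^ k) f)
     in \<forall>k. D k differentiable_on UNIV \<and> (\<forall>m::nat. bounded (range (\<lambda>x. x ^ m *\<^sub>R D k x))))"

definition dyadic_piece :: "(real \<Rightarrow> complex) \<Rightarrow> (real \<Rightarrow> complex) \<Rightarrow> nat \<Rightarrow> real \<Rightarrow> complex"
  where "dyadic_piece \<phi>\<^sub>0 \<phi> j \<xi> = (if j = 0 then \<phi>\<^sub>0 \<xi> else \<phi> (\<xi> / 2 ^ j))"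

definition dyadic_partition :: "(real \<Rightarrow> complex) \<Rightarrow> (real \<Rightarrow> complex) \<Rightarrow> bool"
  where "dyadic_partition \<phi>\<^sub>0 \<phi> \<longleftrightarrow> schwartz \<phi>\<^sub>0 \<and> schwartz \<phi> \<and>
    closure {\<xi>. \<phi>\<^sub>0 \<xi> \<noteq> 0} \<subseteq> {\<xi>. \<bar>\<xi>\<bar> \<le> 2} \<and>
    closure {\<xi>. \<phi> \<xi> \<noteq> 0} \<subseteq> {\<xi>. 1 / 2 \<le> \<bar>\<xi>\<bar> \<and> \<bar>\<xi>\<bar> \<le> 2} \<and>
    (\<forall>\<xi>. (\<lambda>j. dyadic_piece \<phi>\<^sub>0 \<phi> j \<xi>) sums 1)"

definition fourier_besov_norm ::
    "(real \<Rightarrow> complex) \<Rightarrow> (real \<Rightarrow> complex) \<Rightarrow> ennreal \<Rightarrow> ennreal \<Rightarrow> real \<Rightarrow> (int \<Rightarrow> complex) \<Rightarrow> ennreal"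
  where "fourier_besov_norm \<phi>\<^sub>0 \<phi> p q s a =
    lp_norm q (\<lambda>j. lp_norm p (\<lambda>n. ennreal (jap n powr s * cmod (dyadic_piece \<phi>\<^sub>0 \<phi> j (of_int n) * a n))))"

text \<open>The closure of the Sobolev space in the space \<open>{a. nrm a < \<infinity>}\<close>.\<close>

definition hdot1_closure :: "((int \<Rightarrow> complex) \<Rightarrow> ennreal) \<Rightarrow> (int \<Rightarrow> complex) set"
  where "hdot1_closure nrm = {a. nrm a < \<infinity> \<and> (\<forall>\<epsilon>>0. \<exists>u. nrm (a - fcoeff u) < \<epsilon>)}"

text \<open>\<open>(X, \<mu>)\<close> is an abstract Wiener space, for \<open>X = {a. nrm a < \<infinity>}\<close> and \<open>\<mu>\<close> the mean-zero Wiener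
  measure.\<close>

definition wiener_AWS :: "((int \<Rightarrow> complex) \<Rightarrow> ennreal) \<Rightarrow> bool"
  where "wiener_AWS nrm \<longleftrightarrow>
    abstract_wiener_space fcoeff (hdot1_closure nrm) (\<lambda>a. enn2real (nrm a)) (measure wiener_measure)"

end

theory Submission
  imports Defs
begin

text \<open>
  Let \<open>H\<close> be the Sobolev space and \<open>X\<close> one of the four function spaces. Four things have to be
  shown: the norm of \<open>X\<close> is a measurable seminorm on \<open>H\<close>, the closure \<open>B\<close> of \<open>H\<close> in \<open>X\<close> is
  complete, the value of the Gaussian measure on a cylinder set is well defined, and the Wiener
  measure of a cylinder set of \<open>B\<close> is the Gaussian measure of the corresponding cylinder set of
  \<open>H\<close>.

  One mechanism serves all spaces. For the standard Gaussian measure on any finite-dimensional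
  subspace, and for the Wiener measure, the \<open>n\<close>-th Fourier coefficient is a complex Gaussian whose
  real and imaginary parts have variance at most \<open>n\<^sup>-\<^sup>2\<close> (Bessel's inequality), so that its \<open>r\<close>-th
  absolute moment is at most \<open>C \<langle>n\<rangle>\<^sup>-\<^sup>r\<close> (\<open>coeff_moment\<close>). Hence the mean of the \<open>r\<close>-th power of
  the Fourier-Lebesgue norm with weight \<open>\<langle>n\<rangle>\<^sup>\<sigma>\<close> is at most \<open>C \<Sum>\<^sub>n \<langle>n\<rangle>\<^bsup>(\<sigma>-1)r\<^esup>\<close>, which is
  finite when \<open>(\<sigma> - 1) r < - 1\<close>. For a subspace that is orthogonal to the frequencies up to \<open>N\<close>
  only the tail \<open>|n| > N\<close> of this sum appears, and Markov's inequality makes the seminorm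
  measurable (\<open>measurable_seminorm_hnorm\<close>); for the Wiener measure the bound says that almost
  every sample lies in \<open>B\<close> (\<open>AE_wiener_closure\<close>). The locale \<open>admissible_norm\<close> collects what is
  used about the norm: besides being a norm, it controls each coefficient, it is compatible with
  frequency truncation, and it is dominated by some Fourier-Lebesgue norm with
  \<open>(\<sigma> - 1) r < - 1\<close>. Truncations converge in \<open>B\<close>, which yields completeness and the
  measurability of \<open>B\<close>.

  The statements about laws are reduced to characteristic functions. A finite family of random
  variables has at most one joint law with given characteristic function
  (\<open>joint_law_eq_of_char\<close>), which follows from the one-dimensional uniqueness theorem by treating
  one coordinate at a time. A standard Gaussian vector in a subspace has characteristic function
  \<open>exp (- |h|\<^sup>2 / 2)\<close> in every orthonormal basis; this gives rotation invariance, hence the value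
  of the cylinder measure is independent of the representation (\<open>gauss_cyl_eq_gauss_vec\<close>). A
  continuous functional on \<open>B\<close> that restricts to \<open>u \<mapsto> u \<bullet> v\<close> is the limit of its values at the
  truncations, so under the Wiener measure its characteristic function is the limit of
  \<open>exp (- |P\<^sub>N v|\<^sup>2 / 2)\<close>, again the Gaussian one (\<open>extends_gauss_cyl_wiener\<close>).

  It remains to see that the four norms are admissible. Fourier-Lebesgue and Fourier-Besov norms
  are mixed sequence norms of weighted coefficients. The strict inequality between \<open>s\<close> and the
  exponent leaves room for an extra weight \<open>\<langle>n\<rangle>\<^sup>\<delta>\<close>, which makes the dyadic sum a geometric series
  and allows an infinite exponent to be replaced by a large finite one. Modulation and
  amalgam norms are equivalent to the Fourier-Lebesgue norm: a frequency window meets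
  boundedly many frequencies, and its coefficients are recovered by integration over the torus,
  together with Minkowski's integral inequality when the integral is outermost.
\<close>


section \<open>Extended powers and \<open>L\<^sup>p\<close> norms\<close>

lemma ennpowr_ennreal [simp]: "0 \<le> x \<Longrightarrow> ennpowr (ennreal x) r = ennreal (x powr r)"
  by (simp add: ennpowr_def)

lemma ennpowr_top [simp]: "ennpowr top r = top" "ennpowr \<infinity> r = \<infinity>"
  by (simp_all add: ennpowr_def)

lemma ennpowr_0 [simp]: "ennpowr 0 r = 0"
  by (simp add: ennpowr_def)

lemma ennpowr_eq_0_iff [simp]: "ennpowr x r = 0 \<longleftrightarrow> x = 0"
  by (cases x) (auto simp: ennpowr_def)

lemma ennpowr_eq_top_iff [simp]: "ennpowr x r = top \<longleftrightarrow> x = top"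
  by (cases x) (auto simp: ennpowr_def)

lemma ennpowr_1 [simp]: "ennpowr x 1 = x"
  by (cases x) (auto simp: ennpowr_def)

lemma ennpowr_ennpowr: "ennpowr (ennpowr x r) t = ennpowr x (r * t)"
  by (cases x) (auto simp: ennpowr_def powr_powr)

lemma ennpowr_inverse [simp]:
  "r > 0 \<Longrightarrow> ennpowr (ennpowr x r) (1 / r) = x"
  "r > 0 \<Longrightarrow> ennpowr (ennpowr x (1 / r)) r = x"
  by (simp_all add: ennpowr_ennpowr)

lemma ennpowr_mono: "x \<le> y \<Longrightarrow> 0 \<le> r \<Longrightarrow> ennpowr x r \<le> ennpowr y r"
  by (cases x; cases y) (auto simp: ennpowr_def top_unique intro!: ennreal_leI powr_mono2)

lemma ennpowr_le_iff: "r > 0 \<Longrightarrow> ennpowr x r \<le> y \<longleftrightarrow> x \<le> ennpowr y (1 / r)"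
  using ennpowr_mono[of "ennpowr x r" y "1 / r"] ennpowr_mono[of x "ennpowr y (1 / r)" r] by auto

lemma ennpowr_mult: "ennpowr (x * y) r = ennpowr x r * ennpowr y r"
  by (cases x; cases y)
     (auto simp: ennpowr_def powr_mult ennreal_mult_top ennreal_top_mult simp flip: ennreal_mult)

lemma ennpowr_SUP: "r > 0 \<Longrightarrow> ennpowr (SUP i\<in>I. f i) r = (SUP i\<in>I. ennpowr (f i) r)"
proof (rule antisym)
  assume r: "r > 0"
  show "ennpowr (SUP i\<in>I. f i) r \<le> (SUP i\<in>I. ennpowr (f i) r)"
    unfolding ennpowr_le_iff[OF r]
    by (intro SUP_least ennpowr_le_iff[OF r, THEN iffD1] SUP_upper)
  show "(SUP i\<in>I. ennpowr (f i) r) \<le> ennpowr (SUP i\<in>I. f i) r"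
    using r by (intro SUP_least ennpowr_mono SUP_upper) auto
qed

lemma borel_measurable_ennpowr [measurable]: "(\<lambda>x. ennpowr x r) \<in> borel_measurable borel"
  unfolding ennpowr_def by measurable

lemma ennreal_exponent_cases:
  fixes p :: ennreal
  assumes "1 \<le> p"
  obtains "p = top" | P where "1 \<le> P" "p = ennreal P"
  using assms by (cases p) auto

lemma Lp_norm_ennreal:
  "0 \<le> P \<Longrightarrow> Lp_norm (ennreal P) M f = ennpowr (\<integral>\<^sup>+x. ennpowr (f x) P \<partial>M) (1 / P)"
  by (simp add: Lp_norm_def)

lemma Lp_norm_top: "Lp_norm top M f = esssup M f"
  by (simp add: Lp_norm_def)

lemma Lp_norm_AE_mono:
  assumes "1 \<le> p" "f \<in> borel_measurable M" "AE x in M. f x \<le> g x"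
  shows "Lp_norm p M f \<le> Lp_norm p M g"
  using assms(1)
proof (cases rule: ennreal_exponent_cases)
  case 1
  with assms show ?thesis by (auto simp: Lp_norm_top intro: esssup_AE_mono)
next
  case (2 P)
  show ?thesis unfolding 2 using 2(1) assms(3)
    by (subst (1 2) Lp_norm_ennreal)
       (auto intro!: ennpowr_mono nn_integral_mono_AE elim!: eventually_mono)
qed

lemma Lp_norm_mono:
  assumes "1 \<le> p" "f \<in> borel_measurable M" "\<And>x. f x \<le> g x"
  shows "Lp_norm p M f \<le> Lp_norm p M g"
  using assms by (intro Lp_norm_AE_mono) auto

lemma Lp_norm_cmult_le:
  assumes p: "1 \<le> p" and [measurable]: "f \<in> borel_measurable M" and c: "0 \<le> c"
  shows "Lp_norm p M (\<lambda>x. ennreal c * f x) \<le> ennreal c * Lp_norm p M f"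
  using p
proof (cases rule: ennreal_exponent_cases)
  case 1
  have "AE x in M. f x \<le> esssup M f" by (rule esssup_AE)
  hence "AE x in M. ennreal c * f x \<le> ennreal c * esssup M f"
    by eventually_elim (rule mult_left_mono, auto)
  thus ?thesis unfolding 1 Lp_norm_top by (intro esssup_I) auto
next
  case (2 P)
  hence "ennpowr (ennpowr (ennreal c) P) (1/P) = ennreal c" by simp
  thus ?thesis unfolding 2 using 2(1)
    by (simp add: Lp_norm_ennreal ennpowr_mult nn_integral_cmult ennpowr_inverse del: ennpowr_ennreal)
qed

lemma Lp_norm_cmult:
  assumes p: "1 \<le> p" and f [measurable]: "f \<in> borel_measurable M" and c: "0 \<le> c"
  shows "Lp_norm p M (\<lambda>x. ennreal c * f x) = ennreal c * Lp_norm p M f"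
proof (rule antisym[OF Lp_norm_cmult_le[OF assms]])
  show "ennreal c * Lp_norm p M f \<le> Lp_norm p M (\<lambda>x. ennreal c * f x)"
  proof (cases "c = 0")
    case False
    have e: "ennreal (1 / c) * (ennreal c * y) = y" "ennreal c * (ennreal (1 / c) * y) = y" for y
      using False c by (simp_all add: mult.assoc[symmetric] flip: ennreal_mult)
    have "Lp_norm p M f \<le> ennreal (1 / c) * Lp_norm p M (\<lambda>x. ennreal c * f x)"
      using Lp_norm_cmult_le[OF p, of "\<lambda>x. ennreal c * f x" M "1 / c"] c by (simp add: e)
    hence "ennreal c * Lp_norm p M f \<le> ennreal c * (ennreal (1 / c) * Lp_norm p M (\<lambda>x. ennreal c * f x))"
      by (rule mult_left_mono) simp
    thus ?thesis by (simp add: e)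
  qed simp
qed

text \<open>Convexity of the power function, in the form that yields Minkowski's inequality: with
  \<open>l = \<parallel>f\<parallel> / (\<parallel>f\<parallel> + \<parallel>g\<parallel>)\<close> the integral of the right-hand side is \<open>(\<parallel>f\<parallel> + \<parallel>g\<parallel>)\<^sup>P\<close>.\<close>

lemma powr_add_le_weighted:
  fixes x y l P :: real
  assumes "1 \<le> P" "0 < l" "l < 1" "0 \<le> x" "0 \<le> y"
  shows "(x + y) powr P \<le> l powr (1 - P) * x powr P + (1 - l) powr (1 - P) * y powr P"
proof -
  have one: "1 \<le> t powr (1 - P)" if "0 < t" "t < 1" for t :: real
  proof -
    have "t powr (P - 1) \<le> 1" using that assms(1) by (intro powr_le1) auto
    moreover have "0 < t powr (P - 1)" using that by simp
    moreover have "t powr (1 - P) = 1 / t powr (P - 1)" using powr_minus_divide[of t "P - 1"] by simp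
    ultimately show ?thesis by simp
  qed
  consider "x = 0" | "y = 0" | "0 < x" "0 < y" using assms by fastforce
  thus ?thesis
  proof cases
    case 1
    show ?thesis using one[of "1 - l"] assms 1 mult_right_mono[of 1 "(1 - l) powr (1 - P)" "y powr P"]
      by simp
  next
    case 2
    show ?thesis using one[of l] assms 2 mult_right_mono[of 1 "l powr (1 - P)" "x powr P"]
      by simp
  next
    case 3
    have "(l * (x / l) + (1 - l) * (y / (1 - l))) powr P
        \<le> l * (x / l) powr P + (1 - l) * (y / (1 - l)) powr P"
      using convex_onD[OF powr_convex[OF assms(1)], of "1 - l" "x / l" "y / (1 - l)"] assms 3
      by (simp add: algebra_simps)
    also have "\<dots> = l powr (1 - P) * x powr P + (1 - l) powr (1 - P) * y powr P"
      using assms 3 by (simp add: powr_divide powr_diff)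
    finally show ?thesis using assms by simp
  qed
qed

lemma ennpowr_add_le_weighted:
  assumes "1 \<le> P" "0 < l" "l < 1"
  shows "ennpowr (x + y) P \<le>
    ennreal (l powr (1 - P)) * ennpowr x P + ennreal ((1 - l) powr (1 - P)) * ennpowr y P"
proof (cases "x = top \<or> y = top")
  case True
  have top: "a * top + b = top" "b + a * top = top" if "a \<noteq> 0" for a b :: ennreal
    using that by (simp_all add: ennreal_mult_top)
  have "ennreal (l powr (1 - P)) \<noteq> 0" "ennreal ((1 - l) powr (1 - P)) \<noteq> 0" using assms by simp_all
  note t = top(1)[OF this(1)] top(2)[OF this(2)]
  from True show ?thesis
  proof
    assume "x = top"
    hence "ennpowr x P = top" by simp
    thus ?thesis by (simp only: t top_greatest)
  next
    assume "y = top"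
    hence "ennpowr y P = top" by simp
    thus ?thesis by (simp only: t top_greatest)
  qed
next
  case False
  then obtain r t where r: "0 \<le> r" "x = ennreal r" and t: "0 \<le> t" "y = ennreal t"
    by (cases x; cases y) auto
  have "ennpowr (x + y) P = ennreal ((r + t) powr P)"
    unfolding r t ennreal_plus[OF r(1) t(1), symmetric] using r t by (intro ennpowr_ennreal) simp
  also have "\<dots> \<le> ennreal (l powr (1 - P) * r powr P + (1 - l) powr (1 - P) * t powr P)"
    by (intro ennreal_leI powr_add_le_weighted assms r t)
  also have "\<dots> = ennreal (l powr (1 - P)) * ennpowr x P + ennreal ((1 - l) powr (1 - P)) * ennpowr y P"
    using r t by (simp add: ennreal_mult)
  finally show ?thesis .
qed

lemma Lp_norm_eq_0_imp_AE:
  assumes p: "1 \<le> p" and [measurable]: "f \<in> borel_measurable M" and "Lp_norm p M f = 0"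
  shows "AE x in M. f x = 0"
  using p
proof (cases rule: ennreal_exponent_cases)
  case 1
  thus ?thesis using assms(3) esssup_AE[where M = M and f = f] by (simp add: Lp_norm_top)
next
  case (2 P)
  hence "(\<integral>\<^sup>+x. ennpowr (f x) P \<partial>M) = 0" using assms(3) by (simp add: Lp_norm_ennreal)
  thus ?thesis by (subst (asm) nn_integral_0_iff_AE) simp_all
qed

lemma Lp_norm_triangle:
  assumes p: "1 \<le> p" and f [measurable]: "f \<in> borel_measurable M"
    and g [measurable]: "g \<in> borel_measurable M"
  shows "Lp_norm p M (\<lambda>x. f x + g x) \<le> Lp_norm p M f + Lp_norm p M g"
  using p
proof (cases rule: ennreal_exponent_cases)
  case 1
  have "AE x in M. f x + g x \<le> esssup M f + esssup M g"
    using esssup_AE[where M = M and f = f] esssup_AE[where M = M and f = g] by eventually_elim (rule add_mono)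
  thus ?thesis unfolding 1 Lp_norm_top by (intro esssup_I) auto
next
  case (2 P)
  define a b where "a = Lp_norm p M f" and "b = Lp_norm p M g"
  consider "a = 0" | "b = 0" | "a = top \<or> b = top" | "0 < a" "a < top" "0 < b" "b < top"
    by (metis top.not_eq_extremum zero_less_iff_neq_zero)
  thus ?thesis
  proof cases
    case 1
    have "AE x in M. f x = 0" by (rule Lp_norm_eq_0_imp_AE[OF p]) (use 1 in \<open>simp_all add: a_def\<close>)
    hence "Lp_norm p M (\<lambda>x. f x + g x) \<le> Lp_norm p M g"
      by (intro Lp_norm_AE_mono p) auto
    thus ?thesis by (rule order_trans) simp
  next
    case 2
    have "AE x in M. g x = 0" by (rule Lp_norm_eq_0_imp_AE[OF p]) (use 2 in \<open>simp_all add: b_def\<close>)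
    hence "Lp_norm p M (\<lambda>x. f x + g x) \<le> Lp_norm p M f"
      by (intro Lp_norm_AE_mono p) auto
    thus ?thesis by (rule order_trans) simp
  next
    case 3
    thus ?thesis by (auto simp: a_def b_def)
  next
    case 4
    then obtain A B where AB: "a = ennreal A" "b = ennreal B" "A > 0" "B > 0"
      by (cases a; cases b) auto
    define l where "l = A / (A + B)"
    have l: "0 < l" "l < 1" "1 - l = B / (A + B)"
      using AB by (auto simp: l_def field_simps)
    have eq: "(\<integral>\<^sup>+x. ennpowr (f x) P \<partial>M) = ennreal (A powr P)"
      "(\<integral>\<^sup>+x. ennpowr (g x) P \<partial>M) = ennreal (B powr P)"
    proof -
      have "ennpowr a P = (\<integral>\<^sup>+x. ennpowr (f x) P \<partial>M)" "ennpowr b P = (\<integral>\<^sup>+x. ennpowr (g x) P \<partial>M)"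
        using 2 by (simp_all add: a_def b_def Lp_norm_ennreal)
      thus "(\<integral>\<^sup>+x. ennpowr (f x) P \<partial>M) = ennreal (A powr P)"
        "(\<integral>\<^sup>+x. ennpowr (g x) P \<partial>M) = ennreal (B powr P)" using AB by simp_all
    qed
    have "(\<integral>\<^sup>+x. ennpowr (f x + g x) P \<partial>M) \<le>
      (\<integral>\<^sup>+x. ennreal (l powr (1 - P)) * ennpowr (f x) P + ennreal ((1 - l) powr (1 - P)) * ennpowr (g x) P \<partial>M)"
      by (intro nn_integral_mono ennpowr_add_le_weighted 2 l)
    also have "\<dots> = ennreal (l powr (1 - P) * A powr P + (1 - l) powr (1 - P) * B powr P)"
      by (subst nn_integral_add) (simp_all add: nn_integral_cmult eq flip: ennreal_mult ennreal_plus)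
    also have "l powr (1 - P) * A powr P + (1 - l) powr (1 - P) * B powr P = (A + B) powr P"
    proof -
      have t: "(C / (A + B)) powr (1 - P) * C powr P = C * (A + B) powr (P - 1)" if "C > 0" for C
        using that AB by (simp add: powr_divide powr_diff)
      have "l powr (1 - P) * A powr P + (1 - l) powr (1 - P) * B powr P
          = (A + B) * (A + B) powr (P - 1)"
        unfolding l(3) unfolding l_def t[OF AB(3)] t[OF AB(4)] by (simp add: algebra_simps)
      also have "\<dots> = (A + B) powr P" using AB by (simp add: powr_diff)
      finally show ?thesis .
    qed
    finally have "ennpowr (\<integral>\<^sup>+x. ennpowr (f x + g x) P \<partial>M) (1 / P) \<le> ennpowr (ennreal ((A + B) powr P)) (1 / P)"
      using 2 by (intro ennpowr_mono) auto
    also have "\<dots> = ennreal (A + B)" using 2 AB by (simp add: powr_powr)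
    also have "\<dots> = a + b" using AB by simp
    finally show ?thesis unfolding a_def b_def using 2 by (simp add: Lp_norm_ennreal)
  qed
qed

lemma Lp_norm_sum:
  assumes p: "1 \<le> p" and "finite K" and "\<And>k. k \<in> K \<Longrightarrow> f k \<in> borel_measurable M"
  shows "Lp_norm p M (\<lambda>x. \<Sum>k\<in>K. f k x) \<le> (\<Sum>k\<in>K. Lp_norm p M (f k))"
  using assms(2,3)
proof (induction K rule: finite_induct)
  case empty
  have "Lp_norm p M (\<lambda>x. ennreal 0 * 0) \<le> ennreal 0 * Lp_norm p M (\<lambda>x. 0)"
    by (rule Lp_norm_cmult_le[OF p]) auto
  thus ?case by simp
next
  case (insert k K)
  have "Lp_norm p M (\<lambda>x. \<Sum>k\<in>insert k K. f k x) \<le> Lp_norm p M (f k) + Lp_norm p M (\<lambda>x. \<Sum>k\<in>K. f k x)"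
    using insert.hyps insert.prems by (simp add: Lp_norm_triangle[OF p])
  also have "\<dots> \<le> (\<Sum>k\<in>insert k K. Lp_norm p M (f k))"
    using insert by (simp add: add_left_mono)
  finally show ?case .
qed

section \<open>Sequence norms\<close>

lemma lp_norm_top: "lp_norm top f = (SUP i. f i)"
proof (rule antisym)
  show "lp_norm top f \<le> (SUP i. f i)"
    unfolding Lp_norm_top by (rule esssup_I) (auto intro: SUP_upper)
  show "(SUP i. f i) \<le> lp_norm top f"
    unfolding Lp_norm_top using esssup_AE[where M = "count_space UNIV" and f = f]
    by (auto simp: AE_count_space intro!: SUP_least)
qed

lemma lp_norm_component:
  assumes "1 \<le> p"
  shows "f i \<le> lp_norm p f"
  using assms
proof (cases rule: ennreal_exponent_cases)
  case 1
  thus ?thesis by (auto simp: lp_norm_top intro: SUP_upper)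
next
  case (2 P)
  have "ennpowr (f i) P \<le> (\<integral>\<^sup>+x. ennpowr (f x) P \<partial>count_space UNIV)"
    by (rule nn_integral_ge_point) simp
  hence "f i \<le> ennpowr (\<integral>\<^sup>+x. ennpowr (f x) P \<partial>count_space UNIV) (1 / P)"
    by (rule ennpowr_le_iff[THEN iffD1, rotated]) (use 2(1) in simp)
  thus ?thesis unfolding 2(2) using 2(1) by (simp add: Lp_norm_ennreal)
qed

lemma lp_norm_mono: "1 \<le> p \<Longrightarrow> (\<And>i. f i \<le> g i) \<Longrightarrow> lp_norm p f \<le> lp_norm p g"
  by (rule Lp_norm_mono) auto

lemma lp_norm_top_le: "1 \<le> p \<Longrightarrow> lp_norm top f \<le> lp_norm p f"
  unfolding lp_norm_top by (intro SUP_least lp_norm_component)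

lemma lp_norm_incseq_SUP:
  assumes "1 \<le> p" and inc: "\<And>i. incseq (\<lambda>N. f N i)"
  shows "lp_norm p (\<lambda>i. SUP N. f N i) = (SUP N::nat. lp_norm p (f N))"
  using assms(1)
proof (cases rule: ennreal_exponent_cases)
  case 1
  show ?thesis unfolding 1 lp_norm_top by (rule SUP_commute)
next
  case (2 P)
  have "(\<integral>\<^sup>+i. ennpowr (SUP N. f N i) P \<partial>count_space UNIV)
      = (\<integral>\<^sup>+i. (SUP N. ennpowr (f N i) P) \<partial>count_space UNIV)"
    using 2(1) by (simp add: ennpowr_SUP)
  also have "\<dots> = (SUP N. \<integral>\<^sup>+i. ennpowr (f N i) P \<partial>count_space UNIV)"
    using inc 2(1) by (intro nn_integral_monotone_convergence_SUP)
      (auto simp: incseq_def le_fun_def intro!: ennpowr_mono)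
  finally show ?thesis using 2 by (simp add: Lp_norm_ennreal ennpowr_SUP)
qed

lemma lp_norm_shift:
  fixes f :: "int \<Rightarrow> ennreal"
  assumes "1 \<le> p"
  shows "lp_norm p (\<lambda>n. f (n + k)) = lp_norm p f"
proof -
  have bij: "bij_betw (\<lambda>n. n + k) UNIV UNIV" by (rule bij_betwI[of _ _ _ "\<lambda>n. n - k"]) auto
  from assms show ?thesis
  proof (cases rule: ennreal_exponent_cases)
    case 1
    have "range (\<lambda>n. f (n + k)) = f ` range (\<lambda>n. n + k)" by (simp only: image_image)
    also have "\<dots> = range f" using bij by (simp only: bij_betw_def)
    finally show ?thesis unfolding 1 lp_norm_top by (rule arg_cong)
  next
    case (2 P)
    thus ?thesis using nn_integral_bij_count_space[OF bij, of "\<lambda>n. ennpowr (f n) P"]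
      by (simp add: Lp_norm_ennreal)
  qed
qed

text \<open>For finite exponents this is the measurability of a parameter integral, over the countable
  index type with counting measure.\<close>

lemma borel_measurable_lp_norm:
  fixes f :: "'i::countable \<Rightarrow> 'a \<Rightarrow> ennreal"
  assumes p: "1 \<le> p" and [measurable]: "\<And>i. f i \<in> borel_measurable M"
  shows "(\<lambda>x. lp_norm p (\<lambda>i. f i x)) \<in> borel_measurable M"
  using p
proof (cases rule: ennreal_exponent_cases)
  case 1
  thus ?thesis unfolding lp_norm_top 1 by (intro borel_measurable_SUP) auto
next
  case (2 P)
  have "(\<lambda>x. \<integral>\<^sup>+i. ennpowr (f i x) P \<partial>count_space UNIV) \<in> borel_measurable M"
  proof (rule sigma_finite_measure.borel_measurable_nn_integral)
    show "sigma_finite_measure (count_space (UNIV::'i set))"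
      by (rule sigma_finite_measure_count_space)
    have "(\<lambda>z. ennpowr (f (fst z) (snd z)) P) \<in> borel_measurable (count_space UNIV \<Otimes>\<^sub>M M)"
      by (rule measurable_pair_measure_countable1) auto
    from measurable_compose[OF measurable_pair_swap' this]
    show "(\<lambda>(x, i). ennpowr (f i x) P) \<in> borel_measurable (M \<Otimes>\<^sub>M count_space UNIV)"
      by (simp add: case_prod_beta')
  qed
  thus ?thesis unfolding 2 using 2(1) by (simp add: Lp_norm_ennreal)
qed

text \<open>Hoelder's inequality against the extremal sequence \<open>F\<^sup>Q\<^sup>-\<^sup>1\<close>: after normalizing both factors,
  each term is bounded by Young's inequality.\<close>

lemma powr_pair_le:
  fixes x F :: "'i \<Rightarrow> real"
  assumes S: "finite S" and Q: "1 \<le> Q" and x: "\<And>n. 0 \<le> x n" and F: "\<And>n. 0 \<le> F n"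
  shows "(\<Sum>n\<in>S. F n powr (Q - 1) * x n) \<le>
    (\<Sum>n\<in>S. F n powr Q) powr (1 - 1 / Q) * (\<Sum>n\<in>S. x n powr Q) powr (1 / Q)"
proof -
  define T G where "T = (\<Sum>n\<in>S. F n powr Q)" and "G = (\<Sum>n\<in>S. x n powr Q)"
  have nn: "0 \<le> T" "0 \<le> G" by (auto simp: T_def G_def sum_nonneg)
  consider "T = 0" | "G = 0" | "T > 0" "G > 0" using nn by fastforce
  thus ?thesis
  proof cases
    case 1
    hence "F n = 0" if "n \<in> S" for n
      using that S by (simp add: T_def sum_nonneg_eq_0_iff)
    thus ?thesis by (simp add: sum_nonneg)
  next
    case 2
    hence "x n = 0" if "n \<in> S" for n
      using that S by (simp add: G_def sum_nonneg_eq_0_iff)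
    thus ?thesis by (simp add: sum_nonneg)
  next
    case 3
    have Y: "F n powr (Q - 1) * x n / (T powr (1 - 1 / Q) * G powr (1 / Q))
        \<le> (1 - 1 / Q) * (F n powr Q / T) + (1 / Q) * (x n powr Q / G)" for n
    proof (cases "F n = 0 \<or> x n = 0")
      case True
      thus ?thesis using Q 3 by auto
    next
      case False
      have "(F n powr Q / T) powr (1 - 1 / Q) * (x n powr Q / G) powr (1 / Q)
        \<le> (1 - 1 / Q) * (F n powr Q / T) + (1 / Q) * (x n powr Q / G)"
        by (rule Youngs_inequality_0) (use Q 3 False in \<open>auto simp: field_simps\<close>)
      moreover have "(F n powr Q / T) powr (1 - 1 / Q) = F n powr (Q - 1) / T powr (1 - 1 / Q)"
      proof -
        have "Q * (1 - 1 / Q) = Q - 1" using Q by (simp add: right_diff_distrib)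
        thus ?thesis using Q 3 by (simp only: powr_divide powr_powr)
      qed
      moreover have "(x n powr Q / G) powr (1 / Q) = x n / G powr (1 / Q)"
        using Q 3 x by (simp add: powr_divide powr_powr)
      ultimately show ?thesis by simp
    qed
    have "(\<Sum>n\<in>S. F n powr (Q - 1) * x n / (T powr (1 - 1 / Q) * G powr (1 / Q)))
        \<le> (\<Sum>n\<in>S. (1 - 1 / Q) * (F n powr Q / T) + (1 / Q) * (x n powr Q / G))"
      by (intro sum_mono Y)
    also have "\<dots> = (1 - 1 / Q) * ((\<Sum>n\<in>S. F n powr Q) / T) + (1 / Q) * ((\<Sum>n\<in>S. x n powr Q) / G)"
      by (simp only: sum.distrib sum_distrib_left sum_divide_distrib)
    also have "\<dots> = 1" unfolding T_def[symmetric] G_def[symmetric] using 3 by simp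
    finally have "(\<Sum>n\<in>S. F n powr (Q - 1) * x n) / (T powr (1 - 1 / Q) * G powr (1 / Q)) \<le> 1"
      by (simp only: sum_divide_distrib)
    moreover have "0 < T powr (1 - 1 / Q) * G powr (1 / Q)" using 3 by simp
    ultimately show ?thesis unfolding T_def[symmetric] G_def[symmetric] by (simp add: divide_le_eq)
  qed
qed

lemma nn_integral_count_space_int:
  fixes f :: "int \<Rightarrow> ennreal"
  shows "(\<integral>\<^sup>+i. f i \<partial>count_space UNIV) = (SUP N::nat. \<Sum>i\<in>{- int N..int N}. f i)"
proof -
  have part: "(\<integral>\<^sup>+i. f i * indicator {- int N..int N} i \<partial>count_space UNIV)
      = (\<Sum>i\<in>{- int N..int N}. f i)" for N
    by (subst nn_integral_count_space'[of "{- int N..int N}"]) auto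
  have "f i = (SUP N::nat. f i * indicator {- int N..int N} i)" for i
  proof (rule antisym)
    show "f i \<le> (SUP N::nat. f i * indicator {- int N..int N} i)"
    proof (rule SUP_upper2[of "nat \<bar>i\<bar>"])
      have "i \<in> {- int (nat \<bar>i\<bar>)..int (nat \<bar>i\<bar>)}" by auto
      thus "f i \<le> f i * indicator {- int (nat \<bar>i\<bar>)..int (nat \<bar>i\<bar>)} i" by (simp del: int_nat_eq)
    qed simp
  qed (auto intro!: SUP_least split: split_indicator)
  hence "(\<integral>\<^sup>+i. f i \<partial>count_space UNIV)
      = (\<integral>\<^sup>+i. (SUP N::nat. f i * indicator {- int N..int N} i) \<partial>count_space UNIV)"
    by simp
  also have "\<dots> = (SUP N::nat. \<integral>\<^sup>+i. f i * indicator {- int N..int N} i \<partial>count_space UNIV)"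
    by (intro nn_integral_monotone_convergence_SUP)
       (auto simp: incseq_def le_fun_def split: split_indicator)
  finally show ?thesis by (simp only: part)
qed

text \<open>Minkowski's integral inequality. Let \<open>F\<^sub>n\<close> be the integral of \<open>f\<^sub>n\<close> and \<open>T\<close> a finite partial
  sum of the \<open>F\<^sub>n\<^sup>Q\<close>. Writing one factor \<open>F\<^sub>n\<close> of each term as an integral and applying Hoelder's
  inequality under the integral sign gives \<open>T \<le> T\<^bsup>1-1/Q\<^esup> \<integral> \<parallel>f(x)\<parallel> dx\<close>.\<close>

lemma lp_norm_nn_integral_le:
  fixes f :: "int \<Rightarrow> 'a \<Rightarrow> real"
  assumes q: "1 \<le> q" and [measurable]: "\<And>n. f n \<in> borel_measurable M" and nonneg: "\<And>n x. 0 \<le> f n x"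
  shows "lp_norm q (\<lambda>n. \<integral>\<^sup>+x. ennreal (f n x) \<partial>M) \<le> (\<integral>\<^sup>+x. lp_norm q (\<lambda>n. ennreal (f n x)) \<partial>M)"
    (is "_ \<le> ?R")
proof (cases "?R = top")
  case False
  have fin: "(\<integral>\<^sup>+x. ennreal (f n x) \<partial>M) \<noteq> top" for n
  proof -
    have "(\<integral>\<^sup>+x. ennreal (f n x) \<partial>M) \<le> ?R"
      by (intro nn_integral_mono lp_norm_component[OF q])
    thus ?thesis using False by (auto simp: top_unique)
  qed
  define F where "F n = enn2real (\<integral>\<^sup>+x. ennreal (f n x) \<partial>M)" for n
  have F: "(\<integral>\<^sup>+x. ennreal (f n x) \<partial>M) = ennreal (F n)" "0 \<le> F n" for n
    using fin[of n] by (auto simp: F_def less_top)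
  from q show ?thesis
  proof (cases rule: ennreal_exponent_cases)
    case 1
    show ?thesis unfolding 1 lp_norm_top
      by (intro SUP_least nn_integral_mono SUP_upper UNIV_I)
  next
    case (2 Q)
    have "(\<Sum>n\<in>S. ennpowr (ennreal (F n)) Q) \<le> ennpowr ?R Q" if S: "finite S" for S
    proof -
      define T where "T = (\<Sum>n\<in>S. F n powr Q)"
      have T: "0 \<le> T" by (simp add: T_def sum_nonneg)
      have powr_split: "F n powr Q = F n powr (Q - 1) * F n" for n
        using F(2)[of n] 2(1) by (cases "F n = 0") (auto simp: powr_diff)
      have "ennreal T = (\<Sum>n\<in>S. ennreal (F n powr (Q - 1)) * (\<integral>\<^sup>+x. ennreal (f n x) \<partial>M))"
        unfolding T_def powr_split using F by (simp add: sum_ennreal flip: ennreal_mult)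
      also have "\<dots> = (\<integral>\<^sup>+x. (\<Sum>n\<in>S. ennreal (F n powr (Q - 1)) * ennreal (f n x)) \<partial>M)"
        by (simp add: nn_integral_sum nn_integral_cmult)
      also have "\<dots> \<le> (\<integral>\<^sup>+x. ennreal (T powr (1 - 1 / Q)) * lp_norm q (\<lambda>n. ennreal (f n x)) \<partial>M)"
      proof (rule nn_integral_mono)
        fix x
        have "(\<Sum>n\<in>S. ennreal (F n powr (Q - 1)) * ennreal (f n x))
            = ennreal (\<Sum>n\<in>S. F n powr (Q - 1) * f n x)"
          using nonneg by (simp add: sum_ennreal flip: ennreal_mult)
        also have "\<dots> \<le> ennreal (T powr (1 - 1 / Q) * (\<Sum>n\<in>S. f n x powr Q) powr (1 / Q))"
          unfolding T_def by (intro ennreal_leI powr_pair_le S 2 nonneg F)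
        also have "\<dots> = ennreal (T powr (1 - 1 / Q)) * ennreal ((\<Sum>n\<in>S. f n x powr Q) powr (1 / Q))"
          by (simp add: ennreal_mult)
        also have "\<dots> \<le> ennreal (T powr (1 - 1 / Q)) * lp_norm q (\<lambda>n. ennreal (f n x))"
        proof (rule mult_left_mono)
          have "ennreal ((\<Sum>n\<in>S. f n x powr Q) powr (1 / Q))
              = ennpowr (\<integral>\<^sup>+n. ennpowr (ennreal (f n x)) Q \<partial>count_space S) (1 / Q)"
            using S nonneg by (simp add: nn_integral_count_space_finite sum_ennreal sum_nonneg)
          also have "\<dots> \<le> ennpowr (\<integral>\<^sup>+n. ennpowr (ennreal (f n x)) Q \<partial>count_space UNIV) (1 / Q)"
            using 2(1) by (subst nn_integral_count_space_indicator)
              (auto intro!: nn_integral_mono ennpowr_mono split: split_indicator)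
          also have "\<dots> = lp_norm q (\<lambda>n. ennreal (f n x))" using 2 by (simp add: Lp_norm_ennreal)
          finally show "ennreal ((\<Sum>n\<in>S. f n x powr Q) powr (1 / Q)) \<le> lp_norm q (\<lambda>n. ennreal (f n x))" .
        qed simp
        finally show "(\<Sum>n\<in>S. ennreal (F n powr (Q - 1)) * ennreal (f n x))
          \<le> ennreal (T powr (1 - 1 / Q)) * lp_norm q (\<lambda>n. ennreal (f n x))" .
      qed
      also have "\<dots> = ennreal (T powr (1 - 1 / Q)) * ?R"
        by (intro nn_integral_cmult borel_measurable_lp_norm q) measurable
      finally have main: "ennreal T \<le> ennreal (T powr (1 - 1 / Q)) * ?R" .
      obtain R where R: "?R = ennreal R" "0 \<le> R" using False by (cases ?R) auto
      have "T \<le> T powr (1 - 1 / Q) * R"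
        using main R T by (simp flip: ennreal_mult)
      hence "T powr (1 / Q) \<le> R"
      proof (cases "T = 0")
        case False
        hence "0 < T powr (1 - 1 / Q)" using T by simp
        moreover have "T powr (1 - 1 / Q) * T powr (1 / Q) = T" using False T by (simp flip: powr_add)
        ultimately show ?thesis
          using \<open>T \<le> T powr (1 - 1 / Q) * R\<close> by (metis mult_le_cancel_left_pos)
      qed (use R in simp)
      hence "(T powr (1 / Q)) powr Q \<le> R powr Q" using 2(1) by (intro powr_mono2) auto
      hence "T \<le> R powr Q" using T 2(1) by (simp add: powr_powr)
      thus ?thesis using R F(2) unfolding T_def by (simp add: sum_ennreal)
    qed
    hence "(\<integral>\<^sup>+n. ennpowr (\<integral>\<^sup>+x. ennreal (f n x) \<partial>M) Q \<partial>count_space UNIV) \<le> ennpowr ?R Q"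
      unfolding nn_integral_count_space_int F(1) by (intro SUP_least) blast
    thus ?thesis unfolding 2(2) using 2(1) by (simp add: Lp_norm_ennreal ennpowr_le_iff)
  qed
qed simp

section \<open>The torus\<close>

lemma emeasure_torus: "emeasure torus (space torus) = ennreal (2 * pi)"
  by (simp add: torus_def emeasure_restrict_space space_restrict_space)

lemma borel_measurable_torusI: "f \<in> borel_measurable borel \<Longrightarrow> f \<in> borel_measurable torus"
  unfolding torus_def by (rule measurable_restrict_space1) simp

text \<open>Since the torus has finite mass, it suffices to integrate \<open>t \<le> 1 + t\<^sup>P\<close> for a function
  normalized to have norm one; the constant is not optimal.\<close>

lemma nn_integral_torus_le_Lp_norm:
  assumes p: "1 \<le> p" and [measurable]: "f \<in> borel_measurable torus"
  shows "(\<integral>\<^sup>+x. f x \<partial>torus) \<le> ennreal (2 * pi + 1) * Lp_norm p torus f"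
  using p
proof (cases rule: ennreal_exponent_cases)
  case 1
  have "(\<integral>\<^sup>+x. f x \<partial>torus) \<le> (\<integral>\<^sup>+x. esssup torus f \<partial>torus)"
    by (intro nn_integral_mono_AE esssup_AE)
  also have "\<dots> = ennreal (2 * pi) * esssup torus f"
    by (simp add: emeasure_torus mult.commute)
  also have "\<dots> \<le> ennreal (2 * pi + 1) * esssup torus f"
    by (intro mult_right_mono ennreal_leI) auto
  finally show ?thesis by (simp add: 1 Lp_norm_top)
next
  case (2 P)
  consider "Lp_norm p torus f = 0" | "Lp_norm p torus f = top" | A where "A > 0" "Lp_norm p torus f = ennreal A"
    by (metis ennreal_cases ennreal_neg linorder_not_less ennreal_0)
  thus ?thesis
  proof cases
    case 1
    hence "(\<integral>\<^sup>+x. f x \<partial>torus) = (\<integral>\<^sup>+x. 0 \<partial>torus)"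
      using Lp_norm_eq_0_imp_AE[OF p _ 1] by (intro nn_integral_cong_AE) auto
    thus ?thesis by simp
  next
    case 2
    thus ?thesis by (simp add: ennreal_mult_top)
  next
    case 3
    have t: "t \<le> 1 + ennpowr t P" for t
    proof (cases t)
      case (real r)
      have "r \<le> 1 + r powr P"
      proof (cases "r \<le> 1")
        case False
        hence "r powr 1 \<le> r powr P" using 2 by (intro powr_mono) auto
        thus ?thesis using False by simp
      qed (simp add: add_increasing2)
      thus ?thesis using real by (simp flip: ennreal_plus ennreal_1)
    qed auto
    have "ennpowr (Lp_norm p torus f) P = (\<integral>\<^sup>+x. ennpowr (f x) P \<partial>torus)"
      using 2 by (simp add: Lp_norm_ennreal)
    hence Ap: "(\<integral>\<^sup>+x. ennpowr (f x) P \<partial>torus) = ennreal (A powr P)" using 3 by simp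
    have "(\<integral>\<^sup>+x. ennreal (1 / A) * f x \<partial>torus) \<le> (\<integral>\<^sup>+x. 1 + ennpowr (ennreal (1 / A) * f x) P \<partial>torus)"
      by (intro nn_integral_mono t)
    also have "\<dots> = ennreal (2 * pi) + ennreal ((1 / A) powr P) * ennreal (A powr P)"
      using 3 by (subst nn_integral_add) (simp_all add: ennpowr_mult nn_integral_cmult Ap emeasure_torus)
    also have "ennreal ((1 / A) powr P) * ennreal (A powr P) = 1"
      using 3 by (simp add: powr_divide flip: ennreal_mult)
    finally have "ennreal (1 / A) * (\<integral>\<^sup>+x. f x \<partial>torus) \<le> ennreal (2 * pi + 1)"
      by (simp add: nn_integral_cmult flip: ennreal_plus ennreal_1)
    hence "ennreal A * (ennreal (1 / A) * (\<integral>\<^sup>+x. f x \<partial>torus)) \<le> ennreal A * ennreal (2 * pi + 1)"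
      by (rule mult_left_mono) simp
    thus ?thesis using 3 by (simp add: mult.assoc[symmetric] mult.commute flip: ennreal_mult)
  qed
qed

lemma Lp_norm_torus_le_const:
  assumes p: "1 \<le> p" and [measurable]: "f \<in> borel_measurable torus" and le: "\<And>x. f x \<le> c"
  shows "Lp_norm p torus f \<le> ennreal (2 * pi + 1) * c"
  using p
proof (cases rule: ennreal_exponent_cases)
  case 1
  have "1 * c \<le> ennreal (2 * pi + 1) * c"
    by (intro mult_right_mono) (auto simp flip: ennreal_1 intro!: ennreal_leI)
  moreover have "esssup torus f \<le> c" using le by (intro esssup_I) auto
  ultimately show ?thesis by (simp add: 1 Lp_norm_top)
next
  case (2 P)
  have "(\<integral>\<^sup>+x. ennpowr (f x) P \<partial>torus) \<le> (\<integral>\<^sup>+x. ennpowr c P \<partial>torus)"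
    using 2 by (intro nn_integral_mono ennpowr_mono le) auto
  also have "\<dots> = ennreal (2 * pi) * ennpowr c P"
    by (simp add: emeasure_torus mult.commute)
  also have "\<dots> \<le> ennreal ((2 * pi + 1) powr P) * ennpowr c P"
  proof (intro mult_right_mono ennreal_leI)
    have "(2 * pi + 1) powr 1 \<le> (2 * pi + 1) powr P" using 2 by (intro powr_mono) auto
    thus "2 * pi \<le> (2 * pi + 1) powr P" by simp
  qed simp
  also have "\<dots> = ennpowr (ennreal (2 * pi + 1) * c) P"
    unfolding ennpowr_mult by (subst ennpowr_ennreal) simp_all
  finally show ?thesis unfolding 2(2) using 2(1) by (simp add: Lp_norm_ennreal ennpowr_le_iff)
qed


section \<open>Joint characteristic functions\<close>

text \<open>With the nonnegative density \<open>g\<close> the measure becomes a finite one; frequency zero shows that the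
  total masses agree, and after normalization the one-dimensional uniqueness theorem applies to the
  images under \<open>X\<close> and \<open>Y\<close>.\<close>

lemma weighted_law_eq_of_char:
  fixes X :: "'a \<Rightarrow> real" and Y :: "'b \<Rightarrow> real"
  assumes "prob_space M" "prob_space M'"
    and X [measurable]: "X \<in> borel_measurable M" and Y [measurable]: "Y \<in> borel_measurable M'"
    and g [measurable]: "g \<in> borel_measurable M" and h [measurable]: "h \<in> borel_measurable M'"
    and bnd: "\<And>x. 0 \<le> g x" "\<And>x. g x \<le> K" "\<And>y. 0 \<le> h y" "\<And>y. h y \<le> K"
    and eq: "\<And>s. (CLINT x|M. complex_of_real (g x) * iexp (s * X x))
        = (CLINT y|M'. complex_of_real (h y) * iexp (s * Y y))"
    and A [measurable]: "A \<in> sets borel"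
  shows "(LINT x|M. g x * indicator A (X x)) = (LINT y|M'. h y * indicator A (Y y))"
proof -
  interpret M: prob_space M by fact
  interpret M': prob_space M' by fact
  have ig: "integrable M g" by (rule M.integrable_const_bound[of _ K]) (use bnd in auto)
  have ih: "integrable M' h" by (rule M'.integrable_const_bound[of _ K]) (use bnd in auto)
  define c where "c = (LINT x|M. g x)"
  have "complex_of_real (LINT x|M. g x) = complex_of_real (LINT y|M'. h y)"
    using eq[of 0] by simp
  hence c': "c = (LINT y|M'. h y)" unfolding c_def of_real_eq_iff .
  have c0: "0 \<le> c" unfolding c_def by (intro integral_nonneg_AE) (use bnd in auto)
  show ?thesis
  proof (cases "c = 0")
    case True
    have "AE x in M. g x = 0"
      using integral_nonneg_eq_0_iff_AE[OF ig] bnd True by (simp add: c_def)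
    hence "(LINT x|M. g x * indicator A (X x)) = (LINT x|M. 0)"
      by (intro integral_cong_AE) auto
    moreover have "AE y in M'. h y = 0"
      using integral_nonneg_eq_0_iff_AE[OF ih] bnd True by (simp add: c')
    hence "(LINT y|M'. h y * indicator A (Y y)) = (LINT y|M'. 0)"
      by (intro integral_cong_AE) auto
    ultimately show ?thesis by simp
  next
    case False
    with c0 have c: "c > 0" by simp
    have law: "real_distribution (distr (density N (\<lambda>x. ennreal (f x / c))) borel Z)
        \<and> char (distr (density N (\<lambda>x. ennreal (f x / c))) borel Z) s
            = (CLINT x|N. complex_of_real (f x) * iexp (s * Z x)) / c
        \<and> c * measure (distr (density N (\<lambda>x. ennreal (f x / c))) borel Z) A
            = (LINT x|N. f x * indicator A (Z x))"
      if N: "prob_space N" and [measurable]: "Z \<in> borel_measurable N" "f \<in> borel_measurable N"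
        and f: "\<And>x. 0 \<le> f x" and int: "integrable N f" "c = (LINT x|N. f x)"
      for N :: "'c measure" and Z f s
    proof -
      let ?D = "density N (\<lambda>x. ennreal (f x / c))"
      have "emeasure ?D (space ?D) = (\<integral>\<^sup>+x. ennreal (f x / c) \<partial>N)"
        by (simp add: emeasure_density cong: nn_integral_cong)
      also have "\<dots> = ennreal (LINT x|N. f x / c)"
        using int f c by (intro nn_integral_eq_integral) auto
      also have "\<dots> = 1" using c int(2) by simp
      finally have "prob_space ?D" by (intro prob_spaceI)
      then interpret D: prob_space ?D .
      interpret R: real_distribution "distr ?D borel Z"
        by (rule D.real_distribution_distr) simp
      have "char (distr ?D borel Z) s = (CLINT x|N. (f x / c) *\<^sub>R iexp (s * Z x))"
        unfolding char_def using f c by (subst integral_distr) (auto simp: integral_density)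
      also have "\<dots> = (CLINT x|N. (complex_of_real (f x) * iexp (s * Z x)) / c)"
        by (intro Bochner_Integration.integral_cong) (auto simp: scaleR_conv_of_real)
      also have "\<dots> = (CLINT x|N. complex_of_real (f x) * iexp (s * Z x)) / c"
        by (rule integral_divide_zero)
      finally have 1: "char (distr ?D borel Z) s = (CLINT x|N. complex_of_real (f x) * iexp (s * Z x)) / c" .
      have "measure (distr ?D borel Z) A = (LINT x|distr ?D borel Z. indicator A x)"
        by simp
      also have "\<dots> = (LINT x|N. (f x / c) *\<^sub>R indicator A (Z x))"
        using f c by (subst integral_distr) (auto simp: integral_density)
      also have "\<dots> = (LINT x|N. (f x * indicator A (Z x)) / c)"
        by (intro Bochner_Integration.integral_cong) auto
      also have "\<dots> = (LINT x|N. f x * indicator A (Z x)) / c" by (rule integral_divide_zero)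
      finally show ?thesis using 1 c R.real_distribution_axioms by simp
    qed
    note L = law[OF assms(1) X g bnd(1) ig c_def] and L' = law[OF assms(2) Y h bnd(3) ih c']
    have "distr (density M (\<lambda>x. ennreal (g x / c))) borel X = distr (density M' (\<lambda>x. ennreal (h x / c))) borel Y"
      using L L' eq by (intro Levy_uniqueness ext) auto
    thus ?thesis using L L' by metis
  qed
qed

text \<open>Coordinates are turned one at a time from a frequency \<open>t\<^sub>k\<close> into an event \<open>A\<^sub>k\<close>. The weight is
  then complex, so the one-dimensional step is applied to \<open>w\<close>, \<open>w (1 + cos \<theta>)\<close> and
  \<open>w (1 + sin \<theta>)\<close>, where \<open>w\<close> is the indicator of the events already treated and \<open>\<theta>\<close> is the phase
  of the remaining coordinates.\<close>

lemma mixed_char_eq: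
  fixes X :: "nat \<Rightarrow> 'a \<Rightarrow> real" and Y :: "nat \<Rightarrow> 'b \<Rightarrow> real"
  assumes M: "prob_space M" and M': "prob_space M'"
    and X: "\<And>j. j < n \<Longrightarrow> X j \<in> borel_measurable M"
    and Y: "\<And>j. j < n \<Longrightarrow> Y j \<in> borel_measurable M'"
    and eq: "\<And>t. (CLINT x|M. iexp (\<Sum>j<n. t j * X j x)) = (CLINT y|M'. iexp (\<Sum>j<n. t j * Y j y))"
    and "k \<le> n" and A: "\<And>j. A j \<in> sets borel"
  shows "(CLINT x|M. complex_of_real (\<Prod>j<k. indicator (A j) (X j x)) * iexp (\<Sum>j\<in>{k..<n}. t j * X j x))
    = (CLINT y|M'. complex_of_real (\<Prod>j<k. indicator (A j) (Y j y)) * iexp (\<Sum>j\<in>{k..<n}. t j * Y j y))"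
  using \<open>k \<le> n\<close>
proof (induction k arbitrary: t)
  case 0
  show ?case using eq[of t] by (simp add: atLeast0LessThan)
next
  case (Suc k)
  interpret M: prob_space M by fact
  interpret M': prob_space M' by fact
  have k: "k < n" using Suc.prems by simp
  note A [measurable]
  have [measurable]: "X k \<in> borel_measurable M" "Y k \<in> borel_measurable M'" using X Y k by auto
  define w where "w x = (\<Prod>j<k. indicator (A j) (X j x) :: real)" for x
  define w' where "w' y = (\<Prod>j<k. indicator (A j) (Y j y) :: real)" for y
  define \<theta> where "\<theta> x = (\<Sum>j\<in>{Suc k..<n}. t j * X j x)" for x
  define \<theta>' where "\<theta>' y = (\<Sum>j\<in>{Suc k..<n}. t j * Y j y)" for y
  have [measurable]: "w \<in> borel_measurable M" "\<theta> \<in> borel_measurable M"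
    unfolding w_def[abs_def] \<theta>_def[abs_def]
    by (intro borel_measurable_prod borel_measurable_sum borel_measurable_times borel_measurable_const
        measurable_compose[OF _ borel_measurable_indicator[OF A]] X; use k in simp)+
  have [measurable]: "w' \<in> borel_measurable M'" "\<theta>' \<in> borel_measurable M'"
    unfolding w'_def[abs_def] \<theta>'_def[abs_def]
    by (intro borel_measurable_prod borel_measurable_sum borel_measurable_times borel_measurable_const
        measurable_compose[OF _ borel_measurable_indicator[OF A]] Y; use k in simp)+
  have w01: "w x \<in> {0, 1}" "w' y \<in> {0, 1}" for x y
    unfolding w_def w'_def by (induction k) (auto simp: indicator_def)
  have w: "0 \<le> w x" "w x \<le> 1" "0 \<le> w' y" "w' y \<le> 1" for x y
    using w01(1)[of x] w01(2)[of y] by auto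
  have int: "integrable M (\<lambda>x. complex_of_real (w x) * iexp (f x))"
    if [measurable]: "f \<in> borel_measurable M" for f
    by (rule M.integrable_const_bound[of _ 1]) (use w in \<open>auto simp: norm_mult\<close>)
  have int': "integrable M' (\<lambda>x. complex_of_real (w' x) * iexp (f x))"
    if [measurable]: "f \<in> borel_measurable M'" for f
    by (rule M'.integrable_const_bound[of _ 1]) (use w in \<open>auto simp: norm_mult\<close>)
  have IH: "(CLINT x|M. complex_of_real (w x) * iexp (c * \<theta> x + s * X k x))
      = (CLINT y|M'. complex_of_real (w' y) * iexp (c * \<theta>' y + s * Y k y))" for s c
  proof -
    have sp: "{k..<n} = insert k {Suc k..<n}" using k by auto
    have "(\<Sum>j\<in>{k..<n}. ((\<lambda>j. c * t j)(k := s)) j * X j x) = c * \<theta> x + s * X k x" for x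
      unfolding sp \<theta>_def by (subst sum.insert) (auto simp: sum_distrib_left mult.assoc)
    moreover have "(\<Sum>j\<in>{k..<n}. ((\<lambda>j. c * t j)(k := s)) j * Y j y) = c * \<theta>' y + s * Y k y" for y
      unfolding sp \<theta>'_def by (subst sum.insert) (auto simp: sum_distrib_left mult.assoc)
    ultimately show ?thesis
      using Suc.IH[of "(\<lambda>j. c * t j)(k := s)"] k by (simp add: w_def w'_def)
  qed
  have iexp_phase: "iexp (0 * \<theta> + u) = iexp u" "iexp (1 * \<theta> + u) = cis \<theta> * iexp u"
    "iexp (-1 * \<theta> + u) = cis (- \<theta>) * iexp u" for \<theta> u :: real
    by (simp_all add: cis_conv_exp ring_distribs flip: exp_add)
  have iexp_cos: "complex_of_real (w * (1 + cos \<theta>)) * iexp u =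
      complex_of_real w * iexp (0 * \<theta> + u) +
      (complex_of_real w * iexp (1 * \<theta> + u) + 1 * (complex_of_real w * iexp (-1 * \<theta> + u))) / 2" for w \<theta> u :: real
    unfolding iexp_phase by (simp add: complex_eq_iff algebra_simps)
  have iexp_sin: "complex_of_real (w * (1 + sin \<theta>)) * iexp u =
      complex_of_real w * iexp (0 * \<theta> + u) +
      (complex_of_real w * iexp (1 * \<theta> + u) + (- 1) * (complex_of_real w * iexp (-1 * \<theta> + u))) / (2 * \<i>)" for w \<theta> u :: real
    unfolding iexp_phase by (simp add: complex_eq_iff Re_divide Im_divide field_simps power2_eq_square)
  have lin: "(CLINT x|N. a x + (b x + e * c x) / d) = (CLINT x|N. a x) + ((CLINT x|N. b x) + e * (CLINT x|N. c x)) / d"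
    if "integrable N a" "integrable N b" "integrable N c" for N :: "'c measure" and a b c and d e :: complex
    using that by simp
  have E0: "(LINT x|M. w x * indicator (A k) (X k x)) = (LINT y|M'. w' y * indicator (A k) (Y k y))"
    by (rule weighted_law_eq_of_char[where K = 1, OF M M']) (use w IH[of 0] in auto)
  have Ec: "(LINT x|M. w x * (1 + cos (\<theta> x)) * indicator (A k) (X k x))
      = (LINT y|M'. w' y * (1 + cos (\<theta>' y)) * indicator (A k) (Y k y))"
  proof (rule weighted_law_eq_of_char[where K = 2, OF M M'])
    have "1 + cos a \<ge> 0 \<and> 1 + cos a \<le> 2" for a :: real
      using cos_ge_minus_one[of a] cos_le_one[of a] by linarith
    hence b: "0 \<le> v * (1 + cos a) \<and> v * (1 + cos a) \<le> 2" if "v \<in> {0, 1}" for v a :: real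
      using that by auto
    show "0 \<le> w x * (1 + cos (\<theta> x))" "w x * (1 + cos (\<theta> x)) \<le> 2"
      "0 \<le> w' y * (1 + cos (\<theta>' y))" "w' y * (1 + cos (\<theta>' y)) \<le> 2" for x y
      using b w01 by auto
    show "(CLINT x|M. complex_of_real (w x * (1 + cos (\<theta> x))) * iexp (s * X k x))
        = (CLINT y|M'. complex_of_real (w' y * (1 + cos (\<theta>' y))) * iexp (s * Y k y))" for s
      unfolding iexp_cos
      by (rule trans[OF lin trans[OF _ lin[symmetric]]], (rule int, measurable)+, simp only: IH, (rule int', measurable)+)
  qed measurable
  have Es: "(LINT x|M. w x * (1 + sin (\<theta> x)) * indicator (A k) (X k x))
      = (LINT y|M'. w' y * (1 + sin (\<theta>' y)) * indicator (A k) (Y k y))"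
  proof (rule weighted_law_eq_of_char[where K = 2, OF M M'])
    have "1 + sin a \<ge> 0 \<and> 1 + sin a \<le> 2" for a :: real
      using sin_ge_minus_one[of a] sin_le_one[of a] by linarith
    hence b: "0 \<le> v * (1 + sin a) \<and> v * (1 + sin a) \<le> 2" if "v \<in> {0, 1}" for v a :: real
      using that by auto
    show "0 \<le> w x * (1 + sin (\<theta> x))" "w x * (1 + sin (\<theta> x)) \<le> 2"
      "0 \<le> w' y * (1 + sin (\<theta>' y))" "w' y * (1 + sin (\<theta>' y)) \<le> 2" for x y
      using b w01 by auto
    show "(CLINT x|M. complex_of_real (w x * (1 + sin (\<theta> x))) * iexp (s * X k x))
        = (CLINT y|M'. complex_of_real (w' y * (1 + sin (\<theta>' y))) * iexp (s * Y k y))" for s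
      unfolding iexp_sin
      by (rule trans[OF lin trans[OF _ lin[symmetric]]], (rule int, measurable)+, simp only: IH, (rule int', measurable)+)
  qed measurable
  have cs: "(CLINT x|N. complex_of_real (\<Prod>j<Suc k. indicator (A j) (Z j x)) * iexp (f x))
      = complex_of_real ((LINT x|N. v x * (1 + cos (f x)) * indicator (A k) (Z k x))
           - (LINT x|N. v x * indicator (A k) (Z k x)))
        + \<i> * complex_of_real ((LINT x|N. v x * (1 + sin (f x)) * indicator (A k) (Z k x))
           - (LINT x|N. v x * indicator (A k) (Z k x)))"
    if N: "prob_space N" and [measurable]: "Z k \<in> borel_measurable N" "f \<in> borel_measurable N" "v \<in> borel_measurable N"
      and v: "\<And>x. v x = (\<Prod>j<k. indicator (A j) (Z j x))" "\<And>x. v x \<in> {0,1}"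
    for N :: "'c measure" and Z f v
  proof -
    interpret N: prob_space N by fact
    have bd: "\<bar>v x\<bar> \<le> 1" "\<bar>1 + cos (f x)\<bar> \<le> 2" "\<bar>1 + sin (f x)\<bar> \<le> 2" for x
    proof -
      show "\<bar>v x\<bar> \<le> 1" using v(2)[of x] by auto
      show "\<bar>1 + cos (f x)\<bar> \<le> 2" using cos_ge_minus_one[of "f x"] cos_le_one[of "f x"] by linarith
      show "\<bar>1 + sin (f x)\<bar> \<le> 2" using sin_ge_minus_one[of "f x"] sin_le_one[of "f x"] by linarith
    qed
    let ?I = "\<lambda>x. indicator (A k) (Z k x) :: real"
    have I: "\<bar>?I x\<bar> \<le> 1" for x by (simp add: indicator_def)
    have i1: "integrable N (\<lambda>x. v x * ?I x)"
    proof (rule N.integrable_const_bound[of _ 1], rule AE_I2)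
      show "norm (v x * ?I x) \<le> 1" for x
        using mult_mono[OF bd(1)[of x] I[of x]] by (simp add: abs_mult)
    qed measurable
    have i2: "integrable N (\<lambda>x. v x * (1 + cos (f x)) * ?I x)"
    proof (rule N.integrable_const_bound[of _ 2], rule AE_I2)
      show "norm (v x * (1 + cos (f x)) * ?I x) \<le> 2" for x
        using mult_mono[OF mult_mono[OF bd(1)[of x] bd(2)[of x]] I[of x]] by (simp add: abs_mult)
    qed measurable
    have i3: "integrable N (\<lambda>x. v x * (1 + sin (f x)) * ?I x)"
    proof (rule N.integrable_const_bound[of _ 2], rule AE_I2)
      show "norm (v x * (1 + sin (f x)) * ?I x) \<le> 2" for x
        using mult_mono[OF mult_mono[OF bd(1)[of x] bd(3)[of x]] I[of x]] by (simp add: abs_mult)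
    qed measurable
    have "(CLINT x|N. complex_of_real (\<Prod>j<Suc k. indicator (A j) (Z j x)) * iexp (f x))
      = (CLINT x|N. complex_of_real (v x * (1 + cos (f x)) * ?I x - v x * ?I x)
          + \<i> * complex_of_real (v x * (1 + sin (f x)) * ?I x - v x * ?I x))"
      by (intro Bochner_Integration.integral_cong)
         (auto simp: v(1) cis_conv_exp[symmetric] cis.code complex_eq_iff algebra_simps)
    also have "\<dots> = complex_of_real (LINT x|N. v x * (1 + cos (f x)) * ?I x - v x * ?I x)
        + \<i> * complex_of_real (LINT x|N. v x * (1 + sin (f x)) * ?I x - v x * ?I x)"
      using i1 i2 i3 by (subst Bochner_Integration.integral_add) (auto simp del: of_real_diff of_real_mult)
    finally show ?thesis using i1 i2 i3 by simp
  qed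
  show ?case
    using cs[OF M, of X \<theta> w] cs[OF M', of Y \<theta>' w'] E0 Ec Es w01
    by (simp add: w_def[symmetric] w'_def[symmetric] \<theta>_def[symmetric] \<theta>'_def[symmetric] del: prod.lessThan_Suc)
qed

text \<open>When all coordinates have been turned into events, the two laws agree on measurable boxes, and
  these determine a finite measure on the product.\<close>

theorem joint_law_eq_of_char:
  fixes X :: "nat \<Rightarrow> 'a \<Rightarrow> real" and Y :: "nat \<Rightarrow> 'b \<Rightarrow> real"
  assumes M: "prob_space M" and M': "prob_space M'"
    and X: "\<And>j. j < n \<Longrightarrow> X j \<in> borel_measurable M"
    and Y: "\<And>j. j < n \<Longrightarrow> Y j \<in> borel_measurable M'"
    and eq: "\<And>t. (CLINT x|M. iexp (\<Sum>j<n. t j * X j x)) = (CLINT y|M'. iexp (\<Sum>j<n. t j * Y j y))"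
  shows "distr M (PiM {..<n} (\<lambda>_. borel)) (\<lambda>x. \<lambda>j\<in>{..<n}. X j x)
    = distr M' (PiM {..<n} (\<lambda>_. borel)) (\<lambda>y. \<lambda>j\<in>{..<n}. Y j y)"
proof -
  interpret M: prob_space M by fact
  interpret M': prob_space M' by fact
  have mX [measurable]: "(\<lambda>x. \<lambda>j\<in>{..<n}. X j x) \<in> measurable M (PiM {..<n} (\<lambda>_. borel))"
    by (rule measurable_restrict) (use X in auto)
  have mY [measurable]: "(\<lambda>y. \<lambda>j\<in>{..<n}. Y j y) \<in> measurable M' (PiM {..<n} (\<lambda>_. borel))"
    by (rule measurable_restrict) (use Y in auto)
  interpret DX: prob_space "distr M (PiM {..<n} (\<lambda>_. borel)) (\<lambda>x. \<lambda>j\<in>{..<n}. X j x)"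
    by (rule M.prob_space_distr) (rule mX)
  interpret DY: prob_space "distr M' (PiM {..<n} (\<lambda>_. borel)) (\<lambda>y. \<lambda>j\<in>{..<n}. Y j y)"
    by (rule M'.prob_space_distr) (rule mY)
  show ?thesis
  proof (rule measure_eqI_PiM_finite[where A = "\<lambda>_. \<Pi>\<^sub>E i\<in>{..<n}. UNIV"])
    fix A :: "nat \<Rightarrow> real set" assume A: "\<And>i. i \<in> {..<n} \<Longrightarrow> A i \<in> sets borel"
    define A' where "A' i = (if i < n then A i else UNIV)" for i
    have A' [measurable]: "A' i \<in> sets borel" for i using A by (auto simp: A'_def)
    have rect: "emeasure (distr N (PiM {..<n} (\<lambda>_. borel)) (\<lambda>x. \<lambda>j\<in>{..<n}. Z j x)) (Pi\<^sub>E {..<n} A)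
        = ennreal (LINT x|N. (\<Prod>j<n. indicator (A' j) (Z j x)))"
      if N: "prob_space N" and Z: "\<And>j. j < n \<Longrightarrow> Z j \<in> borel_measurable N"
      for N :: "'c measure" and Z
    proof -
      interpret N: prob_space N by fact
      have [measurable]: "(\<lambda>x. \<lambda>j\<in>{..<n}. Z j x) \<in> measurable N (PiM {..<n} (\<lambda>_. borel))"
        by (rule measurable_restrict) (use Z in auto)
      have P: "Pi\<^sub>E {..<n} A \<in> sets (PiM {..<n} (\<lambda>_. borel))" using A by auto
      have "emeasure (distr N (PiM {..<n} (\<lambda>_. borel)) (\<lambda>x. \<lambda>j\<in>{..<n}. Z j x)) (Pi\<^sub>E {..<n} A)
          = emeasure N ((\<lambda>x. \<lambda>j\<in>{..<n}. Z j x) -` Pi\<^sub>E {..<n} A \<inter> space N)"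
        using P by (rule emeasure_distr[rotated]) measurable
      also have "\<dots> = ennreal (measure N ((\<lambda>x. \<lambda>j\<in>{..<n}. Z j x) -` Pi\<^sub>E {..<n} A \<inter> space N))"
        by (simp add: N.emeasure_eq_measure)
      also have "measure N ((\<lambda>x. \<lambda>j\<in>{..<n}. Z j x) -` Pi\<^sub>E {..<n} A \<inter> space N)
          = (LINT x|N. indicator ((\<lambda>x. \<lambda>j\<in>{..<n}. Z j x) -` Pi\<^sub>E {..<n} A \<inter> space N) x)"
        by simp
      also have "\<dots> = (LINT x|N. (\<Prod>j<n. indicator (A' j) (Z j x)))"
      proof (intro Bochner_Integration.integral_cong refl)
        fix x assume x: "x \<in> space N"
        show "indicator ((\<lambda>x. \<lambda>j\<in>{..<n}. Z j x) -` Pi\<^sub>E {..<n} A \<inter> space N) x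
            = (\<Prod>j<n. indicator (A' j) (Z j x) :: real)"
        proof (cases "\<forall>j<n. Z j x \<in> A j")
          case True
          thus ?thesis using x by (auto simp: A'_def)
        next
          case False
          then obtain j where j: "j < n" "Z j x \<notin> A j" by blast
          hence "(\<Prod>j<n. indicator (A' j) (Z j x) :: real) = 0"
            by (intro prod_zero) (auto simp: A'_def intro!: bexI[of _ j])
          moreover have "x \<notin> (\<lambda>x. \<lambda>j\<in>{..<n}. Z j x) -` Pi\<^sub>E {..<n} A"
            using j by (auto simp: PiE_iff)
          ultimately show ?thesis by simp
        qed
      qed
      finally show ?thesis .
    qed
    have "complex_of_real (LINT x|M. (\<Prod>j<n. indicator (A' j) (X j x)))
        = complex_of_real (LINT y|M'. (\<Prod>j<n. indicator (A' j) (Y j y)))"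
      using mixed_char_eq[where A = A' and k = n and t = "\<lambda>_. 0", OF M M' X Y eq order_refl A']
      by (simp del: of_real_prod)
    hence "(LINT x|M. (\<Prod>j<n. indicator (A' j) (X j x) :: real))
        = (LINT y|M'. (\<Prod>j<n. indicator (A' j) (Y j y)))"
      unfolding of_real_eq_iff .
    thus "emeasure (distr M (PiM {..<n} (\<lambda>_. borel)) (\<lambda>x. \<lambda>j\<in>{..<n}. X j x)) (Pi\<^sub>E {..<n} A)
      = emeasure (distr M' (PiM {..<n} (\<lambda>_. borel)) (\<lambda>y. \<lambda>j\<in>{..<n}. Y j y)) (Pi\<^sub>E {..<n} A)"
      by (subst (1 2) rect) (use M M' X Y in auto)
  qed (auto simp: space_PiM intro!: prod_algebraI_finite)
qed


section \<open>Standard Gaussian vectors in finite-dimensional subspaces\<close>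

definition orthonormal :: "nat \<Rightarrow> (nat \<Rightarrow> 'h::real_inner) \<Rightarrow> bool"
  where "orthonormal n e \<longleftrightarrow> (\<forall>i<n. \<forall>j<n. e i \<bullet> e j = (if i = j then 1 else 0))"

lemma inner_orthonormal_sum:
  assumes "orthonormal n e" "j < n"
  shows "(\<Sum>i<n. c i *\<^sub>R e i) \<bullet> e j = c j"
proof -
  have "(\<Sum>i<n. c i *\<^sub>R e i) \<bullet> e j = (\<Sum>i<n. if i = j then c i else 0)"
    unfolding inner_sum_left using assms by (intro sum.cong) (auto simp: orthonormal_def)
  thus ?thesis using assms(2) by simp
qed

lemma orthonormal_expansion:
  assumes e: "orthonormal n e" and h: "h \<in> span (e ` {..<n})"
  shows "h = (\<Sum>i<n. (h \<bullet> e i) *\<^sub>R e i)"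
proof -
  have "(\<Sum>i<n. (h \<bullet> e i) *\<^sub>R e i) = h"
  proof (rule span_induct[OF h, where P = "\<lambda>h. (\<Sum>i<n. (h \<bullet> e i) *\<^sub>R e i) = h"])
    show "subspace {h. (\<Sum>i<n. (h \<bullet> e i) *\<^sub>R e i) = h}"
      by (auto simp: subspace_def inner_add_left scaleR_add_left sum.distrib
          simp flip: scaleR_scaleR scaleR_sum_right)
    fix x assume "x \<in> e ` {..<n}"
    then obtain j where j: "j < n" "x = e j" by auto
    have "(\<Sum>i<n. (e j \<bullet> e i) *\<^sub>R e i) = (\<Sum>i<n. if i = j then e i else 0)"
      using e j by (intro sum.cong) (auto simp: orthonormal_def)
    thus "(\<Sum>i<n. (x \<bullet> e i) *\<^sub>R e i) = x" using j by simp
  qed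
  thus ?thesis by simp
qed

lemma norm_orthonormal_sum:
  assumes "orthonormal n e"
  shows "(norm (\<Sum>i<n. c i *\<^sub>R e i))\<^sup>2 = (\<Sum>i<n. (c i)\<^sup>2)"
proof -
  have "(norm (\<Sum>i<n. c i *\<^sub>R e i))\<^sup>2 = (\<Sum>j<n. c j * ((\<Sum>i<n. c i *\<^sub>R e i) \<bullet> e j))"
    by (simp add: power2_norm_eq_inner inner_sum_right[of _ "\<lambda>i. c i *\<^sub>R e i"])
  also have "\<dots> = (\<Sum>i<n. (c i)\<^sup>2)"
    by (intro sum.cong) (auto simp: inner_orthonormal_sum[OF assms] power2_eq_square)
  finally show ?thesis .
qed

lemma orthonormal_parseval:
  assumes "orthonormal n e" "h \<in> span (e ` {..<n})"
  shows "(\<Sum>i<n. (e i \<bullet> h)\<^sup>2) = (norm h)\<^sup>2"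
  using norm_orthonormal_sum[OF assms(1), of "\<lambda>i. h \<bullet> e i"] orthonormal_expansion[OF assms]
  by (simp add: inner_commute)

lemma orthonormal_bessel:
  assumes e: "orthonormal n e"
  shows "(\<Sum>i<n. (e i \<bullet> h)\<^sup>2) \<le> (norm h)\<^sup>2"
proof -
  let ?p = "\<Sum>i<n. (e i \<bullet> h) *\<^sub>R e i"
  have "?p \<bullet> h = (\<Sum>i<n. (e i \<bullet> h)\<^sup>2)" by (simp add: inner_sum_left power2_eq_square)
  moreover have "0 \<le> (norm (h - ?p))\<^sup>2" by simp
  ultimately show ?thesis
    using norm_orthonormal_sum[OF e, of "\<lambda>i. e i \<bullet> h"]
    by (simp add: power2_norm_eq_inner inner_diff_left inner_diff_right inner_commute)
qed

lemma onb_of_exists: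
  fixes S :: "'h::real_inner set"
  assumes "finite S"
  shows "\<exists>e. onb_of (span S) e"
proof -
  obtain C where C: "finite C" "span C = span S" "pairwise orthogonal C"
    using basis_orthogonal[OF assms] by blast
  define D where "D = (\<lambda>x. x /\<^sub>R norm x) ` (C - {0})"
  have "finite D" using C by (simp add: D_def)
  have ort: "x \<bullet> y = (if x = y then 1 else 0)" if "x \<in> D" "y \<in> D" for x y
  proof -
    obtain a where a: "a \<in> C" "a \<noteq> 0" "x = a /\<^sub>R norm a" using \<open>x \<in> D\<close> by (auto simp: D_def)
    obtain b where b: "b \<in> C" "b \<noteq> 0" "y = b /\<^sub>R norm b" using \<open>y \<in> D\<close> by (auto simp: D_def)
    note ab = a b
    show ?thesis
    proof (cases "a = b")
      case True
      have "x \<bullet> x = 1" using ab by (simp add: dot_square_norm power2_eq_square)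
      thus ?thesis using True ab by simp
    next
      case False
      hence 0: "x \<bullet> y = 0" using C(3) ab by (auto simp: pairwise_def orthogonal_def)
      moreover have "x \<bullet> x = 1" using ab by (simp add: dot_square_norm power2_eq_square)
      ultimately show ?thesis by auto
    qed
  qed
  have indep: "independent D"
  proof (rule pairwise_orthogonal_independent)
    show "pairwise orthogonal D" using ort by (auto simp: pairwise_def orthogonal_def)
    show "0 \<notin> D" using ort[of 0 0] by auto
  qed
  have "span D = span (C - {0})"
  unfolding span_eq
  proof
    show "D \<subseteq> span (C - {0})"
      unfolding D_def by (intro image_subsetI span_scale span_base)
    show "C - {0} \<subseteq> span D"
    proof
      fix x assume x: "x \<in> C - {0}"
      hence "norm x *\<^sub>R (x /\<^sub>R norm x) \<in> span D" by (intro span_scale span_base) (auto simp: D_def)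
      thus "x \<in> span D" using x by simp
    qed
  qed
  hence span: "span D = span S" using C(2) by (metis span_delete_0)
  have dim: "dim (span S) = card D" using indep span by (metis dim_span dim_span_eq_card_independent)
  obtain e where "bij_betw e {0..<card D} D" using ex_bij_betw_nat_finite[OF \<open>finite D\<close>] by blast
  hence e: "bij_betw e {..<card D} D" by (simp add: atLeast0LessThan)
  have "onb_of (span S) e"
    unfolding onb_of_def dim
  proof (intro conjI allI impI)
    show "span (e ` {..<card D}) = span S" using e span by (simp add: bij_betw_def)
    fix i j assume ij: "i < card D" "j < card D"
    have "e i = e j \<longleftrightarrow> i = j" using e ij by (auto simp: bij_betw_def inj_on_def)
    thus "e i \<bullet> e j = (if i = j then 1 else 0)"
      using ort[OF bij_betwE[OF e, rule_format] bij_betwE[OF e, rule_format], of i j] ij by simp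
  qed
  thus ?thesis by blast
qed

lemma onb_of_orthonormal: "onb_of V e \<Longrightarrow> orthonormal (dim V) e" "onb_of V e \<Longrightarrow> span (e ` {..<dim V}) = V"
  by (auto simp: onb_of_def orthonormal_def)

lemma fin_proj_range_onb: "P \<in> fin_proj \<Longrightarrow> \<exists>e. onb_of (range P) e"
  unfolding fin_proj_def using onb_of_exists by fastforce

text \<open>The abstract description of a projection (idempotent and self-adjoint with finite-dimensional
  range) determines it by its range.\<close>

lemma fin_proj_eq_sum:
  assumes P: "P \<in> fin_proj" and e: "onb_of (range P) e"
  shows "P u = (\<Sum>i<dim (range P). (u \<bullet> e i) *\<^sub>R e i)"
proof -
  note o = onb_of_orthonormal[OF e]
  have idem: "P (P v) = P v" for v using P by (auto simp: fin_proj_def fun_eq_iff)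
  have eq: "P u \<bullet> e i = u \<bullet> e i" if i: "i < dim (range P)" for i
  proof -
    have "e i \<in> range P" using o(2) i span_base[of "e i" "e ` {..<dim (range P)}"] by auto
    hence "P (e i) = e i" using idem by auto
    thus ?thesis using P by (auto simp: fin_proj_def)
  qed
  have "P u = (\<Sum>i<dim (range P). (P u \<bullet> e i) *\<^sub>R e i)"
    using o by (intro orthonormal_expansion) auto
  thus ?thesis using eq by simp
qed

lemma fin_proj_measurable: "(P :: _ \<Rightarrow> 'h::{real_inner,polish_space}) \<in> fin_proj \<Longrightarrow> P \<in> borel_measurable borel"
  by (auto simp: fin_proj_def intro!: borel_measurable_continuous_onI linear_continuous_on)

lemma orthonormal_fin_proj:
  fixes e :: "nat \<Rightarrow> 'h::real_inner"
  assumes e: "orthonormal n e"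
  defines "P \<equiv> \<lambda>u. \<Sum>i<n. (u \<bullet> e i) *\<^sub>R e i"
  shows "P \<in> fin_proj" "range P = span (e ` {..<n})"
proof -
  have fix_span: "P u = u" if "u \<in> span (e ` {..<n})" for u
    using orthonormal_expansion[OF e that] by (simp add: P_def)
  have in_span: "P u \<in> span (e ` {..<n})" for u
    unfolding P_def by (intro span_sum span_scale span_base) auto
  show r: "range P = span (e ` {..<n})"
    using fix_span in_span by (metis antisym image_subset_iff rangeI subsetI)
  have "bounded_linear P" unfolding P_def
    by (intro bounded_linear_sum bounded_linear_scaleR_const bounded_linear_inner_left)
  moreover have "P \<circ> P = P" using fix_span in_span by auto
  moreover have "P u \<bullet> v = u \<bullet> P v" for u v
    by (simp add: P_def inner_sum_left inner_sum_right inner_commute mult.commute)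
  ultimately show "P \<in> fin_proj" unfolding fin_proj_def using r by (auto intro!: exI[of _ "e ` {..<n}"])
qed

lemma prob_space_std_normal: "prob_space std_normal_distribution"
  by (rule prob_space_normal_density) simp

lemma product_prob_space_std_normal: "product_prob_space (\<lambda>_. std_normal_distribution)"
  using prob_space_std_normal
  by (auto simp: product_prob_space_def product_sigma_finite_def product_prob_space_axioms_def
      prob_space_imp_sigma_finite)

lemma char_std_normal_sum:
  assumes "finite I"
  shows "(CLINT c|PiM I (\<lambda>_. std_normal_distribution). iexp (\<Sum>i\<in>I. a i * c i))
    = exp (- (\<Sum>i\<in>I. (a i)\<^sup>2) / 2)"
proof -
  interpret N: prob_space std_normal_distribution by (rule prob_space_std_normal)
  interpret product_prob_space "\<lambda>_. std_normal_distribution" by (rule product_prob_space_std_normal)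
  have "(CLINT c|PiM I (\<lambda>_. std_normal_distribution). iexp (\<Sum>i\<in>I. a i * c i))
      = (CLINT c|PiM I (\<lambda>_. std_normal_distribution). (\<Prod>i\<in>I. iexp (a i * c i)))"
    by (simp add: exp_sum[OF assms] sum_distrib_left)
  also have "\<dots> = (\<Prod>i\<in>I. CLINT x|std_normal_distribution. iexp (a i * x))"
    by (rule product_integral_prod[OF assms]) (rule N.integrable_iexp, auto)
  also have "\<dots> = (\<Prod>i\<in>I. char std_normal_distribution (a i))"
    by (simp add: char_def)
  also have "\<dots> = exp (- (\<Sum>i\<in>I. (a i)\<^sup>2) / 2)"
    unfolding char_std_normal_distribution
    by (simp add: exp_sum[OF assms, symmetric] sum_negf sum_divide_distrib flip: of_real_prod)
  finally show ?thesis .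
qed

text \<open>The standard Gaussian measure on the span of \<open>e\<close>, as a measure on the whole space: this way
  Gaussian measures on different subspaces can be compared.\<close>

definition gauss_vec :: "nat \<Rightarrow> (nat \<Rightarrow> 'h::{real_inner,polish_space}) \<Rightarrow> 'h measure"
  where "gauss_vec n e = distr (PiM {..<n} (\<lambda>_. std_normal_distribution)) borel (\<lambda>c. \<Sum>i<n. c i *\<^sub>R e i)"

lemma measurable_lincomb:
  fixes e :: "nat \<Rightarrow> 'h::{real_inner,polish_space}"
  assumes "\<And>i. i < n \<Longrightarrow> sets (N i) = sets borel"
  shows "(\<lambda>c. \<Sum>i<n. c i *\<^sub>R e i) \<in> borel_measurable (PiM {..<n} N)"
proof (intro borel_measurable_sum borel_measurable_scaleR borel_measurable_const)
  fix i assume "i \<in> {..<n}"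
  thus "(\<lambda>c. c i) \<in> borel_measurable (PiM {..<n} N)"
    using measurable_component_singleton[of i "{..<n}" N] assms by (auto cong: measurable_cong_sets)
qed

lemma sets_gauss_vec [simp, measurable_cong]: "sets (gauss_vec n e) = sets borel"
  and space_gauss_vec [simp]: "space (gauss_vec n e) = UNIV"
  by (simp_all add: gauss_vec_def)

lemma prob_space_PiM_std_normal: "prob_space (PiM I (\<lambda>_. std_normal_distribution))"
  by (rule prob_space_PiM) (rule prob_space_std_normal)

lemma prob_space_gauss_vec: "prob_space (gauss_vec n e)"
  unfolding gauss_vec_def
  by (rule prob_space.prob_space_distr[OF prob_space_PiM_std_normal]) (rule measurable_lincomb, simp)

lemma char_gauss_vec:
  "(CLINT u|gauss_vec n e. iexp (u \<bullet> h)) = exp (- (\<Sum>i<n. (e i \<bullet> h)\<^sup>2) / 2)"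
proof -
  have "(CLINT u|gauss_vec n e. iexp (u \<bullet> h))
      = (CLINT c|PiM {..<n} (\<lambda>_. std_normal_distribution). iexp (\<Sum>i<n. (e i \<bullet> h) * c i))"
    unfolding gauss_vec_def
    by (subst integral_distr[OF measurable_lincomb])
       (auto simp: inner_sum_left mult.commute)
  also have "\<dots> = exp (- (\<Sum>i<n. (e i \<bullet> h)\<^sup>2) / 2)" by (rule char_std_normal_sum) simp
  finally show ?thesis .
qed

text \<open>Rotation invariance. The coordinates of a Gaussian vector of the larger subspace with respect
  to a basis of the smaller one have characteristic function \<open>exp (- |t|\<^sup>2 / 2)\<close>, by Parseval's
  identity in the larger subspace, so they are independent standard Gaussians.\<close>

lemma gauss_vec_projection:
  fixes e :: "nat \<Rightarrow> 'h::{real_inner,polish_space}"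
  assumes P: "P \<in> fin_proj" and e: "onb_of (range P) e"
    and e': "orthonormal m e'" and sub: "range P \<subseteq> span (e' ` {..<m})" and F: "F \<in> sets borel"
  shows "measure (gauss_vec (dim (range P)) e) F = measure (gauss_vec m e') {u. P u \<in> F}"
proof -
  define n where "n = dim (range P)"
  have eo: "orthonormal n e" "span (e ` {..<n}) = range P"
    using onb_of_orthonormal[OF e] by (auto simp: n_def)
  have Psum: "P u = (\<Sum>i<n. (u \<bullet> e i) *\<^sub>R e i)" for u
    unfolding n_def by (rule fin_proj_eq_sum[OF P e])
  let ?\<Phi> = "\<lambda>c. \<Sum>i<n. c i *\<^sub>R e i"
  have \<Phi>: "?\<Phi> \<in> borel_measurable (PiM {..<n} (\<lambda>_. borel))"
    by (rule measurable_lincomb) simp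
  have mY: "(\<lambda>u. \<lambda>j\<in>{..<n}. u \<bullet> e j) \<in> measurable (gauss_vec m e') (PiM {..<n} (\<lambda>_. borel))"
    by (rule measurable_restrict) simp
  have mX: "(\<lambda>c. \<lambda>j\<in>{..<n}. c j) \<in> measurable (PiM {..<n} (\<lambda>_. std_normal_distribution)) (PiM {..<n} (\<lambda>_. borel))"
    by (rule measurable_restrict) (auto intro!: measurable_component_singleton)
  have law: "distr (PiM {..<n} (\<lambda>_. std_normal_distribution)) (PiM {..<n} (\<lambda>_. borel)) (\<lambda>c. \<lambda>j\<in>{..<n}. c j)
    = distr (gauss_vec m e') (PiM {..<n} (\<lambda>_. borel)) (\<lambda>u. \<lambda>j\<in>{..<n}. u \<bullet> e j)"
  proof (rule joint_law_eq_of_char[OF prob_space_PiM_std_normal prob_space_gauss_vec])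
    fix t
    let ?h = "\<Sum>j<n. t j *\<^sub>R e j"
    have "?h \<in> span (e ` {..<n})" by (intro span_sum span_scale span_base) auto
    hence h: "?h \<in> span (e' ` {..<m})" using eo sub by auto
    have "(CLINT u|gauss_vec m e'. iexp (\<Sum>j<n. t j * (u \<bullet> e j))) = (CLINT u|gauss_vec m e'. iexp (u \<bullet> ?h))"
      by (simp add: inner_sum_right)
    also have "\<dots> = exp (- (\<Sum>j<n. (t j)\<^sup>2) / 2)"
      unfolding char_gauss_vec orthonormal_parseval[OF e' h] norm_orthonormal_sum[OF eo(1)] ..
    also have "\<dots> = (CLINT c|PiM {..<n} (\<lambda>_. std_normal_distribution). iexp (\<Sum>j<n. t j * c j))"
      by (rule char_std_normal_sum[symmetric]) simp
    finally show "(CLINT c|PiM {..<n} (\<lambda>_. std_normal_distribution). iexp (\<Sum>j<n. t j * c j))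
      = (CLINT u|gauss_vec m e'. iexp (\<Sum>j<n. t j * (u \<bullet> e j)))" by (rule sym)
  qed (auto intro!: measurable_component_singleton)
  have "gauss_vec n e = distr (distr (PiM {..<n} (\<lambda>_. std_normal_distribution)) (PiM {..<n} (\<lambda>_. borel)) (\<lambda>c. \<lambda>j\<in>{..<n}. c j)) borel ?\<Phi>"
    unfolding gauss_vec_def by (subst distr_distr[OF \<Phi> mX]) (intro distr_cong refl, simp add: comp_def)
  also have "\<dots> = distr (gauss_vec m e') borel P"
    unfolding law by (subst distr_distr[OF \<Phi> mY]) (intro distr_cong refl, simp add: comp_def Psum)
  finally have "gauss_vec n e = distr (gauss_vec m e') borel P" .
  moreover have "P \<in> borel_measurable (gauss_vec m e')"
    using fin_proj_measurable[OF P] by (simp cong: measurable_cong_sets)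
  ultimately show ?thesis using F by (simp add: measure_distr n_def vimage_def)
qed

lemma PiM_density_lborel:
  fixes f :: "real \<Rightarrow> real"
  assumes "finite I" and [measurable]: "f \<in> borel_measurable borel" and f: "\<And>x. 0 \<le> f x"
    and "prob_space (density lborel f)"
  shows "density (PiM I (\<lambda>_. lborel)) (\<lambda>x. ennreal (\<Prod>i\<in>I. f (x i))) = PiM I (\<lambda>_. density lborel f)"
proof -
  interpret L: product_sigma_finite "\<lambda>_. lborel :: real measure"
    by (simp add: product_sigma_finite_def lborel.sigma_finite_measure_axioms)
  interpret D: prob_space "density lborel f" by fact
  interpret DP: product_sigma_finite "\<lambda>_. density lborel f"
    by (simp add: product_sigma_finite_def D.sigma_finite_measure_axioms)
  show ?thesis
  proof (rule DP.PiM_eqI)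
    show "sets (density (PiM I (\<lambda>_. lborel)) (\<lambda>x. ennreal (\<Prod>i\<in>I. f (x i)))) = sets (PiM I (\<lambda>_. density lborel f))"
      by (simp cong: sets_PiM_cong)
    fix A assume A: "\<And>i. i \<in> I \<Longrightarrow> A i \<in> sets (density lborel f)"
    have [measurable]: "Pi\<^sub>E I A \<in> sets (PiM I (\<lambda>_. lborel))" using A assms(1) by (intro sets_PiM_I_finite) auto
    have "emeasure (density (PiM I (\<lambda>_. lborel)) (\<lambda>x. ennreal (\<Prod>i\<in>I. f (x i)))) (Pi\<^sub>E I A)
        = (\<integral>\<^sup>+x. ennreal (\<Prod>i\<in>I. f (x i)) * indicator (Pi\<^sub>E I A) x \<partial>PiM I (\<lambda>_. lborel))"
      by (subst emeasure_density) auto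
    also have "\<dots> = (\<integral>\<^sup>+x. (\<Prod>i\<in>I. ennreal (f (x i)) * indicator (A i) (x i)) \<partial>PiM I (\<lambda>_. lborel))"
    proof (rule nn_integral_cong)
      fix x assume x: "x \<in> space (PiM I (\<lambda>_. lborel :: real measure))"
      have "(indicator (Pi\<^sub>E I A) x :: ennreal) = (\<Prod>i\<in>I. indicator (A i) (x i))"
      proof (cases "\<forall>i\<in>I. x i \<in> A i")
        case True
        thus ?thesis using x by (auto simp: space_PiM PiE_iff)
      next
        case False
        then obtain i where "i \<in> I" "x i \<notin> A i" by blast
        thus ?thesis using assms(1) by (subst prod_zero) (auto simp: indicator_def)
      qed
      thus "ennreal (\<Prod>i\<in>I. f (x i)) * indicator (Pi\<^sub>E I A) x
        = (\<Prod>i\<in>I. ennreal (f (x i)) * indicator (A i) (x i))"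
        using f by (simp add: prod.distrib prod_ennreal)
    qed
    also have "\<dots> = (\<Prod>i\<in>I. \<integral>\<^sup>+x. ennreal (f x) * indicator (A i) x \<partial>lborel)"
      using A by (intro L.product_nn_integral_prod assms(1)) auto
    also have "\<dots> = (\<Prod>i\<in>I. emeasure (density lborel f) (A i))"
      using A by (intro prod.cong) (auto simp: emeasure_density)
    finally show "emeasure (density (PiM I (\<lambda>_. lborel)) (\<lambda>x. ennreal (\<Prod>i\<in>I. f (x i)))) (Pi\<^sub>E I A)
      = (\<Prod>i\<in>I. emeasure (density lborel f) (A i))" .
  qed fact
qed

text \<open>In orthonormal coordinates the density \<open>(2 \<pi>)\<^bsup>-n/2\<^esup> exp (- |u|\<^sup>2 / 2)\<close> is the product of the
  one-dimensional Gaussian densities. The basis is the one that is selected in the definition of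
  Lebesgue measure on the subspace.\<close>

lemma gauss_fd_eq_gauss_vec:
  fixes V F :: "'h::{real_inner,polish_space} set"
  assumes V: "\<exists>e. onb_of V e" and F: "F \<in> sets borel"
  obtains e where "onb_of V e" "gauss_fd V F = measure (gauss_vec (dim V) e) F"
proof -
  define e where "e = (SOME e. onb_of V e)"
  have e: "onb_of V e" unfolding e_def using V by (rule someI_ex)
  define n where "n = dim V"
  have eo: "orthonormal n e" using onb_of_orthonormal[OF e] by (simp add: n_def)
  let ?\<Phi> = "\<lambda>c. \<Sum>i<n. c i *\<^sub>R e i"
  let ?L = "PiM {..<n} (\<lambda>_. lborel :: real measure)"
  have \<Phi> [measurable]: "?\<Phi> \<in> borel_measurable ?L" by (rule measurable_lincomb) simp
  note F [measurable]
  have "gauss_fd V F = (2 * pi) powr (- real n / 2) *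
      (LINT c|?L. indicator F (?\<Phi> c) *\<^sub>R exp (- (norm (?\<Phi> c))\<^sup>2 / 2))"
    unfolding gauss_fd_def subspace_lborel_def Let_def e_def[symmetric] n_def[symmetric] set_lebesgue_integral_def
    by (subst integral_distr) auto
  also have "\<dots> = (LINT c|?L. (2 * pi) powr (- real n / 2) *
      (indicator F (?\<Phi> c) *\<^sub>R exp (- (norm (?\<Phi> c))\<^sup>2 / 2)))"
    by (rule integral_mult_right_zero[symmetric])
  also have "\<dots> = (LINT c|?L. (\<Prod>i<n. std_normal_density (c i)) *\<^sub>R indicator F (?\<Phi> c))"
  proof (intro Bochner_Integration.integral_cong refl)
    fix c :: "nat \<Rightarrow> real"
    have "(\<Prod>i<n. exp (- (c i)\<^sup>2 / 2)) = exp (\<Sum>i<n. - (c i)\<^sup>2 / 2)"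
      by (rule exp_sum[symmetric]) simp
    also have "(\<Sum>i<n. - (c i)\<^sup>2 / 2) = - (\<Sum>i<n. (c i)\<^sup>2) / 2"
      by (simp add: sum_negf flip: sum_divide_distrib)
    finally have E: "(\<Prod>i<n. exp (- (c i)\<^sup>2 / 2)) = exp (- (\<Sum>i<n. (c i)\<^sup>2) / 2)" .
    have "(\<Prod>i<n. std_normal_density (c i)) = (\<Prod>i<n. 1 / sqrt (2 * pi)) * (\<Prod>i<n. exp (- (c i)\<^sup>2 / 2))"
      unfolding std_normal_density_def by (rule prod.distrib)
    also have "\<dots> = (1 / sqrt (2 * pi)) ^ n * exp (- (\<Sum>i<n. (c i)\<^sup>2) / 2)"
      unfolding E prod_constant card_lessThan ..
    also have "(1 / sqrt (2 * pi)) ^ n = (2 * pi) powr (- real n / 2)"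
    proof -
      have "1 / sqrt (2 * pi) = (2 * pi) powr (- (1 / 2))"
        using powr_half_sqrt[of "2 * pi"] powr_minus_divide[of "2 * pi" "1 / 2"] by simp
      hence "(1 / sqrt (2 * pi)) ^ n = ((2 * pi) powr (- (1 / 2))) powr real n"
        by (simp add: powr_realpow)
      thus ?thesis by (simp add: powr_powr)
    qed
    finally show "(2 * pi) powr (- real n / 2) * (indicator F (?\<Phi> c) *\<^sub>R exp (- (norm (?\<Phi> c))\<^sup>2 / 2))
        = (\<Prod>i<n. std_normal_density (c i)) *\<^sub>R indicator F (?\<Phi> c)"
      by (simp add: norm_orthonormal_sum[OF eo])
  qed
  also have "\<dots> = (LINT c|density ?L (\<lambda>c. ennreal (\<Prod>i<n. std_normal_density (c i))). indicator F (?\<Phi> c))"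
    by (subst integral_density) (auto intro!: prod_nonneg AE_I2)
  also have "density ?L (\<lambda>c. ennreal (\<Prod>i<n. std_normal_density (c i))) = PiM {..<n} (\<lambda>_. std_normal_distribution)"
    by (rule PiM_density_lborel) (auto intro: prob_space_std_normal)
  also have "(LINT c|PiM {..<n} (\<lambda>_. std_normal_distribution). indicator F (?\<Phi> c) :: real)
      = (LINT u|gauss_vec n e. indicator F u)"
    unfolding gauss_vec_def by (subst integral_distr[OF measurable_lincomb]) auto
  also have "\<dots> = measure (gauss_vec n e) F" by simp
  finally show ?thesis using that[OF e] by (simp add: n_def)
qed

text \<open>Two representations of a cylinder set are compared in a subspace that contains both ranges:
  there each of them gives the Gaussian measure of the cylinder set itself.\<close>

lemma gauss_cyl_eq_gauss_vec:
  fixes P :: "'h::{real_inner,polish_space} \<Rightarrow> 'h"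
  assumes P: "P \<in> fin_proj" and e: "onb_of (range P) e" and F: "F \<in> sets borel"
  shows "gauss_cyl {u. P u \<in> F} = measure (gauss_vec (dim (range P)) e) F"
proof -
  have key: "gauss_fd (range Q) G = measure (gauss_vec m e') {u. Q u \<in> G}"
    if Q: "Q \<in> fin_proj" and G: "G \<in> sets borel" and e': "orthonormal m e'" "range Q \<subseteq> span (e' ` {..<m})"
    for Q :: "'h \<Rightarrow> 'h" and G m e'
  proof -
    obtain d where "onb_of (range Q) d" "gauss_fd (range Q) G = measure (gauss_vec (dim (range Q)) d) G"
      using gauss_fd_eq_gauss_vec[OF fin_proj_range_onb[OF Q] G] by blast
    thus ?thesis using gauss_vec_projection[OF Q _ e' G] by simp
  qed
  have clr: "range P \<in> sets borel"
  proof -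
    have "range P = {u. P u = u}" using P by (auto simp: fin_proj_def fun_eq_iff) (metis rangeI)
    moreover have "P \<in> borel_measurable borel" by (rule fin_proj_measurable[OF P])
    hence "{u \<in> space borel. P u = u} \<in> sets borel" by measurable
    ultimately show ?thesis by simp
  qed
  have FP: "{u. P u \<in> F} = {u. P u \<in> F \<inter> range P}" by auto
  have val: "gauss_fd (range P) (F \<inter> range P) = measure (gauss_vec (dim (range P)) e) F"
  proof -
    have "gauss_fd (range P) (F \<inter> range P) = measure (gauss_vec (dim (range P)) e) {u. P u \<in> F}"
      unfolding FP using onb_of_orthonormal[OF e] clr F by (intro key[OF P]) auto
    also have "\<dots> = measure (gauss_vec (dim (range P)) e) F"
      using onb_of_orthonormal[OF e] by (intro gauss_vec_projection[OF P e _ _ F, symmetric]) auto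
    finally show ?thesis .
  qed
  show ?thesis unfolding gauss_cyl_def
  proof (rule the_equality)
    show "\<exists>Q\<in>fin_proj. \<exists>G\<in>sets borel. G \<subseteq> range Q \<and> {u. P u \<in> F} = {u. Q u \<in> G}
        \<and> measure (gauss_vec (dim (range P)) e) F = gauss_fd (range Q) G"
      using FP val clr F by (intro bexI[OF _ P] bexI[of _ "F \<inter> range P"]) auto
    fix r assume "\<exists>Q\<in>fin_proj. \<exists>G\<in>sets borel. G \<subseteq> range Q \<and> {u. P u \<in> F} = {u. Q u \<in> G}
        \<and> r = gauss_fd (range Q) G"
    then obtain Q G where Q: "Q \<in> fin_proj" "G \<in> sets borel" "{u. P u \<in> F} = {u. Q u \<in> G}"
      "r = gauss_fd (range Q) G" by blast
    obtain S T where "finite S" "range P = span S" "finite T" "range Q = span T"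
      using P Q(1) by (auto simp: fin_proj_def)
    then obtain e' where e': "onb_of (span (S \<union> T)) e'" and
      sub: "range P \<subseteq> span (S \<union> T)" "range Q \<subseteq> span (S \<union> T)"
      using onb_of_exists[of "S \<union> T"] span_mono[of S "S \<union> T"] span_mono[of T "S \<union> T"] by auto
    note o = onb_of_orthonormal[OF e']
    have "r = measure (gauss_vec (dim (span (S \<union> T))) e') {u. P u \<in> F}"
      unfolding Q(4) Q(3) using o sub by (intro key[OF Q(1,2)]) auto
    also have "\<dots> = measure (gauss_vec (dim (range P)) e) F"
      using o sub by (intro gauss_vec_projection[OF P e _ _ F, symmetric]) auto
    finally show "r = measure (gauss_vec (dim (range P)) e) F" .
  qed
qed


section \<open>Fourier truncation in the Sobolev space\<close>

text \<open>The zero mode is kept: the truncations of \<open>a\<close> must determine \<open>a\<close> also if \<open>a\<close> is not known to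
  have mean zero.\<close>

definition trunc :: "nat \<Rightarrow> (int \<Rightarrow> complex) \<Rightarrow> int \<Rightarrow> complex"
  where "trunc N a n = (if \<bar>n\<bar> \<le> int N then a n else 0)"

lemma trunc_diff: "trunc N (a - b) = trunc N a - trunc N b"
  by (auto simp: trunc_def fun_eq_iff)

lemma trunc_trunc: "trunc M (trunc N a) = trunc (min M N) a"
  by (auto simp: trunc_def fun_eq_iff)

lemma hdot1_eqI: "(\<And>n. fcoeff u n = fcoeff v n) \<Longrightarrow> u = v"
  by (simp add: fcoeff_inject[symmetric] fun_eq_iff)

lemma fcoeff_add [simp]: "fcoeff (u + v) n = fcoeff u n + fcoeff v n"
  and fcoeff_scaleR [simp]: "fcoeff (c *\<^sub>R u) n = c *\<^sub>R fcoeff u n"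
  and fcoeff_zero [simp]: "fcoeff 0 n = 0"
  by (simp_all add: plus_hdot1.rep_eq scaleR_hdot1.rep_eq zero_hdot1.rep_eq)

lemma fcoeff_diff_fun: "fcoeff (u - v) = fcoeff u - fcoeff v"
  by (simp add: fun_eq_iff fcoeff_diff)

lemma fcoeff_sum: "fcoeff (\<Sum>i\<in>A. f i) n = (\<Sum>i\<in>A. fcoeff (f i) n)"
  by (induction A rule: infinite_finite_induct) auto

lemma linear_fcoeff: "linear fcoeff"
  by (rule linearI) (auto simp: fun_eq_iff scaleR_fun_def)

lemma inj_fcoeff: "inj fcoeff"
  by (rule injI) (simp add: fcoeff_inject)

lift_definition mode :: "int \<Rightarrow> complex \<Rightarrow> hdot1" is "\<lambda>n z k. if k = n \<and> n \<noteq> 0 then z else 0"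
proof safe
  fix n :: int and z :: complex
  have "(\<lambda>k. (of_int k)\<^sup>2 * (cmod (if k = n \<and> n \<noteq> 0 then z else 0))\<^sup>2 :: real) summable_on {n}"
    by simp
  also have "?this \<longleftrightarrow> (\<lambda>k. (of_int k)\<^sup>2 * (cmod (if k = n \<and> n \<noteq> 0 then z else 0))\<^sup>2 :: real) summable_on UNIV"
    by (rule summable_on_cong_neutral) auto
  finally show "(\<lambda>k. (of_int k)\<^sup>2 * (cmod (if k = n \<and> n \<noteq> 0 then z else 0))\<^sup>2 :: real) summable_on UNIV" .
qed auto

lemma fcoeff_mode: "fcoeff (mode n z) k = (if k = n \<and> n \<noteq> 0 then z else 0)"
  by transfer simp

lemma inner_mode: "mode n z \<bullet> u = (of_int n)\<^sup>2 * Re (z * cnj (fcoeff u n))"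
proof -
  have "mode n z \<bullet> u = (\<Sum>\<^sub>\<infinity>k\<in>{n}. (of_int k)\<^sup>2 * Re (fcoeff (mode n z) k * cnj (fcoeff u k)))"
    unfolding inner_hdot1_def by (rule infsum_cong_neutral) (auto simp: fcoeff_mode)
  thus ?thesis by (cases "n = 0") (auto simp: fcoeff_mode)
qed

lemma norm_mode: "(norm (mode n z))\<^sup>2 = (of_int n)\<^sup>2 * (cmod z)\<^sup>2"
proof -
  have "(norm (mode n z))\<^sup>2 = mode n z \<bullet> mode n z" by (rule power2_norm_eq_inner)
  thus ?thesis unfolding inner_mode
    by (cases "n = 0") (simp_all add: fcoeff_mode complex_mult_cnj cmod_power2)
qed

lemma abs_mult_fcoeff_le_norm: "\<bar>of_int n\<bar> * cmod (fcoeff u n) \<le> norm u"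
proof -
  have "(\<bar>of_int n\<bar> * cmod (fcoeff u n))\<^sup>2 \<le> (norm u)\<^sup>2"
    using finite_sum_le_norm_hdot1[of "{n}" u] by (simp add: power_mult_distrib)
  thus ?thesis by (rule power2_le_imp_le) simp
qed

definition freqs :: "nat \<Rightarrow> int set"
  where "freqs N = {- int N..int N} - {0}"

lemma finite_freqs [simp]: "finite (freqs N)" and zero_notin_freqs [simp]: "0 \<notin> freqs N"
  and mem_freqs: "n \<in> freqs N \<longleftrightarrow> n \<noteq> 0 \<and> \<bar>n\<bar> \<le> int N"
  by (auto simp: freqs_def)

text \<open>Truncation of an arbitrary coefficient sequence to an element of the Sobolev space, which
  forces the zero mode to vanish. The real linear combination makes it visibly measurable as a
  function of the coefficients.\<close>

definition hproj :: "nat \<Rightarrow> (int \<Rightarrow> complex) \<Rightarrow> hdot1"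
  where "hproj N a = (\<Sum>n\<in>freqs N. Re (a n) *\<^sub>R mode n 1 + Im (a n) *\<^sub>R mode n \<i>)"

lemma fcoeff_hproj: "fcoeff (hproj N a) k = (if k \<in> freqs N then a k else 0)"
proof -
  have "fcoeff (hproj N a) k = (\<Sum>n\<in>freqs N. if n = k then a k else 0)"
    unfolding hproj_def fcoeff_sum
    by (intro sum.cong) (auto simp: fcoeff_mode complex_eq_iff)
  thus ?thesis by simp
qed

lemma fcoeff_hproj_eq_trunc: "a 0 = 0 \<Longrightarrow> fcoeff (hproj N a) = trunc N a"
  by (auto simp: fun_eq_iff fcoeff_hproj trunc_def mem_freqs)

lemma inner_hproj:
  "hproj N a \<bullet> u = (\<Sum>n\<in>freqs N. (of_int n)\<^sup>2 * (Re (a n) * Re (fcoeff u n) + Im (a n) * Im (fcoeff u n)))"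
  unfolding hproj_def inner_sum_left inner_add_left inner_scaleR_left inner_mode
  by (intro sum.cong) (auto simp: algebra_simps)

lemma measurable_hproj: "hproj N \<in> borel_measurable (PiM UNIV (\<lambda>_. borel))"
  unfolding hproj_def[abs_def]
  by (intro borel_measurable_sum borel_measurable_add borel_measurable_scaleR borel_measurable_const
      measurable_compose[OF _ borel_measurable_Re] measurable_compose[OF _ borel_measurable_Im]
      measurable_component_singleton) auto

lemma norm_hproj_fcoeff:
  "(norm (hproj N (fcoeff u)))\<^sup>2 = (\<Sum>n\<in>freqs N. (of_int n)\<^sup>2 * (cmod (fcoeff u n))\<^sup>2)"
  unfolding power2_norm_eq_inner[of "hproj N (fcoeff u)"] inner_hproj
  by (intro sum.cong) (auto simp: fcoeff_hproj cmod_power2 simp flip: power2_eq_square)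

lemma norm_hproj_le: "norm (hproj N (fcoeff u)) \<le> norm u"
proof -
  have "(norm (hproj N (fcoeff u)))\<^sup>2 \<le> (norm u)\<^sup>2"
    unfolding norm_hproj_fcoeff by (rule finite_sum_le_norm_hdot1) simp
  thus ?thesis by (rule power2_le_imp_le) simp
qed

lemma fin_proj_hproj: "(\<lambda>u. hproj N (fcoeff u)) \<in> fin_proj"
proof -
  let ?P = "\<lambda>u. hproj N (fcoeff u)"
  have "bounded_linear ?P"
    by (rule bounded_linear_intro[of _ 1])
       (auto intro!: hdot1_eqI simp: fcoeff_hproj norm_hproj_le)
  moreover have "?P \<circ> ?P = ?P" by (auto intro!: hdot1_eqI simp: fcoeff_hproj)
  moreover have "?P u \<bullet> v = u \<bullet> ?P v" for u v
    unfolding inner_commute[of u] inner_hproj by (simp add: mult.commute)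
  moreover have "range ?P = span ((\<lambda>n. mode n 1) ` freqs N \<union> (\<lambda>n. mode n \<i>) ` freqs N)" (is "_ = span ?S")
  proof
    show "range ?P \<subseteq> span ?S"
      unfolding hproj_def by (intro image_subsetI span_sum span_add span_scale span_base) auto
    have "?S \<subseteq> range ?P"
    proof
      fix x assume "x \<in> ?S"
      hence "x = ?P x" by (auto intro!: hdot1_eqI simp: fcoeff_hproj fcoeff_mode)
      thus "x \<in> range ?P" by blast
    qed
    moreover have "subspace (range ?P)"
      using \<open>bounded_linear ?P\<close> by (intro linear_subspace_image subspace_UNIV bounded_linear.linear)
    ultimately show "span ?S \<subseteq> range ?P" by (rule span_minimal)
  qed
  ultimately show ?thesis
    unfolding fin_proj_def by (auto intro!: exI[of _ "(\<lambda>n. mode n 1) ` freqs N \<union> (\<lambda>n. mode n \<i>) ` freqs N"])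
qed

lemma norm_hproj_tendsto: "(\<lambda>N. (norm (hproj N (fcoeff h)))\<^sup>2) \<longlonglongrightarrow> (norm h)\<^sup>2"
proof -
  let ?f = "\<lambda>n. (of_int n)\<^sup>2 * (cmod (fcoeff h n))\<^sup>2 :: real"
  have eq: "(norm (hproj N (fcoeff h)))\<^sup>2 = sum ?f {- int N..int N}" for N
    unfolding norm_hproj_fcoeff by (rule sum.mono_neutral_left) (auto simp: freqs_def)
  have "(?f has_sum (norm h)\<^sup>2) UNIV"
    unfolding norm_hdot1_sq using fcoeff_summable has_sum_infsum by blast
  hence "(sum ?f \<longlongrightarrow> (norm h)\<^sup>2) (finite_subsets_at_top UNIV)" by (simp add: has_sum_def)
  moreover have "filterlim (\<lambda>N. {- int N..int N}) (finite_subsets_at_top UNIV) sequentially"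
    unfolding filterlim_finite_subsets_at_top
  proof (intro allI impI, elim conjE)
    fix X :: "int set" assume X: "finite X"
    define K where "K = nat (Max (insert 0 (abs ` X)))"
    have K: "\<bar>n\<bar> \<le> int K" if "n \<in> X" for n
    proof -
      have "\<bar>n\<bar> \<le> Max (insert 0 (abs ` X))" using X that by (intro Max_ge) auto
      thus ?thesis unfolding K_def by linarith
    qed
    show "\<forall>\<^sub>F N in sequentially. finite {- int N..int N} \<and> X \<subseteq> {- int N..int N} \<and> {- int N..int N} \<subseteq> UNIV"
      using eventually_ge_at_top[of K] by eventually_elim (use K in fastforce)
  qed
  ultimately show ?thesis unfolding eq by (rule filterlim_compose)
qed


section \<open>The Fourier-Lebesgue norm as a dominating norm\<close>

lemma jap_ge_1: "1 \<le> jap n" and jap_pos [simp]: "0 < jap n" and jap_nonneg [simp]: "0 \<le> jap n"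
  by (simp_all add: jap_def add_pos_nonneg)

lemma jap_nonzero [simp]: "jap n \<noteq> 0"
  using jap_pos[of n] by linarith

lemma abs_le_jap: "\<bar>of_int n\<bar> \<le> jap n"
  unfolding jap_def by (rule real_le_rsqrt) simp

lemma jap_le_abs: "n \<noteq> 0 \<Longrightarrow> jap n \<le> 2 * \<bar>of_int n\<bar>"
proof -
  assume "n \<noteq> 0"
  hence "1 \<le> \<bar>of_int n :: real\<bar>" by linarith
  hence "1 \<le> (of_int n :: real)\<^sup>2" by (simp add: abs_le_square_iff[of 1, simplified])
  thus ?thesis unfolding jap_def by (intro real_le_lsqrt) (auto simp: power_mult_distrib)
qed

lemma nn_integral_jap_powr_finite:
  assumes t: "t < - 1"
  shows "(\<integral>\<^sup>+n. ennreal (jap n powr t) \<partial>count_space UNIV) < \<infinity>"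
proof -
  have s: "summable (\<lambda>k. (real k + 1) powr t)"
  proof -
    have "summable (\<lambda>k. real k powr t)" using t by (simp add: summable_real_powr_iff)
    hence "summable (\<lambda>k. real (Suc k) powr t)" by (subst summable_Suc_iff)
    thus ?thesis by (simp add: add.commute)
  qed
  define S where "S = (\<Sum>k. (real k + 1) powr t)"
  have "(\<Sum>n\<in>{- int N..int N}. ennreal (jap n powr t)) \<le> ennreal (2 * (2 powr (- t) * S))" for N
  proof -
    have j: "jap n powr t \<le> 2 powr (- t) * (real (nat \<bar>n\<bar>) + 1) powr t" for n
    proof -
      have "(real (nat \<bar>n\<bar>) + 1) / 2 \<le> jap n"
        using jap_ge_1[of n] abs_le_jap[of n] by simp
      hence "jap n powr t \<le> ((real (nat \<bar>n\<bar>) + 1) / 2) powr t"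
        using t by (intro powr_mono2') auto
      also have "\<dots> = 2 powr (- t) * (real (nat \<bar>n\<bar>) + 1) powr t"
        by (simp add: powr_divide powr_minus_divide)
      finally show ?thesis .
    qed
    have half: "(\<Sum>k\<le>N. (real k + 1) powr t) \<le> S"
      unfolding S_def by (rule sum_le_suminf[OF s]) auto
    have "{- int N..int N} = int ` {..N} \<union> (\<lambda>k. - int k) ` {..N}"
    proof safe
      fix n assume n: "n \<in> {- int N..int N}" "n \<notin> (\<lambda>k. - int k) ` {..N}"
      have "0 \<le> n"
      proof (rule ccontr)
        assume "\<not> 0 \<le> n"
        hence "n = - int (nat (- n))" "nat (- n) \<le> N" using n by auto
        thus False using n by blast
      qed
      hence "n = int (nat n)" "nat n \<le> N" using n by auto
      thus "n \<in> int ` {..N}" by blast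
    qed auto
    hence "(\<Sum>n\<in>{- int N..int N}. jap n powr t) \<le> (\<Sum>n\<in>int ` {..N}. jap n powr t) + (\<Sum>n\<in>(\<lambda>k. - int k) ` {..N}. jap n powr t)"
      by (simp add: sum_Un sum_nonneg)
    also have "\<dots> = 2 * (\<Sum>k\<le>N. jap (int k) powr t)"
      by (subst (1 2) sum.reindex) (auto simp: inj_on_def jap_def)
    also have "\<dots> \<le> 2 * (\<Sum>k\<le>N. 2 powr (- t) * (real k + 1) powr t)"
      using j[of "int k" for k] by (intro mult_left_mono sum_mono) auto
    also have "\<dots> \<le> 2 * (2 powr (- t) * S)"
      using half by (simp flip: sum_distrib_left)
    finally show ?thesis by (subst sum_ennreal) (auto intro: ennreal_leI)
  qed
  hence "(\<integral>\<^sup>+n. ennreal (jap n powr t) \<partial>count_space UNIV) \<le> ennreal (2 * (2 powr (- t) * S))"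
    unfolding nn_integral_count_space_int by (intro SUP_least)
  thus ?thesis by (auto simp: top_unique less_top[symmetric])
qed

lemma nn_integral_tail_small:
  fixes f :: "int \<Rightarrow> ennreal"
  assumes fin: "(\<integral>\<^sup>+n. f n \<partial>count_space UNIV) < \<infinity>" and e: "0 < e"
  shows "\<exists>N::nat. (\<integral>\<^sup>+n. f n * indicator {n. int N < \<bar>n\<bar>} n \<partial>count_space UNIV) < e"
proof -
  let ?g = "\<lambda>N n. f n * indicator {n. int N < \<bar>n\<bar>} n"
  have "(\<integral>\<^sup>+n. (INF N. ?g N n) \<partial>count_space UNIV) = (INF N. \<integral>\<^sup>+n. ?g N n \<partial>count_space UNIV)"
  proof (rule nn_integral_monotone_convergence_INF_decseq)
    show "decseq ?g" by (rule antimonoI) (auto simp: le_fun_def split: split_indicator)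
    have "(\<integral>\<^sup>+n. ?g 0 n \<partial>count_space UNIV) \<le> (\<integral>\<^sup>+n. f n \<partial>count_space UNIV)"
      by (intro nn_integral_mono) (auto split: split_indicator)
    thus "(\<integral>\<^sup>+n. ?g 0 n \<partial>count_space UNIV) < \<infinity>" using fin by (rule le_less_trans)
  qed auto
  moreover have "(INF N. ?g N n) = 0" for n
  proof -
    have "(INF N. ?g N n) \<le> ?g (nat \<bar>n\<bar>) n" by (rule INF_lower) simp
    thus ?thesis by simp
  qed
  ultimately have "(INF N. \<integral>\<^sup>+n. ?g N n \<partial>count_space UNIV) < e" using e by simp
  thus ?thesis by (auto simp: INF_less_iff)
qed

text \<open>The \<open>r\<close>-th power of the Fourier-Lebesgue norm. Being a sum, it has a mean that can be computed
  coefficient by coefficient.\<close>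

definition fl_mass :: "real \<Rightarrow> real \<Rightarrow> (int \<Rightarrow> complex) \<Rightarrow> ennreal"
  where "fl_mass \<sigma> r a = (\<integral>\<^sup>+n. ennreal ((jap n powr \<sigma> * cmod (a n)) powr r) \<partial>count_space UNIV)"

lemma fourier_lebesgue_norm_mass:
  "0 < r \<Longrightarrow> fourier_lebesgue_norm \<sigma> (ennreal r) a = ennpowr (fl_mass \<sigma> r a) (1 / r)"
  by (simp add: fourier_lebesgue_norm_def Lp_norm_ennreal fl_mass_def)

lemma fl_mass_mono:
  assumes "0 \<le> r" "\<And>n. cmod (a n) \<le> cmod (b n)"
  shows "fl_mass \<sigma> r a \<le> fl_mass \<sigma> r b"
  unfolding fl_mass_def
  by (intro nn_integral_mono ennreal_leI powr_mono2 mult_left_mono assms) auto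

lemma fl_mass_tail_small:
  assumes "fl_mass \<sigma> r a < \<infinity>" "0 < e" "0 \<le> r"
  shows "\<exists>N. \<forall>M\<ge>N. fl_mass \<sigma> r (a - trunc M a) < e"
proof -
  obtain N :: nat where N: "(\<integral>\<^sup>+n. ennreal ((jap n powr \<sigma> * cmod (a n)) powr r) * indicator {n. int N < \<bar>n\<bar>} n \<partial>count_space UNIV) < e"
    using nn_integral_tail_small[OF assms(1)[unfolded fl_mass_def] assms(2)] by blast
  have "fl_mass \<sigma> r (a - trunc N a)
    = (\<integral>\<^sup>+n. ennreal ((jap n powr \<sigma> * cmod (a n)) powr r) * indicator {n. int N < \<bar>n\<bar>} n \<partial>count_space UNIV)"
    unfolding fl_mass_def by (intro nn_integral_cong) (auto simp: trunc_def split: split_indicator)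
  hence "fl_mass \<sigma> r (a - trunc N a) < e" using N by simp
  moreover have "fl_mass \<sigma> r (a - trunc M a) \<le> fl_mass \<sigma> r (a - trunc N a)" if "M \<ge> N" for M
    using that assms(3) by (intro fl_mass_mono) (auto simp: trunc_def)
  ultimately show ?thesis by (meson le_less_trans)
qed

text \<open>The \<open>n\<close>-th coefficient of \<open>u\<close> is at most \<open>|u| / |n|\<close>, hence at most \<open>2 |u| / \<langle>n\<rangle>\<close>; what
  remains is a series of powers of \<open>\<langle>n\<rangle>\<close> that does not involve \<open>u\<close>.\<close>

lemma fl_mass_fcoeff_le:
  assumes r: "0 < r"
  shows "fl_mass \<sigma> r (fcoeff u)
    \<le> ennreal ((2 * norm u) powr r) * (\<integral>\<^sup>+n. ennreal (jap n powr ((\<sigma> - 1) * r)) \<partial>count_space UNIV)"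
proof -
  have "(jap n powr \<sigma> * cmod (fcoeff u n)) powr r \<le> (2 * norm u) powr r * jap n powr ((\<sigma> - 1) * r)" for n
  proof -
    have "jap n * cmod (fcoeff u n) \<le> 2 * norm u"
    proof (cases "n = 0")
      case False
      have "jap n * cmod (fcoeff u n) \<le> 2 * \<bar>of_int n\<bar> * cmod (fcoeff u n)"
        by (intro mult_right_mono jap_le_abs False) auto
      also have "\<dots> \<le> 2 * norm u" using abs_mult_fcoeff_le_norm[of n u] by simp
      finally show ?thesis .
    qed simp
    hence "jap n powr (\<sigma> - 1) * (jap n * cmod (fcoeff u n)) \<le> jap n powr (\<sigma> - 1) * (2 * norm u)"
      by (rule mult_left_mono) simp
    moreover have e: "jap n powr (\<sigma> - 1) * jap n = jap n powr \<sigma>" using powr_add[of "jap n" "\<sigma> - 1" 1] by simp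
    ultimately have "jap n powr \<sigma> * cmod (fcoeff u n) \<le> 2 * norm u * jap n powr (\<sigma> - 1)"
      unfolding e[symmetric] by (simp add: mult_ac)
    hence "(jap n powr \<sigma> * cmod (fcoeff u n)) powr r \<le> (2 * norm u * jap n powr (\<sigma> - 1)) powr r"
      using r by (intro powr_mono2) auto
    thus ?thesis by (simp add: powr_mult powr_powr)
  qed
  hence "fl_mass \<sigma> r (fcoeff u)
      \<le> (\<integral>\<^sup>+n. ennreal ((2 * norm u) powr r) * ennreal (jap n powr ((\<sigma> - 1) * r)) \<partial>count_space UNIV)"
    unfolding fl_mass_def by (intro nn_integral_mono) (simp flip: ennreal_mult)
  thus ?thesis by (simp add: nn_integral_cmult)
qed


section \<open>Admissible sequence norms\<close>

text \<open>Apart from the norm axioms, every condition is preserved under passage to an equivalent norm, so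
  only one norm of each equivalence class has to be examined. The Fatou property, a bound by the
  truncations alone, is what completeness rests on; the domination by a Fourier-Lebesgue norm is what the Gaussian
  estimates rest on, and it also puts the Sobolev space into the function space.\<close>

locale admissible_norm =
  fixes nrm :: "(int \<Rightarrow> complex) \<Rightarrow> ennreal" and \<sigma> r :: real
  assumes triangle: "nrm (a + b) \<le> nrm a + nrm b"
    and homogeneous: "nrm (c *\<^sub>R a) = ennreal \<bar>c\<bar> * nrm a"
    and coeff_bounded: "\<exists>C. \<forall>a. ennreal (cmod (a n)) \<le> ennreal C * nrm a"
    and trunc_bounded: "\<exists>C. \<forall>a N. nrm (trunc N a) \<le> ennreal C * nrm a"
    and fatou: "\<exists>C. \<forall>a c. (\<forall>N. nrm (trunc N a) \<le> c) \<longrightarrow> nrm a \<le> ennreal C * c"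
    and exponent: "1 \<le> r" "(\<sigma> - 1) * r < - 1"
    and dominated: "\<exists>C. \<forall>a. nrm a \<le> ennreal C * fourier_lebesgue_norm \<sigma> (ennreal r) a"
begin

lemma nrm_0 [simp]: "nrm 0 = 0"
  using homogeneous[of 0 0] by simp

lemma nrm_diff_commute: "nrm (a - b) = nrm (b - a)"
  using homogeneous[of "-1" "a - b"] by simp

lemma nrm_diff_triangle: "nrm (a - c) \<le> nrm (a - b) + nrm (b - c)"
  using triangle[of "a - b" "b - c"] by simp

lemma nrm_triangle_sub: "nrm a \<le> nrm (a - b) + nrm b"
  using triangle[of "a - b" b] by simp

lemma dominated_mass: obtains C where "C > 0" "\<And>a. nrm a \<le> ennreal C * ennpowr (fl_mass \<sigma> r a) (1 / r)"
proof -
  obtain C where C: "\<And>a. nrm a \<le> ennreal C * fourier_lebesgue_norm \<sigma> (ennreal r) a"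
    using dominated by blast
  have "nrm a \<le> ennreal (max 1 C) * ennpowr (fl_mass \<sigma> r a) (1 / r)" for a
  proof -
    have "ennreal C * ennpowr (fl_mass \<sigma> r a) (1 / r) \<le> ennreal (max 1 C) * ennpowr (fl_mass \<sigma> r a) (1 / r)"
      by (intro mult_right_mono ennreal_leI) auto
    thus ?thesis using C[of a] exponent by (simp add: fourier_lebesgue_norm_mass)
  qed
  thus thesis by (rule that[rotated]) simp
qed

lemma nrm_fcoeff_le: obtains K where "0 \<le> K" "\<And>u. nrm (fcoeff u) \<le> ennreal (K * norm u)"
proof -
  obtain C where C: "C > 0" "\<And>a. nrm a \<le> ennreal C * ennpowr (fl_mass \<sigma> r a) (1 / r)"
    by (rule dominated_mass) blast
  obtain w where w: "(\<integral>\<^sup>+n. ennreal (jap n powr ((\<sigma> - 1) * r)) \<partial>count_space UNIV) = ennreal w" "0 \<le> w"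
    using nn_integral_jap_powr_finite[OF exponent(2)]
    by (cases "\<integral>\<^sup>+n. ennreal (jap n powr ((\<sigma> - 1) * r)) \<partial>count_space UNIV") auto
  have "nrm (fcoeff u) \<le> ennreal ((C * 2 * w powr (1 / r)) * norm u)" for u
  proof -
    have "ennpowr (fl_mass \<sigma> r (fcoeff u)) (1 / r) \<le> ennpowr (ennreal ((2 * norm u) powr r) * ennreal w) (1 / r)"
      using fl_mass_fcoeff_le[of r \<sigma> u] exponent w by (intro ennpowr_mono) auto
    also have "\<dots> = ennreal (2 * norm u * w powr (1 / r))"
      unfolding ennpowr_mult using exponent w by (simp add: powr_powr ennreal_mult)
    finally have "ennreal C * ennpowr (fl_mass \<sigma> r (fcoeff u)) (1 / r) \<le> ennreal C * ennreal (2 * norm u * w powr (1 / r))"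
      by (rule mult_left_mono) simp
    also have "\<dots> = ennreal ((C * 2 * w powr (1 / r)) * norm u)"
      using C(1) by (simp add: mult_ac flip: ennreal_mult)
    finally show ?thesis using C(2)[of "fcoeff u"] by (rule order_trans[rotated])
  qed
  thus thesis by (rule that[rotated]) (use C in simp)
qed

lemma nrm_fcoeff_finite: "nrm (fcoeff u) < top"
  using nrm_fcoeff_le by (metis ennreal_less_top le_less_trans)

definition hnorm :: "hdot1 \<Rightarrow> real"
  where "hnorm u = enn2real (nrm (fcoeff u))"

lemma ennreal_hnorm: "ennreal (hnorm u) = nrm (fcoeff u)"
  unfolding hnorm_def using nrm_fcoeff_finite[of u] by simp

lemma hnorm_nonneg: "0 \<le> hnorm u"
  by (simp add: hnorm_def)

lemma hnorm_triangle: "hnorm (u + v) \<le> hnorm u + hnorm v"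
proof -
  have "ennreal (hnorm (u + v)) \<le> ennreal (hnorm u + hnorm v)"
    using triangle[of "fcoeff u" "fcoeff v"]
    by (simp add: ennreal_hnorm hnorm_nonneg linear_add[OF linear_fcoeff])
  thus ?thesis by (rule ennreal_le_iff[THEN iffD1, rotated]) (simp add: hnorm_nonneg)
qed

lemma hnorm_scaleR: "hnorm (c *\<^sub>R u) = \<bar>c\<bar> * hnorm u"
  by (simp add: hnorm_def linear_scale[OF linear_fcoeff] homogeneous enn2real_mult)

lemma continuous_hnorm: "continuous_on UNIV hnorm"
proof -
  obtain K where K: "0 \<le> K" "\<And>u. nrm (fcoeff u) \<le> ennreal (K * norm u)"
    by (rule nrm_fcoeff_le) blast
  have b: "hnorm u \<le> K * norm u" for u
    using K(2)[of u] K(1) by (simp flip: ennreal_hnorm)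
  have "\<bar>hnorm u - hnorm v\<bar> \<le> K * dist u v" for u v
    using hnorm_triangle[of "u - v" v] hnorm_triangle[of "v - u" u] b[of "u - v"] b[of "v - u"]
    by (simp add: dist_norm norm_minus_commute abs_le_iff)
  hence "K-lipschitz_on UNIV hnorm" by (intro lipschitz_onI K) (auto simp: dist_real_def)
  thus ?thesis by (rule lipschitz_on_continuous_on)
qed

lemma borel_measurable_hnorm [measurable]: "hnorm \<in> borel_measurable borel"
  by (rule borel_measurable_continuous_onI[OF continuous_hnorm])

lemma nrm_tail_small:
  assumes a: "fl_mass \<sigma> r a < \<infinity>" and e: "0 < e"
  shows "\<exists>N. \<forall>M\<ge>N. nrm (a - trunc M a) < ennreal e"
proof -
  obtain C where C: "C > 0" "\<And>a. nrm a \<le> ennreal C * ennpowr (fl_mass \<sigma> r a) (1 / r)"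
    by (rule dominated_mass) blast
  define d where "d = (e / (2 * C)) powr r"
  have "0 < ennreal d" using C e by (simp add: d_def)
  then obtain N where N: "\<And>M. M \<ge> N \<Longrightarrow> fl_mass \<sigma> r (a - trunc M a) < ennreal d"
    using fl_mass_tail_small[OF a] exponent by force
  have "nrm (a - trunc M a) < ennreal e" if "M \<ge> N" for M
  proof -
    have "nrm (a - trunc M a) \<le> ennreal C * ennpowr (fl_mass \<sigma> r (a - trunc M a)) (1 / r)" by (rule C)
    also have "\<dots> \<le> ennreal C * ennpowr (ennreal d) (1 / r)"
      using N[OF that] exponent by (intro mult_left_mono ennpowr_mono) auto
    also have "\<dots> = ennreal (e / 2)"
      using C e exponent by (simp add: d_def powr_powr flip: ennreal_mult)
    also have "\<dots> < ennreal e" using e by (simp add: ennreal_lessI)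
    finally show ?thesis .
  qed
  thus ?thesis by blast
qed

lemma fl_mass_fcoeff_finite: "fl_mass \<sigma> r (fcoeff u) < \<infinity>"
proof -
  have "ennreal ((2 * norm u) powr r) * (\<integral>\<^sup>+n. ennreal (jap n powr ((\<sigma> - 1) * r)) \<partial>count_space UNIV) < \<infinity>"
    using nn_integral_jap_powr_finite[OF exponent(2)] by (simp add: ennreal_mult_less_top)
  thus ?thesis using fl_mass_fcoeff_le[of r \<sigma> u] exponent by (simp add: le_less_trans)
qed

abbreviation cl :: "(int \<Rightarrow> complex) set" where "cl \<equiv> hdot1_closure nrm"

text \<open>The zeroth coefficient is a continuous functional that vanishes on the Sobolev space.\<close>

lemma closure_zero_coeff: "a \<in> cl \<Longrightarrow> a 0 = 0"
proof -
  assume a: "a \<in> cl"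
  obtain C where C: "\<And>a. ennreal (cmod (a 0)) \<le> ennreal C * nrm a" using coeff_bounded[of 0] by blast
  have "cmod (a 0) \<le> e" if e: "e > 0" for e :: real
  proof -
    define d where "d = e / max 1 C"
    have "0 < ennreal d" using e by (simp add: d_def)
    then obtain u where u: "nrm (a - fcoeff u) < ennreal d" using a unfolding hdot1_closure_def by blast
    have "ennreal (cmod (a 0)) \<le> ennreal C * nrm (a - fcoeff u)" using C[of "a - fcoeff u"] by simp
    also have "\<dots> \<le> ennreal (max 1 C) * ennreal d"
      using u by (intro mult_mono ennreal_leI) auto
    also have "\<dots> = ennreal e" using e by (simp add: d_def flip: ennreal_mult)
    finally show ?thesis using e by simp
  qed
  hence "cmod (a 0) \<le> 0" by (rule field_le_epsilon[of _ 0, simplified])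
  thus "a 0 = 0" by simp
qed

text \<open>Truncations are uniformly bounded operators that converge strongly on the dense subspace \<open>H\<close>,
  hence on its closure.\<close>

lemma closure_tail_small:
  assumes a: "a \<in> cl" and e: "0 < e"
  shows "\<exists>N. \<forall>M\<ge>N. nrm (a - trunc M a) < ennreal e"
proof -
  obtain C0 where C0: "\<And>a N. nrm (trunc N a) \<le> ennreal C0 * nrm a" using trunc_bounded by blast
  define C where "C = max 1 C0"
  have C: "nrm (trunc N a) \<le> ennreal C * nrm a" for a N
    using C0[of N a] by (rule order_trans) (auto simp: C_def intro!: mult_right_mono ennreal_leI)
  have C1: "1 \<le> C" by (simp add: C_def)
  define d where "d = e / (4 * C)"
  have d: "0 < d" "d \<le> e / 4" "C * d = e / 4"
    using e C1 by (auto simp: d_def field_simps)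
  have "0 < ennreal d" using d by simp
  then obtain u where u: "nrm (a - fcoeff u) < ennreal d" using a unfolding hdot1_closure_def by blast
  obtain N where N: "\<And>M. M \<ge> N \<Longrightarrow> nrm (fcoeff u - trunc M (fcoeff u)) < ennreal (e / 4)"
    using nrm_tail_small[OF fl_mass_fcoeff_finite, of "e / 4" u] e by auto
  have "nrm (a - trunc M a) < ennreal e" if M: "M \<ge> N" for M
  proof -
    have "nrm (a - trunc M a) \<le> nrm (a - fcoeff u) + nrm (fcoeff u - trunc M a)"
      by (rule nrm_diff_triangle)
    also have "\<dots> \<le> nrm (a - fcoeff u) + (nrm (fcoeff u - trunc M (fcoeff u)) + nrm (trunc M (fcoeff u) - trunc M a))"
      by (intro add_left_mono nrm_diff_triangle)
    also have "nrm (trunc M (fcoeff u) - trunc M a) = nrm (trunc M (a - fcoeff u))"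
      by (subst nrm_diff_commute) (simp add: trunc_diff)
    also have "nrm (a - fcoeff u) + (nrm (fcoeff u - trunc M (fcoeff u)) + nrm (trunc M (a - fcoeff u)))
        \<le> ennreal d + (ennreal (e / 4) + ennreal C * ennreal d)"
      using u N[OF M] by (intro add_mono order_trans[OF C] mult_left_mono) auto
    also have "\<dots> = ennreal (d + (e / 4 + C * d))"
      using d C1 e by (simp flip: ennreal_mult ennreal_plus)
    also have "\<dots> < ennreal e" using d e by (intro ennreal_lessI) auto
    finally show ?thesis .
  qed
  thus ?thesis by blast
qed

lemma nrm_trunc_finite: "a 0 = 0 \<Longrightarrow> nrm (trunc N a) < top"
  using nrm_fcoeff_finite[of "hproj N a"] by (simp add: fcoeff_hproj_eq_trunc)

lemma closureI:
  assumes "a 0 = 0" "\<And>e. 0 < e \<Longrightarrow> \<exists>N. nrm (a - trunc N a) \<le> ennreal e"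
  shows "a \<in> cl"
proof -
  obtain N where "nrm (a - trunc N a) \<le> ennreal 1" using assms(2)[of 1] by auto
  hence "nrm a \<le> ennreal 1 + nrm (trunc N a)"
    using nrm_triangle_sub[of a "trunc N a"] by (meson add_right_mono order_trans)
  also have "\<dots> < top" using nrm_trunc_finite[of a N, OF assms(1)] by simp
  finally have fin: "nrm a < \<infinity>" by simp
  have "\<exists>u. nrm (a - fcoeff u) < \<epsilon>" if "\<epsilon> > 0" for \<epsilon>
  proof -
    obtain e where e: "0 < e" "ennreal e < \<epsilon>"
    proof (cases \<epsilon>)
      case (real x)
      thus ?thesis using \<open>\<epsilon> > 0\<close> by (intro that[of "x / 2"]) (auto intro: ennreal_lessI)
    qed (use that[of 1] in auto)
    obtain N where "nrm (a - trunc N a) \<le> ennreal e" using assms(2)[OF e(1)] by blast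
    hence "nrm (a - fcoeff (hproj N a)) < \<epsilon>"
      using e(2) assms(1) by (simp add: fcoeff_hproj_eq_trunc)
    thus ?thesis by blast
  qed
  thus ?thesis using fin by (simp add: hdot1_closure_def)
qed

text \<open>With \<open>closure_trunc_Cauchy\<close>, membership in the closure becomes a condition on truncations only,
  that is, on countably many measurable functions of the coefficients.\<close>

lemma closure_if_trunc_Cauchy:
  assumes "a 0 = 0" and cau: "\<And>e. 0 < e \<Longrightarrow> \<exists>N. \<forall>M\<ge>N. nrm (trunc M a - trunc N a) \<le> ennreal e"
  shows "a \<in> cl"
proof (rule closureI, rule assms(1))
  fix e :: real assume e: "0 < e"
  obtain C where C: "\<And>a c. (\<And>N. nrm (trunc N a) \<le> c) \<Longrightarrow> nrm a \<le> ennreal C * c" using fatou by blast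
  define d where "d = e / max 1 C"
  have d: "0 < d" using e by (simp add: d_def)
  obtain N where N: "\<And>M. M \<ge> N \<Longrightarrow> nrm (trunc M a - trunc N a) \<le> ennreal d" using cau[OF d] by blast
  have "nrm (trunc M (a - trunc N a)) \<le> ennreal d" for M
  proof (cases "M \<ge> N")
    case True
    thus ?thesis using N[of M] by (simp add: trunc_diff trunc_trunc min_absorb2)
  next
    case False
    hence "trunc M (a - trunc N a) = 0" by (simp add: trunc_diff trunc_trunc min_absorb1)
    thus ?thesis by simp
  qed
  hence "nrm (a - trunc N a) \<le> ennreal C * ennreal d" by (rule C)
  also have "\<dots> \<le> ennreal (max 1 C) * ennreal d" by (intro mult_right_mono ennreal_leI) auto
  also have "\<dots> = ennreal e" using e by (simp add: d_def flip: ennreal_mult)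
  finally show "\<exists>N. nrm (a - trunc N a) \<le> ennreal e" by blast
qed

lemma closure_trunc_Cauchy:
  assumes "a \<in> cl" "0 < e"
  shows "\<exists>N. \<forall>M\<ge>N. nrm (trunc M a - trunc N a) \<le> ennreal e"
proof -
  obtain N where N: "\<And>M. M \<ge> N \<Longrightarrow> nrm (a - trunc M a) < ennreal (e / 2)"
    using closure_tail_small[OF assms(1), of "e / 2"] assms(2) by auto
  have "nrm (trunc M a - trunc N a) \<le> ennreal e" if "M \<ge> N" for M
  proof -
    have "nrm (trunc M a - trunc N a) \<le> nrm (trunc M a - a) + nrm (a - trunc N a)"
      by (rule nrm_diff_triangle)
    also have "\<dots> \<le> ennreal (e / 2) + ennreal (e / 2)"
      using N[OF that] N[OF order_refl] by (subst nrm_diff_commute) (intro add_mono less_imp_le)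
    also have "\<dots> = ennreal e" using assms(2) by (simp flip: ennreal_plus)
    finally show ?thesis .
  qed
  thus ?thesis by blast
qed

lemma closure_add: "a \<in> cl \<Longrightarrow> b \<in> cl \<Longrightarrow> a + b \<in> cl"
proof (rule closureI)
  assume ab: "a \<in> cl" "b \<in> cl"
  show "(a + b) 0 = 0" using ab[THEN closure_zero_coeff] by simp
  fix e :: real assume e: "0 < e"
  obtain N where N: "\<And>M. M \<ge> N \<Longrightarrow> nrm (a - trunc M a) < ennreal (e / 2)"
    using closure_tail_small[OF ab(1), of "e / 2"] e by auto
  obtain N' where N': "\<And>M. M \<ge> N' \<Longrightarrow> nrm (b - trunc M b) < ennreal (e / 2)"
    using closure_tail_small[OF ab(2), of "e / 2"] e by auto
  let ?M = "max N N'"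
  have "a + b - trunc ?M (a + b) = (a - trunc ?M a) + (b - trunc ?M b)"
    by (auto simp: trunc_def fun_eq_iff)
  hence "nrm (a + b - trunc ?M (a + b)) \<le> nrm (a - trunc ?M a) + nrm (b - trunc ?M b)"
    using triangle by metis
  also have "\<dots> \<le> ennreal (e / 2) + ennreal (e / 2)"
    by (intro add_mono N[THEN less_imp_le] N'[THEN less_imp_le]) auto
  also have "\<dots> = ennreal e" using e by (simp flip: ennreal_plus)
  finally show "\<exists>N. nrm (a + b - trunc N (a + b)) \<le> ennreal e" by blast
qed

lemma closure_scaleR: "a \<in> cl \<Longrightarrow> c *\<^sub>R a \<in> cl"
proof (rule closureI)
  assume a: "a \<in> cl"
  show "(c *\<^sub>R a) 0 = 0" using closure_zero_coeff[OF a] by (simp add: scaleR_fun_def)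
  fix e :: real assume e: "0 < e"
  define d where "d = e / (\<bar>c\<bar> + 1)"
  have d: "0 < d" "\<bar>c\<bar> * d \<le> e" using e by (auto simp: d_def field_simps)
  obtain N where N: "nrm (a - trunc N a) < ennreal d" using closure_tail_small[OF a d(1)] by auto
  have "c *\<^sub>R a - trunc N (c *\<^sub>R a) = c *\<^sub>R (a - trunc N a)"
    by (auto simp: trunc_def fun_eq_iff scaleR_fun_def)
  hence "nrm (c *\<^sub>R a - trunc N (c *\<^sub>R a)) = ennreal \<bar>c\<bar> * nrm (a - trunc N a)"
    by (simp add: homogeneous)
  also have "\<dots> \<le> ennreal \<bar>c\<bar> * ennreal d" using N by (intro mult_left_mono) auto
  also have "\<dots> \<le> ennreal e" using d by (simp add: ennreal_leI flip: ennreal_mult)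
  finally show "\<exists>N. nrm (c *\<^sub>R a - trunc N (c *\<^sub>R a)) \<le> ennreal e" by blast
qed

lemma fcoeff_in_closure: "fcoeff u \<in> cl"
proof (rule closureI)
  fix e :: real assume "0 < e"
  then obtain N where "\<And>M. M \<ge> N \<Longrightarrow> nrm (fcoeff u - trunc M (fcoeff u)) < ennreal e"
    using nrm_tail_small[OF fl_mass_fcoeff_finite] by blast
  thus "\<exists>N. nrm (fcoeff u - trunc N (fcoeff u)) \<le> ennreal e" using less_imp_le by blast
qed simp

lemma subspace_closure: "subspace cl"
  using fcoeff_in_closure[of 0] closure_add closure_scaleR
  by (auto simp: subspace_def linear_0[OF linear_fcoeff])

lemma closure_diff: "a \<in> cl \<Longrightarrow> b \<in> cl \<Longrightarrow> a - b \<in> cl"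
  by (rule subspace_diff[OF subspace_closure])

lemma closure_finite: "a \<in> cl \<Longrightarrow> nrm a < top"
  by (simp add: hdot1_closure_def)

lemma norm_on_closure: "norm_on cl (\<lambda>a. enn2real (nrm a))"
  unfolding norm_on_def seminorm_on_def
proof (intro conjI ballI allI impI subspace_closure)
  fix a b assume ab: "a \<in> cl" "b \<in> cl"
  note fin = ab[THEN closure_finite]
  have "enn2real (nrm (a + b)) \<le> enn2real (nrm a + nrm b)"
    using triangle fin by (intro enn2real_mono) auto
  thus "enn2real (nrm (a + b)) \<le> enn2real (nrm a) + enn2real (nrm b)"
    using fin by (simp add: enn2real_plus)
next
  fix c a assume "a \<in> cl"
  show "enn2real (nrm (c *\<^sub>R a)) = \<bar>c\<bar> * enn2real (nrm a)"
    by (simp add: homogeneous enn2real_mult)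
next
  fix a assume a: "a \<in> cl" "enn2real (nrm a) = 0"
  hence 0: "nrm a = 0" using closure_finite[OF a(1)] by (auto simp: enn2real_eq_0_iff)
  have "a n = 0" for n using coeff_bounded[of n] 0 by (metis ennreal_eq_0_iff mult_zero_right norm_le_zero_iff le_zero_eq)
  thus "a = 0" by (simp add: fun_eq_iff)
qed

text \<open>On truncations the norm is continuous with respect to convergence of coefficients, because they
  form a finite-dimensional subspace of the Sobolev space.\<close>

lemma nrm_trunc_tendsto_0:
  assumes lim: "\<And>n. (\<lambda>k. x k n) \<longlonglongrightarrow> y n" and x0: "\<And>k. x k 0 = 0" and y0: "y 0 = 0" and e: "0 < e"
  shows "\<exists>L. \<forall>l\<ge>L. nrm (trunc N (x l - y)) < ennreal e"
proof -
  have "(\<lambda>l. hproj N (x l - y)) \<longlonglongrightarrow> hproj N 0"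
    unfolding hproj_def
  proof (intro tendsto_sum tendsto_add tendsto_scaleR tendsto_const tendsto_Re tendsto_Im)
    fix n
    have "(\<lambda>l. x l n - y n) \<longlonglongrightarrow> y n - y n" by (intro tendsto_intros lim)
    thus "(\<lambda>l. (x l - y) n) \<longlonglongrightarrow> 0 n" by simp
    thus "(\<lambda>l. (x l - y) n) \<longlonglongrightarrow> 0 n" .
  qed
  moreover have "hproj N 0 = 0" by (simp add: hproj_def)
  ultimately have "(\<lambda>l. hnorm (hproj N (x l - y))) \<longlonglongrightarrow> hnorm 0"
    using continuous_hnorm by (auto simp: continuous_on_eq_continuous_at intro: isCont_tendsto_compose)
  moreover have "hnorm 0 = 0" using hnorm_scaleR[of 0 0] by simp
  ultimately have "\<forall>\<^sub>F l in sequentially. hnorm (hproj N (x l - y)) < e"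
    using e by (intro order_tendstoD(2)) auto
  then obtain L where L: "\<And>l. l \<ge> L \<Longrightarrow> hnorm (hproj N (x l - y)) < e"
    by (auto simp: eventually_sequentially)
  have "nrm (trunc N (x l - y)) < ennreal e" if "l \<ge> L" for l
  proof -
    have "nrm (trunc N (x l - y)) = ennreal (hnorm (hproj N (x l - y)))"
      unfolding ennreal_hnorm by (subst fcoeff_hproj_eq_trunc) (simp_all add: x0 y0)
    thus ?thesis using L[OF that] e by (simp add: ennreal_lessI)
  qed
  thus ?thesis by blast
qed

text \<open>A Cauchy sequence converges coefficient by coefficient. On each truncation the limit is also a
  limit in norm, so that the Cauchy bound passes to the truncations of the difference, uniformly in
  the truncation, and the Fatou property removes the truncation.\<close>

lemma complete_closure: "complete_norm_on cl (\<lambda>a. enn2real (nrm a))"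
  unfolding complete_norm_on_def
proof (intro conjI norm_on_closure allI impI)
  fix x :: "nat \<Rightarrow> int \<Rightarrow> complex"
  assume "(\<forall>k. x k \<in> cl) \<and> (\<forall>\<epsilon>>0. \<exists>K. \<forall>k\<ge>K. \<forall>l\<ge>K. enn2real (nrm (x k - x l)) < \<epsilon>)"
  hence x: "\<And>k. x k \<in> cl" and cau0: "\<And>\<epsilon>. \<epsilon> > 0 \<Longrightarrow> \<exists>K. \<forall>k\<ge>K. \<forall>l\<ge>K. enn2real (nrm (x k - x l)) < \<epsilon>"
    by auto
  have fin: "nrm (x k - x l) < top" for k l by (intro closure_finite closure_diff x)
  have cau: "\<exists>K. \<forall>k\<ge>K. \<forall>l\<ge>K. nrm (x k - x l) < ennreal e" if "e > 0" for e
    using cau0[OF that] fin by (metis enn2real_less less_irrefl)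
  have "Cauchy (\<lambda>k. x k n)" for n
    unfolding Cauchy_def
  proof (intro allI impI)
    fix e :: real assume e: "e > 0"
    obtain C where C: "\<And>a. ennreal (cmod (a n)) \<le> ennreal C * nrm a" using coeff_bounded[of n] by blast
    define d where "d = e / (2 * max 1 C)"
    have d: "d > 0" using e by (simp add: d_def)
    obtain K where K: "\<And>k l. k \<ge> K \<Longrightarrow> l \<ge> K \<Longrightarrow> nrm (x k - x l) < ennreal d" using cau[OF d] by blast
    have "dist (x k n) (x l n) < e" if "k \<ge> K" "l \<ge> K" for k l
    proof -
      have "ennreal (cmod ((x k - x l) n)) \<le> ennreal C * nrm (x k - x l)" by (rule C)
      also have "\<dots> \<le> ennreal (max 1 C) * ennreal d"
        using K[OF that] by (intro mult_mono ennreal_leI) auto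
      also have "\<dots> = ennreal (e / 2)" using e by (simp add: d_def flip: ennreal_mult)
      finally have "cmod ((x k - x l) n) \<le> e / 2" using e by (simp add: ennreal_le_iff)
      thus ?thesis using e by (simp add: dist_norm)
    qed
    thus "\<exists>M. \<forall>m\<ge>M. \<forall>k\<ge>M. dist (x m n) (x k n) < e" by blast
  qed
  hence "\<forall>n. \<exists>l. (\<lambda>k. x k n) \<longlonglongrightarrow> l" using Cauchy_convergent convergent_def by blast
  then obtain y where y: "\<And>n. (\<lambda>k. x k n) \<longlonglongrightarrow> y n" by metis
  have x0: "x k 0 = 0" for k by (rule closure_zero_coeff[OF x])
  have y0: "y 0 = 0" using y[of 0] by (simp add: x0 LIMSEQ_const_iff)
  obtain C1 where C1: "\<And>a N. nrm (trunc N a) \<le> ennreal C1 * nrm a" using trunc_bounded by blast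
  obtain C2 where C2: "\<And>a c. (\<And>N. nrm (trunc N a) \<le> c) \<Longrightarrow> nrm a \<le> ennreal C2 * c" using fatou by blast
  have conv: "\<exists>K. \<forall>k\<ge>K. nrm (x k - y) < ennreal e" if e: "e > 0" for e
  proof -
    define d where "d = e / (4 * (max 1 C1 * max 1 C2))"
    have d: "0 < d" "max 1 C2 * (max 1 C1 * d) = e / 4" "max 1 C2 * d \<le> e / 4"
    proof -
      have p: "0 < max 1 C1" "0 < max 1 C2" by auto
      show "0 < d" using e p by (simp add: d_def)
      show eq: "max 1 C2 * (max 1 C1 * d) = e / 4" unfolding d_def using p by (simp add: field_simps)
      have "1 * d \<le> max 1 C1 * d" using \<open>0 < d\<close> by (intro mult_right_mono) auto
      thus "max 1 C2 * d \<le> e / 4" unfolding eq[symmetric] by (intro mult_left_mono) auto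
    qed
    obtain K where K: "\<And>k l. k \<ge> K \<Longrightarrow> l \<ge> K \<Longrightarrow> nrm (x k - x l) < ennreal d" using cau[OF d(1)] by blast
    have "nrm (x k - y) < ennreal e" if k: "k \<ge> K" for k
    proof -
      have "nrm (trunc N (x k - y)) \<le> ennreal (max 1 C1 * d + d)" for N
      proof -
        obtain L where L: "\<And>l. l \<ge> L \<Longrightarrow> nrm (trunc N (x l - y)) < ennreal d"
          using nrm_trunc_tendsto_0[of x y d N] y x0 y0 d(1) by blast
        define l where "l = max K L"
        have "trunc N (x k - y) = trunc N (x k - x l) + trunc N (x l - y)"
          by (auto simp: trunc_def fun_eq_iff)
        hence "nrm (trunc N (x k - y)) \<le> nrm (trunc N (x k - x l)) + nrm (trunc N (x l - y))"
          using triangle by metis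
        also have "\<dots> \<le> ennreal (max 1 C1) * ennreal d + ennreal d"
        proof (intro add_mono)
          have "nrm (trunc N (x k - x l)) \<le> ennreal C1 * nrm (x k - x l)" by (rule C1)
          also have "\<dots> \<le> ennreal (max 1 C1) * ennreal d"
            using K[of k l] k by (intro mult_mono ennreal_leI) (auto simp: l_def)
          finally show "nrm (trunc N (x k - x l)) \<le> ennreal (max 1 C1) * ennreal d" .
          show "nrm (trunc N (x l - y)) \<le> ennreal d" using L[of l] by (auto simp: l_def)
        qed
        also have "\<dots> = ennreal (max 1 C1 * d + d)" using d(1) by (simp flip: ennreal_mult ennreal_plus)
        finally show ?thesis .
      qed
      hence "nrm (x k - y) \<le> ennreal C2 * ennreal (max 1 C1 * d + d)" by (rule C2)
      also have "\<dots> \<le> ennreal (max 1 C2) * ennreal (max 1 C1 * d + d)"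
        by (intro mult_right_mono ennreal_leI) auto
      also have "\<dots> = ennreal (max 1 C2 * (max 1 C1 * d) + max 1 C2 * d)"
        using d(1) by (simp add: distrib_left flip: ennreal_mult)
      also have "\<dots> \<le> ennreal (e / 2)" using d by (intro ennreal_leI) auto
      also have "\<dots> < ennreal e" using e by (intro ennreal_lessI) auto
      finally show ?thesis .
    qed
    thus ?thesis by blast
  qed
  have ycl: "y \<in> cl"
    unfolding hdot1_closure_def
  proof (intro CollectI conjI allI impI)
    obtain k where k: "nrm (x k - y) < ennreal 1" using conv[of 1] by auto
    have "nrm y \<le> nrm (y - x k) + nrm (x k)" by (rule nrm_triangle_sub)
    also have "\<dots> < top" using k closure_finite[OF x[of k]]
      by (subst nrm_diff_commute) (auto simp: less_top[symmetric])
    finally show "nrm y < \<infinity>" by simp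
    fix \<epsilon> :: ennreal assume "\<epsilon> > 0"
    then obtain e where e: "0 < e" "ennreal e < \<epsilon>"
    proof (cases \<epsilon>)
      case (real t)
      thus ?thesis using \<open>\<epsilon> > 0\<close> by (intro that[of "t / 2"]) (auto intro: ennreal_lessI)
    qed (use that[of 1] in auto)
    obtain k where k: "nrm (x k - y) < ennreal (e / 2)" using conv[of "e / 2"] e by auto
    have "0 < ennreal (e / 2)" using e by simp
    then obtain u where u: "nrm (x k - fcoeff u) < ennreal (e / 2)"
      using x[of k] unfolding hdot1_closure_def by blast
    have "nrm (y - fcoeff u) \<le> nrm (y - x k) + nrm (x k - fcoeff u)" by (rule nrm_diff_triangle)
    also have "\<dots> \<le> ennreal (e / 2) + ennreal (e / 2)"
      using k u by (subst nrm_diff_commute) (intro add_mono less_imp_le)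
    also have "\<dots> = ennreal e" using e by (simp flip: ennreal_plus)
    finally show "\<exists>u. nrm (y - fcoeff u) < \<epsilon>" using e(2) by (meson le_less_trans)
  qed
  show "\<exists>y\<in>cl. (\<lambda>k. enn2real (nrm (x k - y))) \<longlonglongrightarrow> 0"
  proof (intro bexI[OF _ ycl] LIMSEQ_I)
    fix e :: real assume e: "0 < e"
    obtain K where K: "\<And>k. k \<ge> K \<Longrightarrow> nrm (x k - y) < ennreal e" using conv[OF e] by blast
    have "enn2real (nrm (x k - y)) < e" if "k \<ge> K" for k
      using K[OF that] by (subst enn2real_less_iff) (auto intro: less_trans)
    thus "\<exists>no. \<forall>n\<ge>no. norm (enn2real (nrm (x n - y)) - 0) < e" by auto
  qed
qed

lemma completion_via_closure: "completion_via fcoeff cl (\<lambda>a. enn2real (nrm a))"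
  unfolding completion_via_def
proof (intro conjI complete_closure linear_fcoeff ballI allI impI)
  show "range fcoeff \<subseteq> cl" using fcoeff_in_closure by auto
  fix a and \<epsilon> :: real assume a: "a \<in> cl" "0 < \<epsilon>"
  hence "0 < ennreal \<epsilon>" by simp
  then obtain u where u: "nrm (a - fcoeff u) < ennreal \<epsilon>" using a unfolding hdot1_closure_def by blast
  thus "\<exists>u. enn2real (nrm (a - fcoeff u)) < \<epsilon>"
    by (intro exI[of _ u], subst enn2real_less_iff) (auto intro: less_trans)
qed

end


section \<open>Gaussian moments\<close>

definition abs_moment :: "real \<Rightarrow> ennreal"
  where "abs_moment r = (\<integral>\<^sup>+x. ennreal (\<bar>x\<bar> powr r) \<partial>std_normal_distribution)"

lemma abs_moment_finite:
  assumes "0 \<le> r"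
  shows "abs_moment r < \<infinity>"
proof -
  define k where "k = nat \<lceil>r\<rceil>"
  have k: "r \<le> real k" by (simp add: k_def real_nat_ceiling_ge)
  interpret N: prob_space std_normal_distribution by (rule prob_space_std_normal)
  have le: "\<bar>x\<bar> powr r \<le> 1 + \<bar>x\<bar> ^ k" for x :: real
  proof (cases "\<bar>x\<bar> \<le> 1")
    case True
    hence "\<bar>x\<bar> powr r \<le> 1" using assms by (intro powr_le1) auto
    thus ?thesis by (rule order_trans) simp
  next
    case False
    hence "\<bar>x\<bar> powr r \<le> \<bar>x\<bar> powr real k" using k by (intro powr_mono) auto
    also have "\<dots> = \<bar>x\<bar> ^ k" using False by (simp add: powr_realpow)
    finally show ?thesis by simp
  qed
  have "integrable std_normal_distribution (\<lambda>x. \<bar>x\<bar> ^ k)"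
    using integrable_std_normal_moment_abs[of k]
    by (subst integrable_density) auto
  hence int: "integrable std_normal_distribution (\<lambda>x. 1 + \<bar>x\<bar> ^ k)" by simp
  have "abs_moment r \<le> (\<integral>\<^sup>+x. ennreal (1 + \<bar>x\<bar> ^ k) \<partial>std_normal_distribution)"
    unfolding abs_moment_def by (intro nn_integral_mono ennreal_leI le)
  also have "\<dots> < \<infinity>" using int by (subst nn_integral_eq_integral) auto
  finally show ?thesis .
qed

lemma cmod_powr_le:
  assumes "0 \<le> r"
  shows "cmod z powr r \<le> 2 powr r * (\<bar>Re z\<bar> powr r + \<bar>Im z\<bar> powr r)"
proof -
  define m where "m = max \<bar>Re z\<bar> \<bar>Im z\<bar>"
  have "cmod z \<le> 2 * m" using cmod_le[of z] by (simp add: m_def)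
  hence "cmod z powr r \<le> (2 * m) powr r" using assms by (intro powr_mono2) auto
  also have "\<dots> = 2 powr r * m powr r" by (simp add: powr_mult m_def)
  also have "m powr r \<le> \<bar>Re z\<bar> powr r + \<bar>Im z\<bar> powr r" by (auto simp: m_def max_def)
  finally show ?thesis by simp
qed

text \<open>A random variable with characteristic function \<open>exp (- (t \<tau>)\<^sup>2 / 2)\<close> is distributed as \<open>\<tau>\<close> times
  a standard Gaussian. The degenerate case \<open>\<tau> = 0\<close> is included, and occurs for vectors that
  are orthogonal to the subspace of a Gaussian vector.\<close>

lemma gaussian_moment:
  fixes Z :: "'a \<Rightarrow> real"
  assumes M: "prob_space M" and [measurable]: "Z \<in> borel_measurable M" and \<tau>: "0 \<le> \<tau>"
    and char: "\<And>t. (CLINT x|M. iexp (t * Z x)) = exp (- (t * \<tau>)\<^sup>2 / 2)"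
  shows "(\<integral>\<^sup>+x. ennreal (\<bar>Z x\<bar> powr r) \<partial>M) = ennreal (\<tau> powr r) * abs_moment r"
proof -
  interpret M: prob_space M by fact
  interpret N: prob_space std_normal_distribution by (rule prob_space_std_normal)
  have law: "distr M borel Z = distr std_normal_distribution borel (\<lambda>x. \<tau> * x)"
  proof (rule Levy_uniqueness)
    show "real_distribution (distr M borel Z)"
      by (rule M.real_distribution_distr) measurable
    show "real_distribution (distr std_normal_distribution borel (\<lambda>x. \<tau> * x))"
      by (rule N.real_distribution_distr) simp
    have "char (distr M borel Z) t = char std_normal_distribution (t * \<tau>)" for t
      unfolding char_std_normal_distribution char[symmetric] char_def by (subst integral_distr) auto
    moreover have "char (distr std_normal_distribution borel (\<lambda>x. \<tau> * x)) t
        = char std_normal_distribution (t * \<tau>)" for t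
      unfolding char_def by (subst integral_distr) (auto simp: mult_ac)
    ultimately show "char (distr M borel Z) = char (distr std_normal_distribution borel (\<lambda>x. \<tau> * x))"
      by (intro ext) simp
  qed
  have "(\<integral>\<^sup>+x. ennreal (\<bar>Z x\<bar> powr r) \<partial>M) = (\<integral>\<^sup>+x. ennreal (\<bar>x\<bar> powr r) \<partial>distr M borel Z)"
    by (subst nn_integral_distr) auto
  also have "\<dots> = (\<integral>\<^sup>+x. ennreal (\<tau> powr r) * ennreal (\<bar>x\<bar> powr r) \<partial>std_normal_distribution)"
    unfolding law using \<tau> by (subst nn_integral_distr) (auto simp: abs_mult powr_mult ennreal_mult)
  also have "\<dots> = ennreal (\<tau> powr r) * abs_moment r"
    unfolding abs_moment_def by (rule nn_integral_cmult) simp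
  finally show ?thesis .
qed

lemma gauss_vec_inner_moment:
  fixes h :: "'h::{real_inner,polish_space}"
  shows "(\<integral>\<^sup>+u. ennreal (\<bar>u \<bullet> h\<bar> powr r) \<partial>gauss_vec n e)
    = ennreal (sqrt (\<Sum>i<n. (e i \<bullet> h)\<^sup>2) powr r) * abs_moment r"
proof (rule gaussian_moment[OF prob_space_gauss_vec])
  fix t
  have "(CLINT u|gauss_vec n e. iexp (t * (u \<bullet> h))) = (CLINT u|gauss_vec n e. iexp (u \<bullet> (t *\<^sub>R h)))"
    by simp
  also have "\<dots> = exp (- (t * sqrt (\<Sum>i<n. (e i \<bullet> h)\<^sup>2))\<^sup>2 / 2)"
    unfolding char_gauss_vec by (simp add: power_mult_distrib sum_nonneg flip: sum_distrib_left)
  finally show "(CLINT u|gauss_vec n e. iexp (t * (u \<bullet> h))) = exp (- (t * sqrt (\<Sum>i<n. (e i \<bullet> h)\<^sup>2))\<^sup>2 / 2)" .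
qed (auto intro: sum_nonneg)

text \<open>A factor \<open>2\<^sup>r\<close> comes from splitting into real and imaginary parts, another one from comparing
  \<open>|n|\<close> with \<open>\<langle>n\<rangle>\<close>, and the factor \<open>2\<close> from adding the two parts.\<close>

definition moment_const :: "real \<Rightarrow> ennreal"
  where "moment_const r = ennreal (2 * (4 powr r)) * abs_moment r"

lemma moment_const_finite: "0 \<le> r \<Longrightarrow> moment_const r < \<infinity>"
  using abs_moment_finite[of r] by (simp add: moment_const_def ennreal_mult_less_top)

lemma abs_powr_le_jap:
  assumes "0 \<le> r" "n \<noteq> 0"
  shows "2 powr r * \<bar>of_int n\<bar> powr (- r) \<le> 4 powr r * jap n powr (- r)"
proof -
  have "\<bar>of_int n\<bar> powr (- r) \<le> (jap n / 2) powr (- r)"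
    using assms jap_le_abs[OF assms(2)] by (intro powr_mono2') auto
  also have "\<dots> = 2 powr r * jap n powr (- r)" by (simp add: powr_divide powr_minus_divide)
  finally have "2 powr r * \<bar>of_int n\<bar> powr (- r) \<le> (2 powr r * 2 powr r) * jap n powr (- r)"
    by (simp add: mult.assoc)
  also have "2 powr r * 2 powr r = (4::real) powr r" by (simp flip: powr_mult)
  finally show ?thesis .
qed

text \<open>The real and imaginary parts of the \<open>n\<close>-th coefficient are \<open>n\<^sup>-\<^sup>2\<close> times inner products with
  vectors of norm \<open>|n|\<close>. The constant depends neither on the random vector nor on \<open>n\<close>.\<close>

lemma coeff_moment:
  assumes r: "0 \<le> r" and [measurable]: "U \<in> borel_measurable M"
    and le: "\<And>h. (\<integral>\<^sup>+x. ennreal (\<bar>U x \<bullet> h\<bar> powr r) \<partial>M) \<le> ennreal (norm h powr r) * abs_moment r"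
  shows "(\<integral>\<^sup>+x. ennreal (cmod (fcoeff (U x) n) powr r) \<partial>M)
    \<le> moment_const r * ennreal (jap n powr (- r))"
proof (cases "n = 0")
  case False
  have b: "(\<integral>\<^sup>+x. ennreal (\<bar>U x \<bullet> mode n z\<bar> powr r) \<partial>M) \<le> ennreal (\<bar>of_int n\<bar> powr r) * abs_moment r"
    if "cmod z = 1" for z
  proof -
    have "(norm (mode n z))\<^sup>2 = \<bar>of_int n\<bar>\<^sup>2" using that by (simp add: norm_mode)
    hence "norm (mode n z) = \<bar>of_int n\<bar>" by (rule power2_eq_imp_eq) auto
    thus ?thesis using le[of "mode n z"] by simp
  qed
  have pt: "cmod (fcoeff u n) powr r \<le> 2 powr r * \<bar>of_int n\<bar> powr (- 2 * r) *
      (\<bar>u \<bullet> mode n 1\<bar> powr r + \<bar>u \<bullet> mode n \<i>\<bar> powr r)" for u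
  proof -
    have "\<bar>Re (fcoeff u n)\<bar> powr r = \<bar>of_int n\<bar> powr (- 2 * r) * \<bar>u \<bullet> mode n 1\<bar> powr r"
      "\<bar>Im (fcoeff u n)\<bar> powr r = \<bar>of_int n\<bar> powr (- 2 * r) * \<bar>u \<bullet> mode n \<i>\<bar> powr r"
    proof -
      have s: "\<bar>of_int n\<bar> powr (- 2 * r) * \<bar>(of_int n)\<^sup>2 * x\<bar> powr r = \<bar>x\<bar> powr r" for x :: real
      proof -
        have "(\<bar>of_int n :: real\<bar> powr 2) powr r = \<bar>of_int n\<bar> powr (2 * r)" by (rule powr_powr)
        moreover have "\<bar>of_int n :: real\<bar> powr 2 = (of_int n)\<^sup>2" using False by simp
        ultimately have "\<bar>(of_int n)\<^sup>2 * x\<bar> powr r = \<bar>of_int n\<bar> powr (2 * r) * \<bar>x\<bar> powr r"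
          by (simp add: abs_mult powr_mult)
        thus ?thesis using False by (simp add: powr_minus)
      qed
      show "\<bar>Re (fcoeff u n)\<bar> powr r = \<bar>of_int n\<bar> powr (- 2 * r) * \<bar>u \<bullet> mode n 1\<bar> powr r"
        unfolding inner_commute[of u] inner_mode s by simp
      show "\<bar>Im (fcoeff u n)\<bar> powr r = \<bar>of_int n\<bar> powr (- 2 * r) * \<bar>u \<bullet> mode n \<i>\<bar> powr r"
        unfolding inner_commute[of u] inner_mode s by simp
    qed
    thus ?thesis using cmod_powr_le[OF r, of "fcoeff u n"] by (simp only: distrib_left mult.assoc)
  qed
  let ?c = "2 powr r * \<bar>of_int n :: real\<bar> powr (- 2 * r)"
  have "(\<integral>\<^sup>+x. ennreal (cmod (fcoeff (U x) n) powr r) \<partial>M)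
      \<le> (\<integral>\<^sup>+x. ennreal ?c * (ennreal (\<bar>U x \<bullet> mode n 1\<bar> powr r) + ennreal (\<bar>U x \<bullet> mode n \<i>\<bar> powr r)) \<partial>M)"
  proof (intro nn_integral_mono)
    fix x
    have "ennreal (cmod (fcoeff (U x) n) powr r) \<le> ennreal (?c * (\<bar>U x \<bullet> mode n 1\<bar> powr r + \<bar>U x \<bullet> mode n \<i>\<bar> powr r))"
      by (rule ennreal_leI[OF pt])
    also have "\<dots> = ennreal ?c * (ennreal (\<bar>U x \<bullet> mode n 1\<bar> powr r) + ennreal (\<bar>U x \<bullet> mode n \<i>\<bar> powr r))"
      by (subst ennreal_mult) auto
    finally show "ennreal (cmod (fcoeff (U x) n) powr r)
      \<le> ennreal ?c * (ennreal (\<bar>U x \<bullet> mode n 1\<bar> powr r) + ennreal (\<bar>U x \<bullet> mode n \<i>\<bar> powr r))" .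
  qed
  also have "\<dots> = ennreal ?c * ((\<integral>\<^sup>+x. ennreal (\<bar>U x \<bullet> mode n 1\<bar> powr r) \<partial>M)
      + (\<integral>\<^sup>+x. ennreal (\<bar>U x \<bullet> mode n \<i>\<bar> powr r) \<partial>M))"
    by (subst nn_integral_cmult) (auto simp: nn_integral_add)
  also have "\<dots> \<le> ennreal ?c * (ennreal (\<bar>of_int n\<bar> powr r) * abs_moment r + ennreal (\<bar>of_int n\<bar> powr r) * abs_moment r)"
    by (intro mult_left_mono add_mono b) auto
  also have "\<dots> = ennreal (2 * (2 powr r * \<bar>of_int n\<bar> powr (- r))) * abs_moment r"
  proof -
    have c: "?c * \<bar>of_int n\<bar> powr r = 2 powr r * \<bar>of_int n\<bar> powr (- r)"
      using False by (simp add: mult.assoc flip: powr_add)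
    have "ennreal ?c * (ennreal (\<bar>of_int n\<bar> powr r) * abs_moment r + ennreal (\<bar>of_int n\<bar> powr r) * abs_moment r)
      = (ennreal ?c * ennreal (\<bar>of_int n\<bar> powr r)) * abs_moment r + (ennreal ?c * ennreal (\<bar>of_int n\<bar> powr r)) * abs_moment r"
      by (simp only: distrib_left mult.assoc)
    also have "ennreal ?c * ennreal (\<bar>of_int n\<bar> powr r) = ennreal (2 powr r * \<bar>of_int n\<bar> powr (- r))"
      by (subst ennreal_mult[symmetric]) (simp_all only: c, simp_all)
    finally show ?thesis unfolding mult_2 by (subst ennreal_plus) (auto simp: distrib_right)
  qed
  also have "\<dots> \<le> ennreal (2 * (4 powr r * jap n powr (- r))) * abs_moment r"
    using abs_powr_le_jap[OF r False] by (intro mult_right_mono ennreal_leI) auto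
  also have "\<dots> = moment_const r * ennreal (jap n powr (- r))"
    unfolding moment_const_def by (subst mult.assoc[symmetric], subst ennreal_mult) (auto simp: mult_ac)
  finally show ?thesis .
qed simp


section \<open>The seminorm is measurable\<close>

context admissible_norm begin

text \<open>Orthogonality to the frequencies up to \<open>N\<close> annihilates the coefficients with \<open>|n| \<le> N\<close>, so the
  mean of the \<open>r\<close>-th power of the dominating norm is bounded by a tail of a convergent series, and
  Markov's inequality applies.\<close>

lemma measurable_seminorm_hnorm: "measurable_seminorm (\<lambda>u. enn2real (nrm (fcoeff u)))"
  unfolding measurable_seminorm_def hnorm_def[symmetric]
proof (intro conjI allI impI)
  show "seminorm_on UNIV hnorm"
    by (auto simp: seminorm_on_def hnorm_triangle hnorm_scaleR)
next
  fix \<epsilon> :: real assume \<epsilon>: "0 < \<epsilon>"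
  have r: "0 \<le> r" "0 < r" using exponent by auto
  obtain C where C: "C > 0" "\<And>a. nrm a \<le> ennreal C * ennpowr (fl_mass \<sigma> r a) (1 / r)"
    by (rule dominated_mass) blast
  obtain K where K: "moment_const r = ennreal K" "0 \<le> K"
    using moment_const_finite[OF r(1)] by (cases "moment_const r") auto
  let ?w = "\<lambda>n. ennreal (jap n powr ((\<sigma> - 1) * r))"
  define d where "d = (\<epsilon> / C) powr r"
  \<comment> \<open>A mean of at most \<open>K \<eta>\<close> gives the probability bound \<open>K \<eta> / d \<le> \<epsilon> / 2\<close> in Markov's inequality.\<close>
  define \<eta> where "\<eta> = d * \<epsilon> / (2 * (K + 1))"
  have d: "d > 0" and \<eta>: "\<eta> > 0" using \<epsilon> C K by (auto simp: d_def \<eta>_def)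
  obtain N :: nat where N: "(\<integral>\<^sup>+n. ?w n * indicator {n. int N < \<bar>n\<bar>} n \<partial>count_space UNIV) < ennreal \<eta>"
    using nn_integral_tail_small[OF nn_integral_jap_powr_finite[OF exponent(2)], of "ennreal \<eta>"] \<eta> by auto
  show "\<exists>P\<^sub>\<epsilon>\<in>fin_proj. \<forall>P\<in>fin_proj. orth_proj P P\<^sub>\<epsilon> \<longrightarrow> gauss_cyl {u. \<epsilon> < hnorm (P u)} < \<epsilon>"
  proof (intro bexI[OF _ fin_proj_hproj[of N]] ballI impI)
    fix P :: "hdot1 \<Rightarrow> hdot1" assume P: "P \<in> fin_proj" and orth: "orth_proj P (\<lambda>u. hproj N (fcoeff u))"
    obtain e where e: "onb_of (range P) e" using fin_proj_range_onb[OF P] by blast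
    define m where "m = dim (range P)"
    have eo: "orthonormal m e" "span (e ` {..<m}) = range P"
      using onb_of_orthonormal[OF e] by (auto simp: m_def)
    let ?G = "gauss_vec m e"
    interpret G: prob_space ?G by (rule prob_space_gauss_vec)
    have bessel: "(\<integral>\<^sup>+u. ennreal (\<bar>u \<bullet> h\<bar> powr r) \<partial>?G) \<le> ennreal (norm h powr r) * abs_moment r" for h
    proof -
      have "sqrt (\<Sum>i<m. (e i \<bullet> h)\<^sup>2) \<le> norm h"
        using orthonormal_bessel[OF eo(1), of h] by (intro real_le_lsqrt) auto
      thus ?thesis unfolding gauss_vec_inner_moment
        by (intro mult_right_mono ennreal_leI powr_mono2 r) (auto simp: sum_nonneg)
    qed
    have "{u. \<epsilon> < hnorm u} \<in> sets borel" by measurable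
    hence cyl: "gauss_cyl {u. \<epsilon> < hnorm (P u)} = measure ?G {u. \<epsilon> < hnorm u}"
      using gauss_cyl_eq_gauss_vec[OF P e, of "{u. \<epsilon> < hnorm u}"] by (simp add: m_def)
    have low: "(\<integral>\<^sup>+u. ennreal (cmod (fcoeff u n) powr r) \<partial>?G) = 0" if n: "\<not> int N < \<bar>n\<bar>" for n
    proof (cases "n = 0")
      case False
      have z: "e i \<bullet> mode n z = 0" if "i < m" for i z
      proof -
        have "mode n z = hproj N (fcoeff (mode n z))"
          using n False by (intro hdot1_eqI) (auto simp: fcoeff_hproj fcoeff_mode mem_freqs)
        moreover have "e i \<in> range P" using eo(2) that span_base[of "e i" "e ` {..<m}"] by auto
        ultimately show ?thesis using orth unfolding orth_proj_def by (metis rangeE)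
      qed
      have "(\<integral>\<^sup>+u. ennreal (\<bar>u \<bullet> mode n z\<bar> powr r) \<partial>?G) = 0" for z
        unfolding gauss_vec_inner_moment using z r by simp
      hence ae: "AE u in ?G. \<bar>u \<bullet> mode n z\<bar> powr r = 0" for z
        by (subst (asm) nn_integral_0_iff_AE) (auto simp: less_le)
      have "AE u in ?G. cmod (fcoeff u n) = 0"
        using ae[of 1] ae[of \<i>]
      proof eventually_elim
        case (elim u)
        have "Re (fcoeff u n) = 0" "Im (fcoeff u n) = 0"
          using elim False by (auto simp: inner_commute[of u] inner_mode)
        thus ?case by (simp add: complex_eq_iff)
      qed
      hence "(\<integral>\<^sup>+u. ennreal (cmod (fcoeff u n) powr r) \<partial>?G) = (\<integral>\<^sup>+u. 0 \<partial>?G)"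
        by (intro nn_integral_cong_AE) auto
      thus ?thesis by simp
    qed simp
    have meas: "(\<lambda>u. fcoeff u n) \<in> borel_measurable borel" for n
    proof (rule borel_measurable_continuous_onI)
      have "1-lipschitz_on UNIV (\<lambda>u. fcoeff u n)"
        using fcoeff_le_norm[of "u - v" n for u v]
        by (intro lipschitz_onI) (auto simp: dist_norm fcoeff_diff)
      thus "continuous_on UNIV (\<lambda>u. fcoeff u n)" by (rule lipschitz_on_continuous_on)
    qed
    note meas [measurable]
    have "(\<integral>\<^sup>+u. fl_mass \<sigma> r (fcoeff u) \<partial>?G)
        = (\<integral>\<^sup>+n. (\<integral>\<^sup>+u. ennreal ((jap n powr \<sigma> * cmod (fcoeff u n)) powr r) \<partial>?G) \<partial>count_space UNIV)"
      unfolding fl_mass_def by (rule nn_integral_count_space_nn_integral) auto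
    also have "\<dots> = (\<integral>\<^sup>+n. ennreal (jap n powr (\<sigma> * r)) * (\<integral>\<^sup>+u. ennreal (cmod (fcoeff u n) powr r) \<partial>?G) \<partial>count_space UNIV)"
    proof (intro nn_integral_cong)
      fix n
      have "(\<integral>\<^sup>+u. ennreal ((jap n powr \<sigma> * cmod (fcoeff u n)) powr r) \<partial>?G)
        = (\<integral>\<^sup>+u. ennreal (jap n powr (\<sigma> * r)) * ennreal (cmod (fcoeff u n) powr r) \<partial>?G)"
        by (intro nn_integral_cong) (simp add: powr_mult powr_powr flip: ennreal_mult)
      thus "(\<integral>\<^sup>+u. ennreal ((jap n powr \<sigma> * cmod (fcoeff u n)) powr r) \<partial>?G)
        = ennreal (jap n powr (\<sigma> * r)) * (\<integral>\<^sup>+u. ennreal (cmod (fcoeff u n) powr r) \<partial>?G)"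
        by (simp add: nn_integral_cmult)
    qed
    also have "\<dots> \<le> (\<integral>\<^sup>+n. ennreal K * (?w n * indicator {n. int N < \<bar>n\<bar>} n) \<partial>count_space UNIV)"
    proof (intro nn_integral_mono)
      fix n
      show "ennreal (jap n powr (\<sigma> * r)) * (\<integral>\<^sup>+u. ennreal (cmod (fcoeff u n) powr r) \<partial>?G)
        \<le> ennreal K * (?w n * indicator {n. int N < \<bar>n\<bar>} n)"
      proof (cases "int N < \<bar>n\<bar>")
        case True
        have "ennreal (jap n powr (\<sigma> * r)) * (\<integral>\<^sup>+u. ennreal (cmod (fcoeff u n) powr r) \<partial>?G)
          \<le> ennreal (jap n powr (\<sigma> * r)) * (moment_const r * ennreal (jap n powr (- r)))"
          by (intro mult_left_mono coeff_moment[where U = "\<lambda>u. u", OF r(1)] bessel) auto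
        also have "\<dots> = ennreal K * (ennreal (jap n powr (\<sigma> * r)) * ennreal (jap n powr (- r)))"
          by (simp add: K mult_ac)
        also have "ennreal (jap n powr (\<sigma> * r)) * ennreal (jap n powr (- r)) = ?w n"
          by (simp add: left_diff_distrib flip: ennreal_mult powr_add)
        finally show ?thesis using True by simp
      qed (simp add: low)
    qed
    also have "\<dots> = ennreal K * (\<integral>\<^sup>+n. ?w n * indicator {n. int N < \<bar>n\<bar>} n \<partial>count_space UNIV)"
      by (rule nn_integral_cmult) simp
    also have "\<dots> \<le> ennreal K * ennreal \<eta>" using N by (intro mult_left_mono) auto
    also have "\<dots> = ennreal (K * \<eta>)" using K \<eta> by (simp add: ennreal_mult)
    finally have mass: "(\<integral>\<^sup>+u. fl_mass \<sigma> r (fcoeff u) \<partial>?G) \<le> ennreal (K * \<eta>)" .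
    have incl: "{u. \<epsilon> < hnorm u} \<subseteq> {u \<in> space ?G. 1 \<le> ennreal (1 / d) * fl_mass \<sigma> r (fcoeff u)}"
    proof safe
      fix u assume u: "\<epsilon> < hnorm u"
      have "ennreal \<epsilon> \<le> nrm (fcoeff u)" using u by (simp add: ennreal_leI flip: ennreal_hnorm)
      also have "\<dots> \<le> ennreal C * ennpowr (fl_mass \<sigma> r (fcoeff u)) (1 / r)" by (rule C)
      finally have "ennreal (1 / C) * ennreal \<epsilon> \<le> ennreal (1 / C) * (ennreal C * ennpowr (fl_mass \<sigma> r (fcoeff u)) (1 / r))"
        by (rule mult_left_mono) simp
      also have "\<dots> = ennpowr (fl_mass \<sigma> r (fcoeff u)) (1 / r)"
        using C(1) by (subst mult.assoc[symmetric], subst ennreal_mult[symmetric]) auto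
      finally have "ennreal (\<epsilon> / C) \<le> ennpowr (fl_mass \<sigma> r (fcoeff u)) (1 / r)"
        using C(1) \<epsilon> by (simp flip: ennreal_mult)
      hence "ennpowr (ennreal (\<epsilon> / C)) r \<le> fl_mass \<sigma> r (fcoeff u)" by (simp add: ennpowr_le_iff r)
      hence "ennreal d \<le> fl_mass \<sigma> r (fcoeff u)" using \<epsilon> C(1) by (simp add: d_def)
      hence "ennreal (1 / d) * ennreal d \<le> ennreal (1 / d) * fl_mass \<sigma> r (fcoeff u)"
        by (rule mult_left_mono) simp
      moreover have "ennreal (1 / d) * ennreal d = 1" using d by (simp flip: ennreal_mult)
      ultimately show "1 \<le> ennreal (1 / d) * fl_mass \<sigma> r (fcoeff u)" by simp
    qed simp
    have fm [measurable]: "(\<lambda>u. fl_mass \<sigma> r (fcoeff u)) \<in> borel_measurable ?G"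
    proof -
      have "(\<lambda>u. lp_norm 1 (\<lambda>n. ennreal ((jap n powr \<sigma> * cmod (fcoeff u n)) powr r))) \<in> borel_measurable ?G"
        by (rule borel_measurable_lp_norm) auto
      thus ?thesis by (simp add: Lp_norm_ennreal[of 1, simplified] fl_mass_def)
    qed
    have "emeasure ?G {u. \<epsilon> < hnorm u} \<le> emeasure ?G {u \<in> space ?G. 1 \<le> ennreal (1 / d) * fl_mass \<sigma> r (fcoeff u)}"
      by (rule emeasure_mono[OF incl]) measurable
    also have "\<dots> \<le> ennreal (1 / d) * (\<integral>\<^sup>+u. fl_mass \<sigma> r (fcoeff u) * indicator (space ?G) u \<partial>?G)"
      by (rule nn_integral_Markov_inequality) measurable
    also have "\<dots> \<le> ennreal (1 / d) * ennreal (K * \<eta>)" using mass by (intro mult_left_mono) auto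
    also have "\<dots> = ennreal (K * \<eta> / d)" using d K \<eta> by (simp flip: ennreal_mult)
    finally have "measure ?G {u. \<epsilon> < hnorm u} \<le> K * \<eta> / d"
      using d K \<eta> by (simp add: G.emeasure_eq_measure)
    also have "\<dots> = (K / (K + 1)) * (\<epsilon> / 2)" using d by (simp add: \<eta>_def)
    also have "\<dots> \<le> 1 * (\<epsilon> / 2)" using K \<epsilon> by (intro mult_right_mono) auto
    also have "\<dots> < \<epsilon>" using \<epsilon> by simp
    finally show "gauss_cyl {u. \<epsilon> < hnorm (P u)} < \<epsilon>" unfolding cyl .
  qed
qed

end


section \<open>The mean-zero Wiener measure\<close>

lemma measurable_Complex_pair:
  "(\<lambda>(x, y). Complex x y) \<in> borel_measurable (density lborel std_normal_density \<Otimes>\<^sub>M density lborel std_normal_density)"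
proof -
  have "(\<lambda>z. complex_of_real (fst z) + \<i> * complex_of_real (snd z))
      \<in> borel_measurable (density lborel std_normal_density \<Otimes>\<^sub>M density lborel std_normal_density)"
    by measurable
  thus ?thesis by (simp add: case_prod_beta' Complex_eq)
qed

lemma prob_space_std_normal_pair: "prob_space (std_normal_distribution \<Otimes>\<^sub>M std_normal_distribution)"
proof -
  interpret N: prob_space std_normal_distribution by (rule prob_space_std_normal)
  interpret P: pair_prob_space std_normal_distribution std_normal_distribution ..
  show ?thesis by (rule P.prob_space_axioms)
qed

lemma prob_space_std_complex_normal: "prob_space std_complex_normal"
  unfolding std_complex_normal_def
  by (rule prob_space.prob_space_distr[OF prob_space_std_normal_pair measurable_Complex_pair])

lemma sets_std_complex_normal [simp, measurable_cong]: "sets std_complex_normal = sets borel"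
  and space_std_complex_normal [simp]: "space std_complex_normal = UNIV"
  by (simp_all add: std_complex_normal_def)

lemma product_prob_space_std_complex_normal: "product_prob_space (\<lambda>_. std_complex_normal)"
  using prob_space_std_complex_normal
  by (auto simp: product_prob_space_def product_sigma_finite_def product_prob_space_axioms_def
      prob_space_imp_sigma_finite)

lemma char_std_complex_normal:
  "(CLINT z|std_complex_normal. iexp (a * Re z + b * Im z)) = exp (- (a\<^sup>2 + b\<^sup>2) / 2)"
proof -
  interpret N: prob_space std_normal_distribution by (rule prob_space_std_normal)
  interpret P: pair_prob_space std_normal_distribution std_normal_distribution ..
  let ?N = "std_normal_distribution"
  have int: "integrable (?N \<Otimes>\<^sub>M ?N) (\<lambda>z. iexp (a * fst z + b * snd z))"
    by (rule P.integrable_const_bound[of _ 1]) auto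
  have "(CLINT z|std_complex_normal. iexp (a * Re z + b * Im z)) = (CLINT z|?N \<Otimes>\<^sub>M ?N. iexp (a * fst z + b * snd z))"
    unfolding std_complex_normal_def
    by (subst integral_distr[OF measurable_Complex_pair]) (auto simp: case_prod_beta')
  also have "\<dots> = (CLINT x|?N. CLINT y|?N. iexp (a * x + b * y))"
    using P.integral_fst'[OF int] by simp
  also have "\<dots> = (CLINT x|?N. CLINT y|?N. iexp (a * x) * iexp (b * y))"
    by (simp add: distrib_left exp_add)
  also have "\<dots> = (CLINT x|?N. iexp (a * x)) * (CLINT y|?N. iexp (b * y))"
    by simp
  also have "\<dots> = char ?N a * char ?N b" by (simp add: char_def)
  also have "\<dots> = complex_of_real (exp (- a\<^sup>2 / 2) * exp (- b\<^sup>2 / 2))"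
    unfolding char_std_normal_distribution by simp
  also have "exp (- a\<^sup>2 / 2) * exp (- b\<^sup>2 / 2) = exp (- (a\<^sup>2 + b\<^sup>2) / 2)"
    by (subst exp_add[symmetric]) (simp add: field_simps)
  finally show ?thesis .
qed

abbreviation noise :: "(int \<Rightarrow> complex) measure"
  where "noise \<equiv> PiM (UNIV - {0}) (\<lambda>_. std_complex_normal)"

definition wiener_coeff :: "(int \<Rightarrow> complex) \<Rightarrow> int \<Rightarrow> complex"
  where "wiener_coeff g n = (if n = 0 then 0 else g n / of_int n)"

lemma measurable_noise_component: "n \<noteq> 0 \<Longrightarrow> (\<lambda>g. g n) \<in> borel_measurable noise"
  using measurable_component_singleton[of n "UNIV - {0}" "\<lambda>_. std_complex_normal"]
  by (simp cong: measurable_cong_sets)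

lemma measurable_wiener_coeff: "wiener_coeff \<in> measurable noise (PiM UNIV (\<lambda>_. borel))"
proof (rule measurable_PiM_single')
  fix n :: int
  show "(\<lambda>g. wiener_coeff g n) \<in> borel_measurable noise"
    by (cases "n = 0") (auto simp: wiener_coeff_def intro!: borel_measurable_divide measurable_noise_component)
qed auto

lemma wiener_measure_eq: "wiener_measure = distr noise (PiM UNIV (\<lambda>_. borel)) wiener_coeff"
  by (simp add: wiener_measure_def wiener_coeff_def[abs_def])

lemma sets_wiener_measure [simp, measurable_cong]: "sets wiener_measure = sets (PiM UNIV (\<lambda>_. borel))"
  and space_wiener_measure [simp]: "space wiener_measure = UNIV"
  by (simp_all add: wiener_measure_def space_PiM)

lemma prob_space_wiener_measure: "prob_space wiener_measure"
  unfolding wiener_measure_eq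
  by (rule prob_space.prob_space_distr[OF prob_space_PiM measurable_wiener_coeff])
     (rule prob_space_std_complex_normal)

lemma wiener_measure_zero_coeff: "AE x in wiener_measure. x 0 = 0"
  unfolding wiener_measure_eq
proof (subst AE_distr_iff[OF measurable_wiener_coeff])
  have "(\<lambda>x. x 0) \<in> borel_measurable (PiM UNIV (\<lambda>_::int. borel :: complex measure))"
    by (rule measurable_component_singleton) simp
  thus "{x \<in> space (PiM UNIV (\<lambda>_::int. borel)). x 0 = (0::complex)} \<in> sets (PiM UNIV (\<lambda>_. borel))"
    by measurable
qed (simp add: wiener_coeff_def)

text \<open>The inner product of a truncated sample with \<open>h\<close> is a finite sum of independent Gaussians, with
  total variance \<open>|P\<^sub>N h|\<^sup>2\<close>.\<close>

lemma char_wiener_measure: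
  "(CLINT x|wiener_measure. iexp (hproj N x \<bullet> h)) = exp (- (norm (hproj N (fcoeff h)))\<^sup>2 / 2)"
proof -
  interpret C: prob_space std_complex_normal by (rule prob_space_std_complex_normal)
  interpret product_prob_space "\<lambda>_::int. std_complex_normal" "UNIV - {0}" by (rule product_prob_space_std_complex_normal)
  let ?J = "freqs N"
  let ?\<phi> = "\<lambda>n z. iexp (of_int n * Re (fcoeff h n) * Re z + of_int n * Im (fcoeff h n) * Im z)"
  have "(\<lambda>x. hproj N x \<bullet> h) \<in> borel_measurable (PiM UNIV (\<lambda>_. borel))"
    using measurable_hproj[of N] by measurable
  hence m: "(\<lambda>x. iexp (hproj N x \<bullet> h)) \<in> borel_measurable (PiM UNIV (\<lambda>_. borel))" by measurable
  have "(CLINT x|wiener_measure. iexp (hproj N x \<bullet> h)) = (CLINT g|noise. iexp (hproj N (wiener_coeff g) \<bullet> h))"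
    unfolding wiener_measure_eq by (rule integral_distr[OF measurable_wiener_coeff m])
  also have "\<dots> = (CLINT g|noise. (\<Prod>n\<in>?J. ?\<phi> n (restrict g ?J n)))"
  proof (intro Bochner_Integration.integral_cong refl)
    fix g :: "int \<Rightarrow> complex"
    have "hproj N (wiener_coeff g) \<bullet> h
        = (\<Sum>n\<in>?J. of_int n * Re (fcoeff h n) * Re (g n) + of_int n * Im (fcoeff h n) * Im (g n))"
      unfolding inner_hproj
    proof (intro sum.cong refl)
      fix n assume "n \<in> ?J"
      hence n: "n \<noteq> 0" by (auto simp: mem_freqs)
      have "Re (g n / of_int n) = Re (g n) / of_int n" "Im (g n / of_int n) = Im (g n) / of_int n"
        by (simp_all add: Re_divide_of_real[of _ "of_int n", simplified] Im_divide_of_real[of _ "of_int n", simplified])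
      thus "(of_int n)\<^sup>2 * (Re (wiener_coeff g n) * Re (fcoeff h n) + Im (wiener_coeff g n) * Im (fcoeff h n))
        = of_int n * Re (fcoeff h n) * Re (g n) + of_int n * Im (fcoeff h n) * Im (g n)"
        using n by (simp add: wiener_coeff_def power2_eq_square distrib_left)
    qed
    hence "iexp (hproj N (wiener_coeff g) \<bullet> h)
        = exp (\<Sum>n\<in>?J. \<i> * complex_of_real (of_int n * Re (fcoeff h n) * Re (g n) + of_int n * Im (fcoeff h n) * Im (g n)))"
      by (simp only: of_real_sum sum_distrib_left)
    also have "\<dots> = (\<Prod>n\<in>?J. ?\<phi> n (g n))" by (rule exp_sum) simp
    finally show "iexp (hproj N (wiener_coeff g) \<bullet> h) = (\<Prod>n\<in>?J. ?\<phi> n (restrict g ?J n))" by simp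
  qed
  also have "\<dots> = (CLINT g|distr noise (PiM ?J (\<lambda>_. std_complex_normal)) (\<lambda>g. restrict g ?J). (\<Prod>n\<in>?J. ?\<phi> n (g n)))"
  proof (rule integral_distr[symmetric])
    show "(\<lambda>g. restrict g ?J) \<in> measurable noise (PiM ?J (\<lambda>_. std_complex_normal))"
      by (rule measurable_restrict_subset) (auto simp: freqs_def)
    have c: "(\<lambda>g. g n) \<in> borel_measurable (PiM ?J (\<lambda>_. std_complex_normal))" if "n \<in> ?J" for n
      using measurable_component_singleton[OF that, of "\<lambda>_. std_complex_normal"]
      by (simp cong: measurable_cong_sets)
    show "(\<lambda>g. \<Prod>n\<in>?J. ?\<phi> n (g n)) \<in> borel_measurable (PiM ?J (\<lambda>_. std_complex_normal))"
    proof (rule borel_measurable_prod)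
      fix n assume "n \<in> ?J"
      note [measurable] = c[OF this]
      show "(\<lambda>g. ?\<phi> n (g n)) \<in> borel_measurable (PiM ?J (\<lambda>_. std_complex_normal))" by measurable
    qed
  qed
  also have "distr noise (PiM ?J (\<lambda>_. std_complex_normal)) (\<lambda>g. restrict g ?J) = PiM ?J (\<lambda>_. std_complex_normal)"
    by (rule distr_PiM_restrict_finite) (auto simp: freqs_def)
  also have "(CLINT g|PiM ?J (\<lambda>_. std_complex_normal). (\<Prod>n\<in>?J. ?\<phi> n (g n)))
      = (\<Prod>n\<in>?J. CLINT z|std_complex_normal. ?\<phi> n z)"
    by (rule product_integral_prod) (auto intro!: C.integrable_const_bound[of _ 1])
  also have "\<dots> = (\<Prod>n\<in>?J. complex_of_real (exp (- ((of_int n)\<^sup>2 * (cmod (fcoeff h n))\<^sup>2) / 2)))"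
    unfolding char_std_complex_normal by (simp add: cmod_power2 power_mult_distrib distrib_left)
  also have "\<dots> = complex_of_real (\<Prod>n\<in>?J. exp (- ((of_int n)\<^sup>2 * (cmod (fcoeff h n))\<^sup>2) / 2))"
    by (rule of_real_prod[symmetric])
  also have "(\<Prod>n\<in>?J. exp (- ((of_int n)\<^sup>2 * (cmod (fcoeff h n))\<^sup>2) / 2))
      = exp (\<Sum>n\<in>?J. - ((of_int n)\<^sup>2 * (cmod (fcoeff h n))\<^sup>2) / 2)"
    by (rule exp_sum[symmetric]) simp
  also have "(\<Sum>n\<in>?J. - ((of_int n)\<^sup>2 * (cmod (fcoeff h n))\<^sup>2) / 2) = - (norm (hproj N (fcoeff h)))\<^sup>2 / 2"
    unfolding norm_hproj_fcoeff by (simp add: sum_negf sum_divide_distrib)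
  finally show ?thesis .
qed


text \<open>The truncation to frequencies up to \<open>|n|\<close> has the same \<open>n\<close>-th coefficient and is a Gaussian
  vector in the Sobolev space.\<close>

lemma wiener_coeff_moment:
  assumes r: "0 \<le> r"
  shows "(\<integral>\<^sup>+x. ennreal (cmod (x n) powr r) \<partial>wiener_measure) \<le> moment_const r * ennreal (jap n powr (- r))"
proof -
  let ?U = "hproj (nat \<bar>n\<bar>)"
  have m [measurable]: "?U \<in> borel_measurable wiener_measure"
    using measurable_hproj by (simp cong: measurable_cong_sets)
  have "(\<integral>\<^sup>+x. ennreal (\<bar>?U x \<bullet> h\<bar> powr r) \<partial>wiener_measure) \<le> ennreal (norm h powr r) * abs_moment r" for h
  proof -
    have "(\<integral>\<^sup>+x. ennreal (\<bar>?U x \<bullet> h\<bar> powr r) \<partial>wiener_measure)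
        = ennreal (norm (?U (fcoeff h)) powr r) * abs_moment r"
    proof (rule gaussian_moment[OF prob_space_wiener_measure])
      fix t
      have "?U (fcoeff (t *\<^sub>R h)) = t *\<^sub>R ?U (fcoeff h)" by (rule hdot1_eqI) (simp add: fcoeff_hproj)
      hence "(norm (?U (fcoeff (t *\<^sub>R h))))\<^sup>2 = (t * norm (?U (fcoeff h)))\<^sup>2" by (simp add: power_mult_distrib)
      thus "(CLINT x|wiener_measure. iexp (t * (?U x \<bullet> h))) = exp (- (t * norm (?U (fcoeff h)))\<^sup>2 / 2)"
        using char_wiener_measure[of "nat \<bar>n\<bar>" "t *\<^sub>R h"] by simp
    qed auto
    thus ?thesis using norm_hproj_le r by (auto intro!: mult_right_mono ennreal_leI powr_mono2)
  qed
  note coeff_moment[OF r m this, of n]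
  moreover have "AE x in wiener_measure. fcoeff (?U x) n = x n"
    using wiener_measure_zero_coeff by eventually_elim (auto simp: fcoeff_hproj mem_freqs)
  hence "(\<integral>\<^sup>+x. ennreal (cmod (x n) powr r) \<partial>wiener_measure)
      = (\<integral>\<^sup>+x. ennreal (cmod (fcoeff (?U x) n) powr r) \<partial>wiener_measure)"
    by (intro nn_integral_cong_AE) (auto elim: eventually_mono)
  ultimately show ?thesis by simp
qed


section \<open>Extension of the cylinder measure\<close>

text \<open>The projection onto the span of the \<open>v\<^sub>j\<close> does not change the inner products with them, so this
  set is a cylinder set.\<close>

lemma gauss_cyl_functionals:
  fixes v :: "nat \<Rightarrow> 'h::{real_inner,polish_space}"
  assumes F: "F \<in> sets (PiM {..<n} (\<lambda>_. borel))"
  obtains m e where "orthonormal m e" "v ` {..<n} \<subseteq> span (e ` {..<m})"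
    "gauss_cyl {u. (\<lambda>j\<in>{..<n}. u \<bullet> v j) \<in> F}
      = measure (distr (gauss_vec m e) (PiM {..<n} (\<lambda>_. borel)) (\<lambda>u. \<lambda>j\<in>{..<n}. u \<bullet> v j)) F"
proof -
  obtain e where e: "onb_of (span (v ` {..<n})) e" using onb_of_exists[of "v ` {..<n}"] by auto
  define m where "m = dim (span (v ` {..<n}))"
  have eo: "orthonormal m e" "span (e ` {..<m}) = span (v ` {..<n})"
    using onb_of_orthonormal[OF e] by (auto simp: m_def)
  define P where "P u = (\<Sum>i<m. (u \<bullet> e i) *\<^sub>R e i)" for u
  have P: "P \<in> fin_proj" "range P = span (v ` {..<n})"
    using orthonormal_fin_proj[OF eo(1)] eo(2) by (auto simp: P_def[abs_def])
  have Pv: "P u \<bullet> v j = u \<bullet> v j" if "j < n" for u j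
  proof -
    have "v j \<in> span (e ` {..<m})" using that by (auto simp: eo intro: span_base)
    hence "P (v j) = v j" using orthonormal_expansion[OF eo(1)] by (simp add: P_def)
    moreover have "P u \<bullet> v j = u \<bullet> P (v j)" using P(1) by (simp add: fin_proj_def)
    ultimately show ?thesis by simp
  qed
  define F' where "F' = {w. (\<lambda>j\<in>{..<n}. w \<bullet> v j) \<in> F}"
  have mv: "(\<lambda>u. \<lambda>j\<in>{..<n}. u \<bullet> v j) \<in> measurable borel (PiM {..<n} (\<lambda>_. borel))"
    by (rule measurable_restrict) simp
  have F': "F' \<in> sets borel"
    using measurable_sets[OF mv F] by (simp add: F'_def vimage_def)
  have "{u. (\<lambda>j\<in>{..<n}. u \<bullet> v j) \<in> F} = {u. P u \<in> F'}"
    unfolding F'_def using Pv by (auto cong: restrict_cong)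
  hence "gauss_cyl {u. (\<lambda>j\<in>{..<n}. u \<bullet> v j) \<in> F} = measure (gauss_vec m e) F'"
    using gauss_cyl_eq_gauss_vec[OF P(1) _ F', of e] e P(2) by (simp add: m_def)
  also have "\<dots> = measure (distr (gauss_vec m e) (PiM {..<n} (\<lambda>_. borel)) (\<lambda>u. \<lambda>j\<in>{..<n}. u \<bullet> v j)) F"
    using mv F by (subst measure_distr) (auto simp: F'_def vimage_def cong: measurable_cong_sets)
  finally show thesis using that[of m e] eo by (auto simp: span_superset eo(2))
qed

context admissible_norm begin

text \<open>The norm itself need not be a measurable function of the coefficients, but its restriction to the
  Sobolev space is continuous and the truncations depend measurably on the coefficients.\<close>

lemma measurable_closure: "cl \<in> sets (PiM UNIV (\<lambda>_. borel))"
proof -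
  have eq: "cl = {a. a 0 = 0 \<and> (\<forall>k. \<exists>N. \<forall>M\<in>{N..}. hnorm (hproj M a - hproj N a) \<le> 1 / real (Suc k))}"
    (is "_ = {a. ?Q a}")
  proof (intro set_eqI iffI CollectI)
    have h: "nrm (trunc M a - trunc N a) = ennreal (hnorm (hproj M a - hproj N a))" if "a 0 = 0" for M N a
      unfolding ennreal_hnorm by (simp add: fcoeff_diff_fun fcoeff_hproj_eq_trunc that)
    fix a
    show "?Q a" if a: "a \<in> cl"
    proof (intro conjI allI)
      show a0: "a 0 = 0" by (rule closure_zero_coeff[OF a])
      fix k
      obtain N where N: "\<forall>M\<ge>N. nrm (trunc M a - trunc N a) \<le> ennreal (1 / real (Suc k))"
        using closure_trunc_Cauchy[OF a, of "1 / real (Suc k)"] by auto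
      have "hnorm (hproj M a - hproj N a) \<le> 1 / real (Suc k)" if "M \<ge> N" for M
      proof -
        have "ennreal (hnorm (hproj M a - hproj N a)) \<le> ennreal (1 / real (Suc k))"
          using N that unfolding h[where a = a, OF a0] by blast
        thus ?thesis by (rule ennreal_le_iff[THEN iffD1, rotated]) simp
      qed
      thus "\<exists>N. \<forall>M\<in>{N..}. hnorm (hproj M a - hproj N a) \<le> 1 / real (Suc k)" by auto
    qed
    show "a \<in> cl" if Q: "a \<in> {a. ?Q a}"
    proof (rule closure_if_trunc_Cauchy)
      show a0: "a 0 = 0" using Q by simp
      fix e :: real assume "0 < e"
      then obtain k where k: "1 / real (Suc k) < e" using nat_approx_posE by blast
      obtain N where "\<forall>M\<in>{N..}. hnorm (hproj M a - hproj N a) \<le> 1 / real (Suc k)" using Q by blast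
      hence N: "hnorm (hproj M a - hproj N a) \<le> 1 / real (Suc k)" if "M \<ge> N" for M using that by simp
      have "nrm (trunc M a - trunc N a) \<le> ennreal e" if "M \<ge> N" for M
        unfolding h[where a = a, OF a0] using N[OF that] k by (intro ennreal_leI) linarith
      thus "\<exists>N. \<forall>M\<ge>N. nrm (trunc M a - trunc N a) \<le> ennreal e" by blast
    qed
  qed
  have [measurable]: "(\<lambda>x. x 0) \<in> borel_measurable (PiM UNIV (\<lambda>_::int. borel :: complex measure))"
    by (rule measurable_component_singleton) simp
  note measurable_hproj [measurable]
  have "{a \<in> space (PiM UNIV (\<lambda>_::int. borel :: complex measure)). ?Q a} \<in> sets (PiM UNIV (\<lambda>_. borel))"
    by measurable
  thus ?thesis unfolding eq by (simp add: space_PiM)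
qed

lemma AE_wiener_closure: "AE x in wiener_measure. x \<in> cl"
proof -
  have r: "0 \<le> r" "0 < r" using exponent by auto
  have [measurable]: "(\<lambda>x. x n) \<in> borel_measurable wiener_measure" for n
    using measurable_component_singleton[of n UNIV "\<lambda>_::int. borel :: complex measure"]
    by (simp cong: measurable_cong_sets)
  have fm [measurable]: "(\<lambda>x. fl_mass \<sigma> r x) \<in> borel_measurable wiener_measure"
  proof -
    have "(\<lambda>x. lp_norm 1 (\<lambda>n. ennreal ((jap n powr \<sigma> * cmod (x n)) powr r))) \<in> borel_measurable wiener_measure"
      by (rule borel_measurable_lp_norm) auto
    thus ?thesis by (simp add: Lp_norm_ennreal[of 1, simplified] fl_mass_def)
  qed
  have "(\<integral>\<^sup>+x. fl_mass \<sigma> r x \<partial>wiener_measure)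
      = (\<integral>\<^sup>+n. (\<integral>\<^sup>+x. ennreal ((jap n powr \<sigma> * cmod (x n)) powr r) \<partial>wiener_measure) \<partial>count_space UNIV)"
    unfolding fl_mass_def by (rule nn_integral_count_space_nn_integral) auto
  also have "\<dots> \<le> (\<integral>\<^sup>+n. moment_const r * ennreal (jap n powr ((\<sigma> - 1) * r)) \<partial>count_space UNIV)"
  proof (intro nn_integral_mono)
    fix n
    have "(\<integral>\<^sup>+x. ennreal ((jap n powr \<sigma> * cmod (x n)) powr r) \<partial>wiener_measure)
        = (\<integral>\<^sup>+x. ennreal (jap n powr (\<sigma> * r)) * ennreal (cmod (x n) powr r) \<partial>wiener_measure)"
      by (intro nn_integral_cong) (simp add: powr_mult powr_powr flip: ennreal_mult)
    also have "\<dots> = ennreal (jap n powr (\<sigma> * r)) * (\<integral>\<^sup>+x. ennreal (cmod (x n) powr r) \<partial>wiener_measure)"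
      by (rule nn_integral_cmult) measurable
    also have "\<dots> \<le> ennreal (jap n powr (\<sigma> * r)) * (moment_const r * ennreal (jap n powr (- r)))"
      by (intro mult_left_mono wiener_coeff_moment r) simp
    also have "\<dots> = moment_const r * (ennreal (jap n powr (\<sigma> * r)) * ennreal (jap n powr (- r)))"
      by (simp add: mult_ac)
    also have "ennreal (jap n powr (\<sigma> * r)) * ennreal (jap n powr (- r)) = ennreal (jap n powr ((\<sigma> - 1) * r))"
      by (simp add: left_diff_distrib flip: ennreal_mult powr_add)
    finally show "(\<integral>\<^sup>+x. ennreal ((jap n powr \<sigma> * cmod (x n)) powr r) \<partial>wiener_measure)
      \<le> moment_const r * ennreal (jap n powr ((\<sigma> - 1) * r))" .
  qed
  also have "\<dots> = moment_const r * (\<integral>\<^sup>+n. ennreal (jap n powr ((\<sigma> - 1) * r)) \<partial>count_space UNIV)"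
    by (rule nn_integral_cmult) simp
  also have "\<dots> < \<infinity>"
    using moment_const_finite[OF r(1)] nn_integral_jap_powr_finite[OF exponent(2)]
    by (simp add: ennreal_mult_less_top)
  finally have "AE x in wiener_measure. fl_mass \<sigma> r x \<noteq> \<infinity>"
    by (intro nn_integral_PInf_AE fm) auto
  thus ?thesis using wiener_measure_zero_coeff
  proof eventually_elim
    case (elim x)
    hence fin: "fl_mass \<sigma> r x < \<infinity>" by (simp add: less_top)
    show ?case
    proof (rule closureI)
      fix e :: real assume "0 < e"
      then obtain N where "\<And>M. M \<ge> N \<Longrightarrow> nrm (x - trunc M x) < ennreal e"
        using nrm_tail_small[OF fin] by blast
      thus "\<exists>N. nrm (x - trunc N x) \<le> ennreal e" using less_imp_le by blast
    qed (use elim in simp)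
  qed
qed

lemma dual_on_limit:
  assumes f: "f \<in> dual_on cl (\<lambda>a. enn2real (nrm a))" and fv: "\<And>u. f (fcoeff u) = u \<bullet> v" and x: "x \<in> cl"
  shows "(\<lambda>N. hproj N x \<bullet> v) \<longlonglongrightarrow> f x"
proof (rule LIMSEQ_I)
  fix e :: real assume e: "0 < e"
  obtain C0 where C0: "\<And>y. y \<in> cl \<Longrightarrow> \<bar>f y\<bar> \<le> C0 * enn2real (nrm y)"
    using f unfolding dual_on_def by blast
  define C where "C = max 1 C0"
  have C: "\<bar>f y\<bar> \<le> C * enn2real (nrm y)" if "y \<in> cl" for y
    using C0[OF that] mult_right_mono[of C0 C "enn2real (nrm y)"] by (simp add: C_def)
  have C1: "C > 0" by (simp add: C_def)
  have add: "f (y + z) = f y + f z" if "y \<in> cl" "z \<in> cl" for y z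
    using f that by (simp add: dual_on_def)
  obtain N where N: "\<And>M. M \<ge> N \<Longrightarrow> nrm (x - trunc M x) < ennreal (e / C)"
    using closure_tail_small[OF x, of "e / C"] e C1 by auto
  have "norm (hproj M x \<bullet> v - f x) < e" if "M \<ge> N" for M
  proof -
    have t: "trunc M x = fcoeff (hproj M x)" using closure_zero_coeff[OF x] by (simp add: fcoeff_hproj_eq_trunc)
    have cl: "trunc M x \<in> cl" "x - trunc M x \<in> cl"
      unfolding t by (auto intro!: closure_diff x fcoeff_in_closure)
    have "f x = f (x - trunc M x) + hproj M x \<bullet> v"
      using add[OF cl(2,1)] by (simp add: fv t)
    hence "norm (hproj M x \<bullet> v - f x) = \<bar>f (x - trunc M x)\<bar>" by simp
    also have "\<dots> \<le> C * enn2real (nrm (x - trunc M x))" by (rule C[OF cl(2)])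
    also have "enn2real (nrm (x - trunc M x)) < e / C"
      using N[OF that] by (subst enn2real_less_iff) (auto intro: less_trans)
    finally show ?thesis using C1 by (simp add: field_simps)
  qed
  thus "\<exists>no. \<forall>n\<ge>no. norm (hproj n x \<bullet> v - f x) < e" by blast
qed

text \<open>Extended by zero off the closure, which has full measure, the functionals are random variables.
  They are limits of inner products of the truncated samples, so their joint characteristic function
  is a limit of Gaussian ones; it equals that of the inner products of a Gaussian vector with the
  \<open>v\<^sub>j\<close>.\<close>

lemma extends_gauss_cyl_wiener:
  "extends_gauss_cyl fcoeff cl (\<lambda>a. enn2real (nrm a)) (measure wiener_measure)"
  unfolding extends_gauss_cyl_def
proof (intro allI ballI impI)
  fix n :: nat and f :: "nat \<Rightarrow> (int \<Rightarrow> complex) \<Rightarrow> real" and v :: "nat \<Rightarrow> hdot1" and F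
  assume F: "F \<in> sets (PiM {..<n} (\<lambda>_. borel :: real measure))"
    and "\<forall>j<n. f j \<in> dual_on cl (\<lambda>a. enn2real (nrm a)) \<and> (\<forall>u. f j (fcoeff u) = u \<bullet> v j)"
  hence f: "\<And>j. j < n \<Longrightarrow> f j \<in> dual_on cl (\<lambda>a. enn2real (nrm a))"
    "\<And>j u. j < n \<Longrightarrow> f j (fcoeff u) = u \<bullet> v j" by auto
  interpret W: prob_space wiener_measure by (rule prob_space_wiener_measure)
  have cl: "cl \<in> sets wiener_measure" by (simp add: measurable_closure)
  define X where "X j x = (if x \<in> cl then f j x else 0)" for j x
  define XN where "XN N j x = (if x \<in> cl then hproj N x \<bullet> v j else 0)" for N j x
  have lim: "(\<lambda>N. XN N j x) \<longlonglongrightarrow> X j x" if "j < n" for j x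
    using dual_on_limit[OF f(1)[OF that] f(2)[OF that], of x] by (cases "x \<in> cl") (auto simp: X_def XN_def)
  have mh: "hproj N \<in> borel_measurable wiener_measure" for N
    using measurable_hproj[of N] by (simp cong: measurable_cong_sets)
  have mXN [measurable]: "XN N j \<in> borel_measurable wiener_measure" for N j
    unfolding XN_def[abs_def]
    by (rule measurable_If_set) (use mh cl in \<open>auto intro!: borel_measurable_inner\<close>)
  have mX: "X j \<in> borel_measurable wiener_measure" if "j < n" for j
    by (rule borel_measurable_LIMSEQ_real[OF lim[OF that] mXN])
  obtain m e where e: "orthonormal m e" "v ` {..<n} \<subseteq> span (e ` {..<m})"
    and rhs: "gauss_cyl {u. (\<lambda>j\<in>{..<n}. u \<bullet> v j) \<in> F}
      = measure (distr (gauss_vec m e) (PiM {..<n} (\<lambda>_. borel)) (\<lambda>u. \<lambda>j\<in>{..<n}. u \<bullet> v j)) F"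
    by (rule gauss_cyl_functionals[OF F])
  have law: "distr wiener_measure (PiM {..<n} (\<lambda>_. borel)) (\<lambda>x. \<lambda>j\<in>{..<n}. X j x)
      = distr (gauss_vec m e) (PiM {..<n} (\<lambda>_. borel)) (\<lambda>u. \<lambda>j\<in>{..<n}. u \<bullet> v j)"
  proof (rule joint_law_eq_of_char[OF prob_space_wiener_measure prob_space_gauss_vec])
    fix t
    let ?h = "\<Sum>j<n. t j *\<^sub>R v j"
    have h: "?h \<in> span (e ` {..<m})" using e(2) by (intro span_sum span_scale) auto
    have "(\<lambda>N. CLINT x|wiener_measure. iexp (\<Sum>j<n. t j * XN N j x))
        \<longlonglongrightarrow> (CLINT x|wiener_measure. iexp (\<Sum>j<n. t j * X j x))"
    proof (rule integral_dominated_convergence[where w = "\<lambda>_. 1"])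
      have "(\<lambda>x. \<Sum>j<n. t j * X j x) \<in> borel_measurable wiener_measure"
        by (intro borel_measurable_sum borel_measurable_times borel_measurable_const mX) simp
      thus "(\<lambda>x. iexp (\<Sum>j<n. t j * X j x)) \<in> borel_measurable wiener_measure" by measurable
      show "(\<lambda>x. iexp (\<Sum>j<n. t j * XN N j x)) \<in> borel_measurable wiener_measure" for N by measurable
      show "AE x in wiener_measure. (\<lambda>N. iexp (\<Sum>j<n. t j * XN N j x)) \<longlonglongrightarrow> iexp (\<Sum>j<n. t j * X j x)"
        by (intro AE_I2 tendsto_intros lim) simp
    qed auto
    moreover have "(CLINT x|wiener_measure. iexp (\<Sum>j<n. t j * XN N j x))
        = complex_of_real (exp (- (norm (hproj N (fcoeff ?h)))\<^sup>2 / 2))" for N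
    proof -
      have "(\<lambda>x. hproj N x \<bullet> ?h) \<in> borel_measurable wiener_measure" using mh by measurable
      hence m: "(\<lambda>x. iexp (hproj N x \<bullet> ?h)) \<in> borel_measurable wiener_measure" by measurable
      have "(CLINT x|wiener_measure. iexp (\<Sum>j<n. t j * XN N j x)) = (CLINT x|wiener_measure. iexp (hproj N x \<bullet> ?h))"
      proof (rule integral_cong_AE)
        show "AE x in wiener_measure. iexp (\<Sum>j<n. t j * XN N j x) = iexp (hproj N x \<bullet> ?h)"
          using AE_wiener_closure by eventually_elim (simp add: XN_def inner_sum_right)
      qed (use m in measurable)
      thus ?thesis by (simp only: char_wiener_measure)
    qed
    ultimately have "(\<lambda>N. complex_of_real (exp (- (norm (hproj N (fcoeff ?h)))\<^sup>2 / 2)))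
        \<longlonglongrightarrow> (CLINT x|wiener_measure. iexp (\<Sum>j<n. t j * X j x))" by simp
    moreover have "(\<lambda>N. complex_of_real (exp (- (norm (hproj N (fcoeff ?h)))\<^sup>2 / 2)))
        \<longlonglongrightarrow> complex_of_real (exp (- (norm ?h)\<^sup>2 / 2))"
      by (intro tendsto_intros norm_hproj_tendsto) simp
    ultimately have "(CLINT x|wiener_measure. iexp (\<Sum>j<n. t j * X j x)) = complex_of_real (exp (- (norm ?h)\<^sup>2 / 2))"
      by (rule LIMSEQ_unique)
    also have "\<dots> = (CLINT u|gauss_vec m e. iexp (u \<bullet> ?h))"
      unfolding char_gauss_vec orthonormal_parseval[OF e(1) h] ..
    also have "\<dots> = (CLINT u|gauss_vec m e. iexp (\<Sum>j<n. t j * (u \<bullet> v j)))"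
      by (simp add: inner_sum_right)
    finally show "(CLINT x|wiener_measure. iexp (\<Sum>j<n. t j * X j x))
      = (CLINT u|gauss_vec m e. iexp (\<Sum>j<n. t j * (u \<bullet> v j)))" .
  qed (auto intro: mX)
  have mXr: "(\<lambda>x. \<lambda>j\<in>{..<n}. X j x) \<in> measurable wiener_measure (PiM {..<n} (\<lambda>_. borel))"
    by (rule measurable_restrict) (use mX in auto)
  let ?A = "(\<lambda>x. \<lambda>j\<in>{..<n}. X j x) -` F \<inter> space wiener_measure"
  have A: "?A \<in> sets wiener_measure" by (rule measurable_sets[OF mXr F])
  have eq: "{x \<in> cl. (\<lambda>j\<in>{..<n}. f j x) \<in> F} = cl \<inter> ?A"
    by (auto simp: X_def cong: restrict_cong)
  have "measure wiener_measure {x \<in> cl. (\<lambda>j\<in>{..<n}. f j x) \<in> F} = measure wiener_measure ?A"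
    unfolding eq by (rule W.finite_measure_eq_AE) (use AE_wiener_closure A cl in auto)
  also have "\<dots> = measure (distr wiener_measure (PiM {..<n} (\<lambda>_. borel)) (\<lambda>x. \<lambda>j\<in>{..<n}. X j x)) F"
    by (rule measure_distr[OF mXr F, symmetric])
  finally show "measure wiener_measure {x \<in> cl. (\<lambda>j\<in>{..<n}. f j x) \<in> F}
      = gauss_cyl {u. (\<lambda>j\<in>{..<n}. u \<bullet> v j) \<in> F}"
    unfolding law rhs .
qed

theorem wiener_AWS_nrm: "wiener_AWS nrm"
  unfolding wiener_AWS_def abstract_wiener_space_def abstract_wiener_triple_def
  by (intro conjI inj_fcoeff measurable_seminorm_hnorm completion_via_closure extends_gauss_cyl_wiener)

end


section \<open>Mixed sequence norms\<close>

lemma admissible_norm_equivalent: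
  assumes "admissible_norm nrm0 \<sigma> r"
    and triangle: "\<And>a b. nrm (a + b) \<le> nrm a + nrm b"
    and homogeneous: "\<And>c a. nrm (c *\<^sub>R a) = ennreal \<bar>c\<bar> * nrm a"
    and le: "\<And>a. nrm a \<le> ennreal C * nrm0 a" and ge: "\<And>a. nrm0 a \<le> ennreal D * nrm a"
  shows "admissible_norm nrm \<sigma> r"
proof -
  interpret N: admissible_norm nrm0 \<sigma> r by fact
  define C' where "C' = max 0 C"
  define D' where "D' = max 0 D"
  have nn: "0 \<le> C'" "0 \<le> D'" by (auto simp: C'_def D'_def)
  have C': "ennreal C = ennreal C'" and D': "ennreal D = ennreal D'"
    by (auto simp: C'_def D'_def max_def ennreal_neg)
  note le = le[unfolded C'] and ge = ge[unfolded D']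
  have pos: "\<exists>E'\<ge>0. ennreal E = ennreal E'" for E
    by (cases "0 \<le> E") (auto simp: ennreal_neg intro: exI[of _ 0])
  show ?thesis
  proof
    fix n
    obtain E where E: "\<And>a. ennreal (cmod (a n)) \<le> ennreal E * nrm0 a" using N.coeff_bounded by blast
    obtain E' where E': "0 \<le> E'" "ennreal E = ennreal E'" using pos by blast
    have "ennreal (cmod (a n)) \<le> ennreal (E' * D') * nrm a" for a
    proof -
      have "ennreal (cmod (a n)) \<le> ennreal E' * (ennreal D' * nrm a)"
        using E[of a] mult_left_mono[OF ge[of a], of "ennreal E'"] unfolding E' by (rule order_trans) simp
      thus ?thesis using E' nn by (simp add: ennreal_mult mult.assoc)
    qed
    thus "\<exists>C. \<forall>a. ennreal (cmod (a n)) \<le> ennreal C * nrm a" by blast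
  next
    obtain E where E: "\<And>a N. nrm0 (trunc N a) \<le> ennreal E * nrm0 a" using N.trunc_bounded by blast
    obtain E' where E': "0 \<le> E'" "ennreal E = ennreal E'" using pos by blast
    have "nrm (trunc N a) \<le> ennreal (C' * E' * D') * nrm a" for a N
    proof -
      have "nrm (trunc N a) \<le> ennreal C' * nrm0 (trunc N a)" by (rule le)
      also have "\<dots> \<le> ennreal C' * (ennreal E' * nrm0 a)"
        using E[of N a] unfolding E' by (rule mult_left_mono) simp
      also have "\<dots> \<le> ennreal C' * (ennreal E' * (ennreal D' * nrm a))"
        by (intro mult_left_mono ge) auto
      finally show ?thesis using E' nn by (simp add: ennreal_mult mult.assoc)
    qed
    thus "\<exists>C. \<forall>a N. nrm (trunc N a) \<le> ennreal C * nrm a" by blast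
  next
    obtain E where E: "\<And>a c. (\<And>N. nrm0 (trunc N a) \<le> c) \<Longrightarrow> nrm0 a \<le> ennreal E * c" using N.fatou by blast
    obtain E' where E': "0 \<le> E'" "ennreal E = ennreal E'" using pos by blast
    have "nrm a \<le> ennreal (C' * E' * D') * c" if c: "\<And>N. nrm (trunc N a) \<le> c" for a c
    proof -
      have "nrm0 (trunc N a) \<le> ennreal D' * c" for N
        using ge[of "trunc N a"] mult_left_mono[OF c[of N], of "ennreal D'"] by (rule order_trans) simp
      hence "nrm0 a \<le> ennreal E' * (ennreal D' * c)" unfolding E'(2)[symmetric] by (rule E)
      hence "ennreal C' * nrm0 a \<le> ennreal C' * (ennreal E' * (ennreal D' * c))" by (rule mult_left_mono) simp
      with le[of a] have "nrm a \<le> ennreal C' * (ennreal E' * (ennreal D' * c))" by (rule order_trans)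
      thus ?thesis using E' nn by (simp add: ennreal_mult mult.assoc)
    qed
    thus "\<exists>C. \<forall>a c. (\<forall>N. nrm (trunc N a) \<le> c) \<longrightarrow> nrm a \<le> ennreal C * c" by blast
  next
    obtain E where E: "\<And>a. nrm0 a \<le> ennreal E * fourier_lebesgue_norm \<sigma> (ennreal r) a" using N.dominated by blast
    obtain E' where E': "0 \<le> E'" "ennreal E = ennreal E'" using pos by blast
    have "nrm a \<le> ennreal (C' * E') * fourier_lebesgue_norm \<sigma> (ennreal r) a" for a
    proof -
      have "nrm a \<le> ennreal C' * (ennreal E' * fourier_lebesgue_norm \<sigma> (ennreal r) a)"
        using le[of a] mult_left_mono[OF E[of a], of "ennreal C'"] unfolding E' by (rule order_trans) simp
      thus ?thesis using E' nn by (simp add: ennreal_mult mult.assoc)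
    qed
    thus "\<exists>C. \<forall>a. nrm a \<le> ennreal C * fourier_lebesgue_norm \<sigma> (ennreal r) a" by blast
  qed (fact triangle homogeneous N.exponent)+
qed

text \<open>Contains the Fourier-Besov norms, with \<open>j\<close> the dyadic scale, and the Fourier-Lebesgue norms, with
  a single value of \<open>j\<close>.\<close>

definition mixed_norm ::
    "ennreal \<Rightarrow> ennreal \<Rightarrow> ('j \<Rightarrow> int \<Rightarrow> real) \<Rightarrow> (int \<Rightarrow> complex) \<Rightarrow> ennreal"
  where "mixed_norm p q w a = lp_norm q (\<lambda>j. lp_norm p (\<lambda>n. ennreal (w j n * cmod (a n))))"

lemma ennreal_trunc_SUP:
  assumes "0 \<le> c"
  shows "ennreal (c * cmod (a n)) = (SUP N. ennreal (c * cmod (trunc N a n)))"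
    and "incseq (\<lambda>N. ennreal (c * cmod (trunc N a n)))"
proof -
  have le: "cmod (trunc N a n) \<le> cmod (a n)" for N by (simp add: trunc_def)
  show "incseq (\<lambda>N. ennreal (c * cmod (trunc N a n)))"
    by (rule incseq_SucI) (auto simp: trunc_def assms)
  show "ennreal (c * cmod (a n)) = (SUP N. ennreal (c * cmod (trunc N a n)))"
  proof (rule antisym)
    have "trunc (nat \<bar>n\<bar>) a n = a n" by (simp add: trunc_def)
    thus "ennreal (c * cmod (a n)) \<le> (SUP N. ennreal (c * cmod (trunc N a n)))"
      by (intro SUP_upper2[of "nat \<bar>n\<bar>"]) auto
    show "(SUP N. ennreal (c * cmod (trunc N a n))) \<le> ennreal (c * cmod (a n))"
      by (intro SUP_least ennreal_leI mult_left_mono le assms)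
  qed
qed

text \<open>Compatibility with truncation holds because the norm depends monotonically on the absolute values
  of the coefficients; the Fatou property is monotone convergence, applied once for each exponent.\<close>

lemma admissible_mixed_norm:
  fixes w :: "'j \<Rightarrow> int \<Rightarrow> real"
  assumes p: "1 \<le> p" and q: "1 \<le> q" and w: "\<And>j n. 0 \<le> w j n" "\<And>n. \<exists>j. 0 < w j n"
    and exponent: "1 \<le> r" "(\<sigma> - 1) * r < - 1"
    and dominated: "\<And>a. mixed_norm p q w a \<le> ennreal C * fourier_lebesgue_norm \<sigma> (ennreal r) a"
  shows "admissible_norm (mixed_norm p q w) \<sigma> r"
proof
  fix a b :: "int \<Rightarrow> complex"
  have "mixed_norm p q w (a + b) \<le> lp_norm q (\<lambda>j. lp_norm p (\<lambda>n. ennreal (w j n * cmod (a n)) + ennreal (w j n * cmod (b n))))"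
    unfolding mixed_norm_def
  proof (intro lp_norm_mono p q)
    fix j n
    have "w j n * cmod ((a + b) n) \<le> w j n * cmod (a n) + w j n * cmod (b n)"
      using mult_left_mono[OF norm_triangle_ineq[of "a n" "b n"] w(1)[of j n]] by (simp add: distrib_left)
    thus "ennreal (w j n * cmod ((a + b) n)) \<le> ennreal (w j n * cmod (a n)) + ennreal (w j n * cmod (b n))"
      using w(1) by (simp add: ennreal_leI flip: ennreal_plus)
  qed
  also have "\<dots> \<le> lp_norm q (\<lambda>j. lp_norm p (\<lambda>n. ennreal (w j n * cmod (a n))) + lp_norm p (\<lambda>n. ennreal (w j n * cmod (b n))))"
    by (intro lp_norm_mono Lp_norm_triangle p q) auto
  also have "\<dots> \<le> mixed_norm p q w a + mixed_norm p q w b"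
    unfolding mixed_norm_def by (intro Lp_norm_triangle q) auto
  finally show "mixed_norm p q w (a + b) \<le> mixed_norm p q w a + mixed_norm p q w b" .
next
  fix c :: real and a :: "int \<Rightarrow> complex"
  have "ennreal (w j n * cmod ((c *\<^sub>R a) n)) = ennreal \<bar>c\<bar> * ennreal (w j n * cmod (a n))" for j n
    using w(1) by (simp add: scaleR_fun_def mult_ac flip: ennreal_mult)
  thus "mixed_norm p q w (c *\<^sub>R a) = ennreal \<bar>c\<bar> * mixed_norm p q w a"
    unfolding mixed_norm_def by (simp add: Lp_norm_cmult p q)
next
  fix n
  obtain j where j: "0 < w j n" using w(2) by blast
  have "ennreal (cmod (a n)) \<le> ennreal (1 / w j n) * mixed_norm p q w a" for a
  proof -
    have "ennreal (w j n * cmod (a n)) \<le> lp_norm p (\<lambda>n. ennreal (w j n * cmod (a n)))"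
      using lp_norm_component[OF p, of "\<lambda>n. ennreal (w j n * cmod (a n))" n] .
    also have "\<dots> \<le> mixed_norm p q w a"
      unfolding mixed_norm_def using lp_norm_component[OF q, of "\<lambda>j. lp_norm p (\<lambda>n. ennreal (w j n * cmod (a n)))" j] .
    finally have "ennreal (1 / w j n) * ennreal (w j n * cmod (a n)) \<le> ennreal (1 / w j n) * mixed_norm p q w a"
      by (rule mult_left_mono) simp
    thus ?thesis using j by (simp flip: ennreal_mult)
  qed
  thus "\<exists>C. \<forall>a. ennreal (cmod (a n)) \<le> ennreal C * mixed_norm p q w a" by blast
next
  have "mixed_norm p q w (trunc N a) \<le> ennreal 1 * mixed_norm p q w a" for N a
    unfolding mixed_norm_def using w(1)
    by (auto intro!: lp_norm_mono p q ennreal_leI mult_left_mono simp: trunc_def)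
  thus "\<exists>C. \<forall>a N. mixed_norm p q w (trunc N a) \<le> ennreal C * mixed_norm p q w a" by blast
next
  have "mixed_norm p q w a \<le> ennreal 1 * c" if c: "\<And>N. mixed_norm p q w (trunc N a) \<le> c" for a c
  proof -
    have inner: "lp_norm p (\<lambda>n. ennreal (w j n * cmod (a n)))
        = (SUP N. lp_norm p (\<lambda>n. ennreal (w j n * cmod (trunc N a n))))" for j
    proof -
      have "(\<lambda>n. ennreal (w j n * cmod (a n))) = (\<lambda>n. SUP N. ennreal (w j n * cmod (trunc N a n)))"
        by (rule ext) (rule ennreal_trunc_SUP(1)[OF w(1)])
      hence "lp_norm p (\<lambda>n. ennreal (w j n * cmod (a n)))
          = lp_norm p (\<lambda>n. SUP N. ennreal (w j n * cmod (trunc N a n)))" by (rule arg_cong)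
      also have "\<dots> = (SUP N. lp_norm p (\<lambda>n. ennreal (w j n * cmod (trunc N a n))))"
        by (rule lp_norm_incseq_SUP[OF p ennreal_trunc_SUP(2)[OF w(1)]])
      finally show ?thesis .
    qed
    have "mixed_norm p q w a = (SUP N. mixed_norm p q w (trunc N a))"
      unfolding mixed_norm_def ext[OF inner]
    proof (rule lp_norm_incseq_SUP[OF q])
      fix j
      show "incseq (\<lambda>N. lp_norm p (\<lambda>n. ennreal (w j n * cmod (trunc N a n))))"
        using ennreal_trunc_SUP(2)[OF w(1)] by (auto simp: incseq_def intro!: lp_norm_mono p)
    qed
    also have "\<dots> \<le> c" by (intro SUP_least c)
    finally show ?thesis by simp
  qed
  thus "\<exists>C. \<forall>a c. (\<forall>N. mixed_norm p q w (trunc N a) \<le> c) \<longrightarrow> mixed_norm p q w a \<le> ennreal C * c" by blast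
next
  show "\<exists>C. \<forall>a. mixed_norm p q w a \<le> ennreal C * fourier_lebesgue_norm \<sigma> (ennreal r) a"
    using dominated by blast
qed (fact exponent)+

text \<open>The strict inequality on the exponents leaves room for a slightly larger weight and, when the
  exponent is infinite, for a large finite exponent.\<close>

lemma subcritical_room:
  assumes p: "1 \<le> p" and sub: "if p = \<infinity> then s < 1 else (s - 1) * enn2real p < - 1"
  obtains \<delta> r where "0 < \<delta>" "1 \<le> r" "(s + \<delta> - 1) * r < - 1"
    "\<And>f :: int \<Rightarrow> ennreal. lp_norm p f \<le> lp_norm (ennreal r) f"
  using p
proof (cases rule: ennreal_exponent_cases)
  case 1
  hence s: "s < 1" using sub by simp
  define \<delta> where "\<delta> = (1 - s) / 2"
  define r where "r = max 1 (2 / \<delta>)"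
  have \<delta>: "0 < \<delta>" "s + \<delta> - 1 = - \<delta>" using s by (auto simp: \<delta>_def field_simps)
  have "2 / \<delta> \<le> r" by (simp add: r_def)
  hence "2 \<le> \<delta> * r" using \<delta>(1) by (simp add: field_simps)
  show thesis
  proof (rule that[of \<delta> r])
    show "(s + \<delta> - 1) * r < - 1" unfolding \<delta>(2) using \<open>2 \<le> \<delta> * r\<close> by simp
    show "1 \<le> r" by (simp add: r_def)
    hence "1 \<le> ennreal r" by (simp flip: ennreal_1)
    thus "lp_norm p f \<le> lp_norm (ennreal r) f" for f :: "int \<Rightarrow> ennreal"
      unfolding 1 by (rule lp_norm_top_le)
  qed (fact \<delta>)
next
  case (2 P)
  hence sub': "(s - 1) * P < - 1" using sub by simp
  define \<delta> where "\<delta> = (- 1 - (s - 1) * P) / (2 * P)"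
  have P: "0 < P" using 2 by simp
  have "\<delta> * P = (- 1 - (s - 1) * P) / 2" using P by (simp add: \<delta>_def)
  moreover have "(s + \<delta> - 1) * P = (s - 1) * P + \<delta> * P" by (simp add: algebra_simps)
  ultimately have "(s + \<delta> - 1) * P < - 1" using sub' by (simp add: field_simps)
  moreover have "0 < \<delta>" unfolding \<delta>_def using sub' P by (intro divide_pos_pos) auto
  ultimately show thesis using 2 that[of \<delta> P] by simp
qed

lemma lp_norm_const_unit:
  assumes "1 \<le> q"
  shows "lp_norm q (\<lambda>_ :: unit. x) = x"
  using assms
proof (cases rule: ennreal_exponent_cases)
  case (2 P)
  thus ?thesis by (simp add: Lp_norm_ennreal nn_integral_count_space_finite UNIV_unit)
qed (simp add: lp_norm_top)

lemma fourier_lebesgue_eq_mixed_norm: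
  "fourier_lebesgue_norm s q = mixed_norm q 1 (\<lambda>_ :: unit. \<lambda>n. jap n powr s)"
  by (rule ext) (simp add: fourier_lebesgue_norm_def mixed_norm_def lp_norm_const_unit)

lemma admissible_fourier_lebesgue:
  assumes q: "1 \<le> q" and sub: "if q = \<infinity> then s < 1 else (s - 1) * enn2real q < - 1"
  obtains \<sigma> r where "admissible_norm (fourier_lebesgue_norm s q) \<sigma> r"
proof -
  obtain \<delta> r where d: "0 < \<delta>" "1 \<le> r" "(s + \<delta> - 1) * r < - 1"
    "\<And>f :: int \<Rightarrow> ennreal. lp_norm q f \<le> lp_norm (ennreal r) f"
    by (rule subcritical_room[OF q sub]) blast
  have r1: "1 \<le> ennreal r" using d(2) by (simp flip: ennreal_1)
  have "fourier_lebesgue_norm s q a \<le> ennreal 1 * fourier_lebesgue_norm (s + \<delta>) (ennreal r) a" for a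
  proof -
    have "fourier_lebesgue_norm s q a \<le> fourier_lebesgue_norm s (ennreal r) a"
      unfolding fourier_lebesgue_norm_def by (rule d(4))
    also have "\<dots> \<le> fourier_lebesgue_norm (s + \<delta>) (ennreal r) a"
      unfolding fourier_lebesgue_norm_def using d(1) jap_ge_1
      by (intro lp_norm_mono r1 ennreal_leI mult_right_mono powr_mono) auto
    finally show ?thesis by simp
  qed
  hence "admissible_norm (mixed_norm q 1 (\<lambda>_ :: unit. \<lambda>n. jap n powr s)) (s + \<delta>) r"
    unfolding fourier_lebesgue_eq_mixed_norm
    by (intro admissible_mixed_norm[where C = 1] q d) (auto simp: fourier_lebesgue_eq_mixed_norm)
  thus thesis using that unfolding fourier_lebesgue_eq_mixed_norm by blast
qed


section \<open>Fourier-Besov norms\<close>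

lemma lp_norm_geometric_finite:
  assumes q: "1 \<le> q" and \<rho>: "0 < \<rho>" "\<rho> < 1" and K: "0 \<le> K"
  shows "lp_norm q (\<lambda>j::nat. ennreal (K * \<rho> ^ j)) < \<infinity>"
  using q
proof (cases rule: ennreal_exponent_cases)
  case 1
  have "ennreal (K * \<rho> ^ j) \<le> ennreal K" for j
    using \<rho> K by (intro ennreal_leI mult_left_le power_le_one) auto
  hence "lp_norm q (\<lambda>j. ennreal (K * \<rho> ^ j)) \<le> ennreal K"
    unfolding 1 lp_norm_top by (intro SUP_least)
  thus ?thesis by (rule le_less_trans) simp
next
  case (2 Q)
  have eq: "ennpowr (ennreal (K * \<rho> ^ j)) Q = ennreal (K powr Q * (\<rho> powr Q) ^ j)" for j
    using \<rho> K by (simp add: powr_mult powr_powr mult.commute flip: powr_realpow)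
  have r: "0 < \<rho> powr Q" "\<rho> powr Q < 1"
    using \<rho> 2 powr_less_mono2[of Q \<rho> 1] by auto
  have "summable (\<lambda>j. K powr Q * (\<rho> powr Q) ^ j)"
    using r by (intro summable_mult summable_geometric) simp
  hence "(\<Sum>j. ennreal (K powr Q * (\<rho> powr Q) ^ j)) \<noteq> top"
    using r by (intro ennreal_suminf_neq_top) auto
  hence "(\<integral>\<^sup>+j. ennpowr (ennreal (K * \<rho> ^ j)) Q \<partial>count_space UNIV) \<noteq> top"
    unfolding eq nn_integral_count_space_nat .
  thus ?thesis unfolding 2 using 2(1) by (simp add: Lp_norm_ennreal less_top[symmetric])
qed

lemma schwartz_bounded: "schwartz f \<Longrightarrow> \<exists>K. \<forall>x. cmod (f x) \<le> K"
proof -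
  assume "schwartz f"
  hence "bounded (range (\<lambda>x. x ^ 0 *\<^sub>R ((\<lambda>g x. vector_derivative g (at x)) ^^ 0) f x))"
    unfolding schwartz_def Let_def by blast
  thus ?thesis by (auto simp: bounded_iff)
qed

text \<open>On the support of the \<open>j\<close>-th piece \<open>\<langle>n\<rangle> \<ge> 2\<^sup>j / 2\<close>, so that an additional weight \<open>\<langle>n\<rangle>\<^sup>\<delta>\<close> pays for
  a factor \<open>2\<^bsup>-\<delta>j\<^esup>\<close>, which is summable over the dyadic scales in every \<open>\<ell>\<^sup>q\<close>.\<close>

lemma admissible_fourier_besov:
  assumes p: "1 \<le> p" and q: "1 \<le> q" and sub: "if p = \<infinity> then s < 1 else (s - 1) * enn2real p < - 1"
    and part: "dyadic_partition \<phi>\<^sub>0 \<phi>"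
  obtains \<sigma> r where "admissible_norm (fourier_besov_norm \<phi>\<^sub>0 \<phi> p q s) \<sigma> r"
proof -
  obtain \<delta> r where d: "0 < \<delta>" "1 \<le> r" "(s + \<delta> - 1) * r < - 1"
    "\<And>f :: int \<Rightarrow> ennreal. lp_norm p f \<le> lp_norm (ennreal r) f"
    by (rule subcritical_room[OF p sub]) blast
  have r1: "1 \<le> ennreal r" using d(2) by (simp flip: ennreal_1)
  define b where "b j n = cmod (dyadic_piece \<phi>\<^sub>0 \<phi> j (of_int n))" for j n
  define w where "w j n = jap n powr s * b j n" for j n
  have eq: "fourier_besov_norm \<phi>\<^sub>0 \<phi> p q s = mixed_norm p q w"
    by (rule ext) (simp add: fourier_besov_norm_def mixed_norm_def w_def b_def norm_mult mult_ac)
  obtain K0 K1 where "\<And>x. cmod (\<phi>\<^sub>0 x) \<le> K0" "\<And>x. cmod (\<phi> x) \<le> K1"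
    using part schwartz_bounded[of \<phi>\<^sub>0] schwartz_bounded[of \<phi>] unfolding dyadic_partition_def by blast
  hence bK: "b j n \<le> max 1 (max K0 K1)" for j n
    by (auto simp: b_def dyadic_piece_def le_max_iff_disj)
  define K where "K = max 1 (max K0 K1)"
  have supp: "2 ^ j / 2 \<le> jap n" if "b j n \<noteq> 0" for j n
  proof (cases "j = 0")
    case True
    thus ?thesis using jap_ge_1[of n] by simp
  next
    case False
    hence "\<phi> (of_int n / 2 ^ j) \<noteq> 0" using that by (simp add: b_def dyadic_piece_def)
    hence "of_int n / 2 ^ j \<in> closure {\<xi>. \<phi> \<xi> \<noteq> 0}"
      using closure_subset[of "{\<xi>. \<phi> \<xi> \<noteq> 0}"] by auto
    hence "1 / 2 \<le> \<bar>of_int n / 2 ^ j :: real\<bar>" using part unfolding dyadic_partition_def by blast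
    hence "2 ^ j / 2 \<le> \<bar>of_int n :: real\<bar>" by (simp add: abs_divide field_simps)
    thus ?thesis using abs_le_jap[of n] by linarith
  qed
  define \<rho> :: real where "\<rho> = 2 powr (- \<delta>)"
  have \<rho>: "0 < \<rho>" "\<rho> < 1" using d(1) by (auto simp: \<rho>_def powr_less_one)
  define c where "c j = K * 2 powr \<delta> * \<rho> ^ j" for j :: nat
  have c0: "0 \<le> c j" for j using \<rho> by (simp add: c_def K_def)
  have w_le: "w j n \<le> c j * jap n powr (s + \<delta>)" for j n
  proof (cases "b j n = 0")
    case True
    thus ?thesis using c0 by (simp add: w_def)
  next
    case False
    have "jap n powr (- \<delta>) \<le> (2 ^ j / 2) powr (- \<delta>)"
      using supp[OF False] d(1) by (intro powr_mono2') auto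
    also have "\<dots> = 2 powr \<delta> * \<rho> ^ j"
      by (simp add: powr_divide \<rho>_def powr_minus_divide powr_powr mult.commute flip: powr_realpow)
    finally have "jap n powr (- \<delta>) * b j n \<le> (2 powr \<delta> * \<rho> ^ j) * K"
      using bK[of j n] \<rho> by (intro mult_mono) (auto simp: K_def b_def)
    hence "jap n powr (s + \<delta>) * (jap n powr (- \<delta>) * b j n) \<le> jap n powr (s + \<delta>) * ((2 powr \<delta> * \<rho> ^ j) * K)"
      by (rule mult_left_mono) simp
    also have "\<dots> = c j * jap n powr (s + \<delta>)" unfolding c_def by (simp only: mult_ac)
    finally have "jap n powr (s + \<delta>) * jap n powr (- \<delta>) * b j n \<le> c j * jap n powr (s + \<delta>)"
      by (simp only: mult.assoc)
    moreover have "jap n powr (s + \<delta>) * jap n powr (- \<delta>) = jap n powr s" by (simp flip: powr_add)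
    ultimately show ?thesis by (simp only: w_def)
  qed
  obtain E where E: "lp_norm q (\<lambda>j. ennreal (c j)) = ennreal E" "0 \<le> E"
    using lp_norm_geometric_finite[OF q \<rho>, of "K * 2 powr \<delta>"]
    by (cases "lp_norm q (\<lambda>j. ennreal (c j))") (auto simp: c_def K_def)
  have dom: "mixed_norm p q w a \<le> ennreal (max 1 E) * fourier_lebesgue_norm (s + \<delta>) (ennreal r) a" for a
  proof (cases "fourier_lebesgue_norm (s + \<delta>) (ennreal r) a")
    case (real A)
    have "lp_norm p (\<lambda>n. ennreal (w j n * cmod (a n))) \<le> ennreal A * ennreal (c j)" for j
    proof -
      have "lp_norm p (\<lambda>n. ennreal (w j n * cmod (a n))) \<le> lp_norm (ennreal r) (\<lambda>n. ennreal (w j n * cmod (a n)))"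
        by (rule d(4))
      also have "\<dots> \<le> lp_norm (ennreal r) (\<lambda>n. ennreal (c j) * ennreal (jap n powr (s + \<delta>) * cmod (a n)))"
      proof (rule lp_norm_mono[OF r1])
        fix n
        have "w j n * cmod (a n) \<le> c j * (jap n powr (s + \<delta>) * cmod (a n))"
          using mult_right_mono[OF w_le[of j n], of "cmod (a n)"] by (simp add: mult.assoc)
        thus "ennreal (w j n * cmod (a n)) \<le> ennreal (c j) * ennreal (jap n powr (s + \<delta>) * cmod (a n))"
          using c0 by (simp add: ennreal_leI flip: ennreal_mult)
      qed
      also have "\<dots> = ennreal (c j) * fourier_lebesgue_norm (s + \<delta>) (ennreal r) a"
        unfolding fourier_lebesgue_norm_def by (rule Lp_norm_cmult[OF r1 _ c0]) simp
      finally show ?thesis by (simp add: real(2) mult.commute)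
    qed
    hence "mixed_norm p q w a \<le> lp_norm q (\<lambda>j. ennreal A * ennreal (c j))"
      unfolding mixed_norm_def by (intro lp_norm_mono q)
    also have "\<dots> = ennreal A * ennreal E"
      using real(1) E(1) by (subst Lp_norm_cmult[OF q]) auto
    also have "\<dots> \<le> ennreal (max 1 E) * fourier_lebesgue_norm (s + \<delta>) (ennreal r) a"
      unfolding real(2) by (subst mult.commute) (intro mult_right_mono ennreal_leI, auto)
    finally show ?thesis .
  next
    case top
    have "ennreal (max 1 E) \<noteq> 0" by simp
    hence "ennreal (max 1 E) * top = top" by (simp only: ennreal_mult_top if_False)
    thus ?thesis unfolding top by (simp only: top_greatest)
  qed
  have "admissible_norm (mixed_norm p q w) (s + \<delta>) r"
  proof (rule admissible_mixed_norm[OF p q _ _ d(2,3) dom])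
    show "0 \<le> w j n" for j n by (simp add: w_def b_def)
    show "\<exists>j. 0 < w j n" for n
    proof (rule ccontr)
      assume no: "\<not> (\<exists>j. 0 < w j n)"
      have "dyadic_piece \<phi>\<^sub>0 \<phi> j (of_int n) = 0" for j
      proof (rule ccontr)
        assume "dyadic_piece \<phi>\<^sub>0 \<phi> j (of_int n) \<noteq> 0"
        hence "0 < w j n" using jap_pos[of n] by (simp add: w_def b_def)
        thus False using no by blast
      qed
      moreover have "(\<lambda>j. dyadic_piece \<phi>\<^sub>0 \<phi> j (of_int n)) sums 1"
        using part by (simp add: dyadic_partition_def)
      ultimately show False using sums_unique2[OF sums_zero] by (metis (no_types, lifting) sums_cong zero_neq_one)
    qed
  qed
  thus thesis using that eq by simp
qed


section \<open>Modulation and Wiener amalgam norms\<close>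

lemma torus_integral_cis: "(CLINT x|torus. cis (of_int k * x)) = (if k = 0 then 2 * pi else 0)"
proof (cases "k = 0")
  case True
  have "measure torus (space torus) = 2 * pi" by (simp add: measure_def emeasure_torus)
  thus ?thesis using True by (simp add: scaleR_conv_of_real)
next
  case False
  let ?F = "\<lambda>x. cis (of_int k * x) / (\<i> * of_int k)"
  have "has_bochner_integral lborel (\<lambda>x. indicator {0..2 * pi} x *\<^sub>R cis (of_int k * x)) (?F (2 * pi) - ?F 0)"
  proof (rule has_bochner_integral_FTC_Icc)
    show "(?F has_vector_derivative cis (of_int k * x)) (at x within {0..2 * pi})" for x
    proof -
      have "((\<lambda>z. exp (\<i> * of_int k * z) / (\<i> * of_int k)) has_field_derivative exp (\<i> * of_int k * of_real x)) (at (of_real x))"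
        using False by (auto intro!: derivative_eq_intros)
      from has_vector_derivative_real_field[OF this] show ?thesis
        by (simp add: cis_conv_exp mult.assoc)
    qed
    show "continuous_on {0..2 * pi} (\<lambda>x. cis (of_int k * x))" by (intro continuous_intros)
  qed simp
  moreover have "?F (2 * pi) = ?F 0"
  proof -
    have "cis (of_int k * (2 * pi)) = 1" using cis_multiple_2pi[of "of_int k"] by (simp add: mult.commute mult.left_commute)
    thus ?thesis by simp
  qed
  ultimately have 0: "(CLINT x|lborel. indicator {0..2 * pi} x *\<^sub>R cis (of_int k * x)) = 0"
    by (simp add: has_bochner_integral_integral_eq)
  have [measurable]: "(\<lambda>x. cis (of_int k * x)) \<in> borel_measurable borel"
    by (intro borel_measurable_continuous_onI continuous_intros)
  have "(CLINT x|torus. cis (of_int k * x)) = (CLINT x|lborel. indicator {0..<2 * pi} x *\<^sub>R cis (of_int k * x))"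
    unfolding torus_def by (subst integral_restrict_space) auto
  also have "\<dots> = (CLINT x|lborel. indicator {0..2 * pi} x *\<^sub>R cis (of_int k * x))"
  proof (rule integral_cong_AE)
    have "AE x in lborel. x \<noteq> 2 * pi" by (rule AE_lborel_singleton)
    thus "AE x in lborel. indicator {0..<2 * pi} x *\<^sub>R cis (of_int k * x) = indicator {0..2 * pi} x *\<^sub>R cis (of_int k * x)"
      by eventually_elim (auto split: split_indicator)
  qed measurable
  finally show ?thesis using 0 False by simp
qed

locale frequency_window =
  fixes \<psi> :: "int \<Rightarrow> complex"
  assumes fin: "finite {n. \<psi> n \<noteq> 0}"
    and partition: "\<forall>k. (\<Sum>n | \<psi> (k - n) \<noteq> 0. \<psi> (k - n)) = 1"
begin

abbreviation supp :: "int set" where "supp \<equiv> {m. \<psi> m \<noteq> 0}"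

lemma sum_supp: "(\<Sum>m\<in>supp. \<psi> m) = 1"
proof -
  have "(\<Sum>n | \<psi> (0 - n) \<noteq> 0. \<psi> (0 - n)) = (\<Sum>m\<in>supp. \<psi> m)"
    by (rule sum.reindex_bij_witness[of _ uminus uminus]) auto
  thus ?thesis using partition by metis
qed

lemma freq_loc_eq: "freq_loc \<psi> n a x = (\<Sum>m\<in>supp. \<psi> m * a (n + m) * cis (of_int (n + m) * x))"
  unfolding freq_loc_def
  by (rule sum.reindex_bij_witness[of _ "\<lambda>m. n + m" "\<lambda>k. k - n"]) auto

lemma continuous_freq_loc: "continuous_on A (freq_loc \<psi> n a)"
  unfolding freq_loc_eq[abs_def] by (intro continuous_intros)

lemma borel_measurable_freq_loc [measurable]: "freq_loc \<psi> n a \<in> borel_measurable borel"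
  by (rule borel_measurable_continuous_onI[OF continuous_freq_loc])

lemma measurable_torus_freq_loc [measurable]: "freq_loc \<psi> n a \<in> borel_measurable torus"
  by (rule borel_measurable_torusI) measurable

lemma cmod_freq_loc_le: "cmod (freq_loc \<psi> n a x) \<le> (\<Sum>m\<in>supp. cmod (\<psi> m) * cmod (a (n + m)))"
  unfolding freq_loc_eq by (rule sum_norm_le) (simp add: norm_mult)

lemma freq_loc_add: "freq_loc \<psi> n (a + b) x = freq_loc \<psi> n a x + freq_loc \<psi> n b x"
  unfolding freq_loc_eq by (simp add: algebra_simps sum.distrib)

lemma freq_loc_scaleR: "freq_loc \<psi> n (c *\<^sub>R a) x = c *\<^sub>R freq_loc \<psi> n a x"
  unfolding freq_loc_eq by (simp add: scaleR_fun_def scaleR_sum_right)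

text \<open>Integration of the localized polynomial against \<open>e\<^bsup>-i(n+m)x\<^esup>\<close> picks out the coefficient at the
  frequency \<open>n + m\<close>; the factor \<open>2 \<pi> \<ge> 1\<close> is dropped.\<close>

lemma freq_loc_coefficient:
  "m \<in> supp \<Longrightarrow> ennreal (cmod (\<psi> m) * cmod (a (n + m))) \<le> (\<integral>\<^sup>+x. ennreal (cmod (freq_loc \<psi> n a x)) \<partial>torus)"
proof -
  assume m: "m \<in> supp"
  have fm: "finite_measure torus" by (rule finite_measureI) (simp add: emeasure_torus)
  interpret T: finite_measure torus by (rule fm)
  have mc: "(\<lambda>x. cis (of_int k * x)) \<in> borel_measurable torus" for k
    by (intro borel_measurable_torusI borel_measurable_continuous_onI continuous_intros)
  have int: "integrable torus (\<lambda>x. cis (of_int k * x))" for k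
    by (rule T.integrable_const_bound[of _ 1]) (use mc in auto)
  let ?f = "\<lambda>x. freq_loc \<psi> n a x * cis (of_int (- (n + m)) * x)"
  have f: "?f x = (\<Sum>k\<in>supp. (\<psi> k * a (n + k)) * cis (of_int (k - m) * x))" for x
    unfolding freq_loc_eq sum_distrib_right
    by (intro sum.cong refl) (simp add: mult.assoc cis_mult algebra_simps)
  have "(CLINT x|torus. ?f x) = (\<Sum>k\<in>supp. (\<psi> k * a (n + k)) * (CLINT x|torus. cis (of_int (k - m) * x)))"
    unfolding f using int
    by (subst Bochner_Integration.integral_sum) (auto intro!: integrable_mult_right simp del: of_int_diff)
  also have "\<dots> = (\<Sum>k\<in>supp. if k = m then \<psi> m * a (n + m) * (2 * pi) else 0)"
    unfolding torus_integral_cis by (intro sum.cong) auto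
  also have "\<dots> = \<psi> m * a (n + m) * (2 * pi)" using m fin by simp
  finally have I: "(CLINT x|torus. ?f x) = \<psi> m * a (n + m) * (2 * pi)" .
  have "integrable torus ?f" unfolding f
    by (intro Bochner_Integration.integrable_sum integrable_mult_right int)
  hence "ennreal (norm (CLINT x|torus. ?f x)) \<le> (\<integral>\<^sup>+x. ennreal (norm (?f x)) \<partial>torus)"
    by (rule integral_norm_bound_ennreal)
  also have "\<dots> = (\<integral>\<^sup>+x. ennreal (cmod (freq_loc \<psi> n a x)) \<partial>torus)" by (simp add: norm_mult)
  finally have "ennreal (cmod (\<psi> m) * cmod (a (n + m)) * (2 * pi)) \<le> (\<integral>\<^sup>+x. ennreal (cmod (freq_loc \<psi> n a x)) \<partial>torus)"
    unfolding I by (simp add: norm_mult)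
  moreover have "cmod (\<psi> m) * cmod (a (n + m)) * 1 \<le> cmod (\<psi> m) * cmod (a (n + m)) * (2 * pi)"
    using pi_gt3 by (intro mult_left_mono) auto
  ultimately show ?thesis by (metis ennreal_leI mult.right_neutral order_trans)
qed

text \<open>Peetre's inequality: shifting by a fixed frequency changes the weight by a bounded factor.\<close>

definition shift_const :: "real \<Rightarrow> int \<Rightarrow> real"
  where "shift_const s m = (4 * jap m) powr \<bar>s\<bar>"

lemma jap_add_le: "jap (n + m) \<le> 4 * jap m * jap n"
proof -
  have j: "1 + \<bar>of_int k\<bar> \<le> 2 * jap k" for k using jap_ge_1[of k] abs_le_jap[of k] by linarith
  have "jap (n + m) \<le> 1 + \<bar>of_int (n + m)\<bar>"
    unfolding jap_def by (rule real_le_lsqrt) (auto simp: power2_eq_square algebra_simps)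
  also have "\<dots> \<le> (1 + \<bar>of_int m\<bar>) * (1 + \<bar>of_int n\<bar>)"
  proof -
    have "0 \<le> \<bar>of_int m :: real\<bar> * \<bar>of_int n\<bar>" by simp
    thus ?thesis unfolding of_int_add distrib_left distrib_right by linarith
  qed
  also have "\<dots> \<le> (2 * jap m) * (2 * jap n)" by (intro mult_mono j) auto
  finally show ?thesis by simp
qed

lemma jap_minus: "jap (- m) = jap m"
  by (simp add: jap_def)

lemma jap_shift: "jap n powr s \<le> shift_const s m * jap (n + m) powr s"
proof (cases "0 \<le> s")
  case True
  have "jap n \<le> 4 * jap m * jap (n + m)" using jap_add_le[of "n + m" "- m"] by (simp add: jap_minus)
  hence "jap n powr s \<le> (4 * jap m * jap (n + m)) powr s" using True by (intro powr_mono2) auto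
  thus ?thesis using True by (simp add: shift_const_def powr_mult)
next
  case False
  have "jap (n + m) / (4 * jap m) \<le> jap n"
    using jap_add_le[of n m] jap_pos[of m] by (simp add: field_simps)
  hence "jap n powr s \<le> (jap (n + m) / (4 * jap m)) powr s"
    using False by (intro powr_mono2') auto
  also have "\<dots> = (4 * jap m) powr (- s) * jap (n + m) powr s"
    by (simp add: powr_divide powr_minus_divide)
  finally show ?thesis using False by (simp add: shift_const_def)
qed

lemma shift_const_nonneg: "0 \<le> shift_const s m"
  by (simp add: shift_const_def)

definition upper_const :: "real \<Rightarrow> real"
  where "upper_const s = (\<Sum>m\<in>supp. cmod (\<psi> m) * shift_const s m)"

lemma upper_const_nonneg: "0 \<le> upper_const s"
  unfolding upper_const_def by (intro sum_nonneg mult_nonneg_nonneg shift_const_nonneg) auto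

text \<open>Each localized piece is dominated by finitely many shifts of the coefficient sequence, and a shift
  is bounded on the weighted sequence space by Peetre's inequality.\<close>

lemma lp_norm_window_le:
  assumes q: "1 \<le> q"
  shows "lp_norm q (\<lambda>n. ennreal (jap n powr s * (\<Sum>m\<in>supp. cmod (\<psi> m) * cmod (a (n + m)))))
    \<le> ennreal (upper_const s) * fourier_lebesgue_norm s q a"
proof -
  let ?g = "\<lambda>k. ennreal (jap k powr s * cmod (a k))"
  have "lp_norm q (\<lambda>n. ennreal (jap n powr s * (\<Sum>m\<in>supp. cmod (\<psi> m) * cmod (a (n + m)))))
      \<le> lp_norm q (\<lambda>n. \<Sum>m\<in>supp. ennreal (cmod (\<psi> m) * shift_const s m) * ?g (n + m))"
  proof (rule lp_norm_mono[OF q])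
    fix n
    have "jap n powr s * (\<Sum>m\<in>supp. cmod (\<psi> m) * cmod (a (n + m)))
        \<le> (\<Sum>m\<in>supp. (cmod (\<psi> m) * shift_const s m) * (jap (n + m) powr s * cmod (a (n + m))))"
      unfolding sum_distrib_left
    proof (rule sum_mono)
      fix m
      have "jap n powr s * (cmod (\<psi> m) * cmod (a (n + m)))
          \<le> (shift_const s m * jap (n + m) powr s) * (cmod (\<psi> m) * cmod (a (n + m)))"
        by (intro mult_right_mono jap_shift) auto
      thus "jap n powr s * (cmod (\<psi> m) * cmod (a (n + m)))
          \<le> (cmod (\<psi> m) * shift_const s m) * (jap (n + m) powr s * cmod (a (n + m)))"
        by (simp add: mult_ac)
    qed
    hence "ennreal (jap n powr s * (\<Sum>m\<in>supp. cmod (\<psi> m) * cmod (a (n + m))))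
        \<le> ennreal (\<Sum>m\<in>supp. (cmod (\<psi> m) * shift_const s m) * (jap (n + m) powr s * cmod (a (n + m))))"
      by (rule ennreal_leI)
    also have "\<dots> = (\<Sum>m\<in>supp. ennreal (cmod (\<psi> m) * shift_const s m) * ?g (n + m))"
      using shift_const_nonneg by (simp add: sum_ennreal flip: ennreal_mult)
    finally show "ennreal (jap n powr s * (\<Sum>m\<in>supp. cmod (\<psi> m) * cmod (a (n + m))))
      \<le> (\<Sum>m\<in>supp. ennreal (cmod (\<psi> m) * shift_const s m) * ?g (n + m))" .
  qed
  also have "\<dots> \<le> (\<Sum>m\<in>supp. lp_norm q (\<lambda>n. ennreal (cmod (\<psi> m) * shift_const s m) * ?g (n + m)))"
    by (rule Lp_norm_sum[OF q fin]) simp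
  also have "\<dots> = (\<Sum>m\<in>supp. ennreal (cmod (\<psi> m) * shift_const s m) * fourier_lebesgue_norm s q a)"
  proof (intro sum.cong refl)
    fix m
    have "lp_norm q (\<lambda>n. ennreal (cmod (\<psi> m) * shift_const s m) * ?g (n + m))
        = ennreal (cmod (\<psi> m) * shift_const s m) * lp_norm q (\<lambda>n. ?g (n + m))"
      using shift_const_nonneg by (intro Lp_norm_cmult q) auto
    thus "lp_norm q (\<lambda>n. ennreal (cmod (\<psi> m) * shift_const s m) * ?g (n + m))
        = ennreal (cmod (\<psi> m) * shift_const s m) * fourier_lebesgue_norm s q a"
      unfolding fourier_lebesgue_norm_def lp_norm_shift[OF q, of ?g m] .
  qed
  also have "\<dots> = ennreal (upper_const s) * fourier_lebesgue_norm s q a"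
    unfolding upper_const_def using shift_const_nonneg
    by (simp add: sum_ennreal sum_distrib_right[symmetric])
  finally show ?thesis .
qed

definition local_mass :: "(int \<Rightarrow> complex) \<Rightarrow> int \<Rightarrow> ennreal"
  where "local_mass a n = (\<integral>\<^sup>+x. ennreal (cmod (freq_loc \<psi> n a x)) \<partial>torus)"

definition lower_const :: "real \<Rightarrow> real"
  where "lower_const s = (\<Sum>m\<in>supp. shift_const s (- m))"

text \<open>Since the window sums to one, \<open>a\<^sub>k\<close> is the sum of the \<open>\<psi>\<^sub>m a\<^sub>k\<close>, and \<open>\<psi>\<^sub>m a\<^sub>k\<close> is a Fourier
  coefficient of the piece at \<open>k - m\<close>.\<close>

lemma fourier_lebesgue_le_local_mass:
  assumes q: "1 \<le> q"
  shows "fourier_lebesgue_norm s q a \<le> ennreal (lower_const s) * lp_norm q (\<lambda>n. ennreal (jap n powr s) * local_mass a n)"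
proof -
  let ?g = "\<lambda>n. ennreal (jap n powr s) * local_mass a n"
  have "fourier_lebesgue_norm s q a \<le> lp_norm q (\<lambda>k. \<Sum>m\<in>supp. ennreal (shift_const s (- m)) * ?g (k + - m))"
    unfolding fourier_lebesgue_norm_def
  proof (rule lp_norm_mono[OF q])
    fix k
    have "cmod (a k) = cmod (\<Sum>m\<in>supp. \<psi> m * a k)"
      by (simp add: sum_supp flip: sum_distrib_right)
    also have "\<dots> \<le> (\<Sum>m\<in>supp. cmod (\<psi> m) * cmod (a k))"
      by (rule sum_norm_le) (simp add: norm_mult)
    finally have "ennreal (jap k powr s * cmod (a k)) \<le> ennreal (jap k powr s * (\<Sum>m\<in>supp. cmod (\<psi> m) * cmod (a k)))"
      by (intro ennreal_leI mult_left_mono) auto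
    also have "\<dots> = (\<Sum>m\<in>supp. ennreal (jap k powr s) * ennreal (cmod (\<psi> m) * cmod (a k)))"
      unfolding sum_distrib_left by (simp add: sum_ennreal flip: ennreal_mult)
    also have "\<dots> \<le> (\<Sum>m\<in>supp. ennreal (shift_const s (- m)) * ?g (k + - m))"
    proof (rule sum_mono)
      fix m assume m: "m \<in> supp"
      have "ennreal (jap k powr s) * ennreal (cmod (\<psi> m) * cmod (a k))
          \<le> ennreal (shift_const s (- m) * jap (k + - m) powr s) * local_mass a (k + - m)"
        using freq_loc_coefficient[OF m, of a "k + - m"] jap_shift[of k s "- m"]
        by (intro mult_mono ennreal_leI) (auto simp: local_mass_def)
      thus "ennreal (jap k powr s) * ennreal (cmod (\<psi> m) * cmod (a k))
          \<le> ennreal (shift_const s (- m)) * ?g (k + - m)"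
        by (simp add: ennreal_mult shift_const_nonneg mult.assoc)
    qed
    finally show "ennreal (jap k powr s * cmod (a k)) \<le> (\<Sum>m\<in>supp. ennreal (shift_const s (- m)) * ?g (k + - m))" .
  qed
  also have "\<dots> \<le> (\<Sum>m\<in>supp. lp_norm q (\<lambda>k. ennreal (shift_const s (- m)) * ?g (k + - m)))"
    by (rule Lp_norm_sum[OF q fin]) simp
  also have "\<dots> = (\<Sum>m\<in>supp. ennreal (shift_const s (- m)) * lp_norm q ?g)"
  proof (intro sum.cong refl)
    fix m
    have "lp_norm q (\<lambda>k. ennreal (shift_const s (- m)) * ?g (k + - m))
        = ennreal (shift_const s (- m)) * lp_norm q (\<lambda>k. ?g (k + - m))"
      using shift_const_nonneg by (intro Lp_norm_cmult q) auto
    thus "lp_norm q (\<lambda>k. ennreal (shift_const s (- m)) * ?g (k + - m))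
        = ennreal (shift_const s (- m)) * lp_norm q ?g"
      unfolding lp_norm_shift[OF q, of ?g "- m"] .
  qed
  also have "\<dots> = ennreal (lower_const s) * lp_norm q ?g"
    unfolding lower_const_def using shift_const_nonneg
    by (simp add: sum_ennreal sum_distrib_right[symmetric])
  finally show ?thesis .
qed

lemma lower_const_nonneg: "0 \<le> lower_const s"
  unfolding lower_const_def by (intro sum_nonneg shift_const_nonneg)

context
  fixes p q :: ennreal and s :: real
  assumes p: "1 \<le> p" and q: "1 \<le> q"
begin

lemma modulation_norm_triangle: "modulation_norm \<psi> p q s (a + b) \<le> modulation_norm \<psi> p q s a + modulation_norm \<psi> p q s b"
proof -
  let ?L = "\<lambda>a n. Lp_norm p torus (\<lambda>x. ennreal (cmod (freq_loc \<psi> n a x)))"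
  have "?L (a + b) n \<le> ?L a n + ?L b n" for n
  proof -
    have "?L (a + b) n \<le> Lp_norm p torus (\<lambda>x. ennreal (cmod (freq_loc \<psi> n a x)) + ennreal (cmod (freq_loc \<psi> n b x)))"
      by (intro Lp_norm_mono p) (auto simp: freq_loc_add norm_triangle_ineq ennreal_leI simp flip: ennreal_plus)
    also have "\<dots> \<le> ?L a n + ?L b n" by (rule Lp_norm_triangle[OF p]) measurable
    finally show ?thesis .
  qed
  hence "modulation_norm \<psi> p q s (a + b) \<le> lp_norm q (\<lambda>n. ennreal (jap n powr s) * ?L a n + ennreal (jap n powr s) * ?L b n)"
    unfolding modulation_norm_def distrib_left[symmetric] by (intro lp_norm_mono q mult_left_mono) auto
  also have "\<dots> \<le> modulation_norm \<psi> p q s a + modulation_norm \<psi> p q s b"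
    unfolding modulation_norm_def by (rule Lp_norm_triangle[OF q]) auto
  finally show ?thesis .
qed

lemma modulation_norm_scaleR: "modulation_norm \<psi> p q s (c *\<^sub>R a) = ennreal \<bar>c\<bar> * modulation_norm \<psi> p q s a"
proof -
  have "Lp_norm p torus (\<lambda>x. ennreal (cmod (freq_loc \<psi> n (c *\<^sub>R a) x)))
      = ennreal \<bar>c\<bar> * Lp_norm p torus (\<lambda>x. ennreal (cmod (freq_loc \<psi> n a x)))" for n
    by (simp add: freq_loc_scaleR ennreal_mult Lp_norm_cmult p)
  hence "modulation_norm \<psi> p q s (c *\<^sub>R a)
      = lp_norm q (\<lambda>n. ennreal \<bar>c\<bar> * (ennreal (jap n powr s) * Lp_norm p torus (\<lambda>x. ennreal (cmod (freq_loc \<psi> n a x)))))"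
    unfolding modulation_norm_def by (simp add: mult.left_commute)
  thus ?thesis unfolding modulation_norm_def by (subst (asm) Lp_norm_cmult[OF q]) auto
qed

lemma modulation_norm_le: "modulation_norm \<psi> p q s a \<le> ennreal ((2 * pi + 1) * upper_const s) * fourier_lebesgue_norm s q a"
proof -
  let ?u = "\<lambda>n. \<Sum>m\<in>supp. cmod (\<psi> m) * cmod (a (n + m))"
  have "modulation_norm \<psi> p q s a \<le> lp_norm q (\<lambda>n. ennreal (2 * pi + 1) * ennreal (jap n powr s * ?u n))"
    unfolding modulation_norm_def
  proof (rule lp_norm_mono[OF q])
    fix n
    have "Lp_norm p torus (\<lambda>x. ennreal (cmod (freq_loc \<psi> n a x))) \<le> ennreal (2 * pi + 1) * ennreal (?u n)"
      by (intro Lp_norm_torus_le_const p ennreal_leI cmod_freq_loc_le) measurable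
    hence "ennreal (jap n powr s) * Lp_norm p torus (\<lambda>x. ennreal (cmod (freq_loc \<psi> n a x)))
        \<le> ennreal (jap n powr s) * (ennreal (2 * pi + 1) * ennreal (?u n))"
      by (rule mult_left_mono) simp
    also have "\<dots> = ennreal (2 * pi + 1) * ennreal (jap n powr s * ?u n)"
      by (subst ennreal_mult) (auto simp: sum_nonneg mult.left_commute)
    finally show "ennreal (jap n powr s) * Lp_norm p torus (\<lambda>x. ennreal (cmod (freq_loc \<psi> n a x)))
      \<le> ennreal (2 * pi + 1) * ennreal (jap n powr s * ?u n)" .
  qed
  also have "\<dots> = ennreal (2 * pi + 1) * lp_norm q (\<lambda>n. ennreal (jap n powr s * ?u n))"
    by (rule Lp_norm_cmult[OF q]) auto
  also have "\<dots> \<le> ennreal (2 * pi + 1) * (ennreal (upper_const s) * fourier_lebesgue_norm s q a)"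
    by (intro mult_left_mono lp_norm_window_le q) simp
  also have "\<dots> = ennreal ((2 * pi + 1) * upper_const s) * fourier_lebesgue_norm s q a"
    by (subst ennreal_mult) (auto simp: upper_const_nonneg mult.assoc)
  finally show ?thesis .
qed

lemma modulation_norm_ge: "fourier_lebesgue_norm s q a \<le> ennreal (lower_const s * (2 * pi + 1)) * modulation_norm \<psi> p q s a"
proof -
  have "fourier_lebesgue_norm s q a \<le> ennreal (lower_const s) * lp_norm q (\<lambda>n. ennreal (jap n powr s) * local_mass a n)"
    by (rule fourier_lebesgue_le_local_mass[OF q])
  also have "\<dots> \<le> ennreal (lower_const s) * lp_norm q (\<lambda>n. ennreal (2 * pi + 1) *
      (ennreal (jap n powr s) * Lp_norm p torus (\<lambda>x. ennreal (cmod (freq_loc \<psi> n a x)))))"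
  proof (intro mult_left_mono lp_norm_mono q)
    fix n
    have "local_mass a n \<le> ennreal (2 * pi + 1) * Lp_norm p torus (\<lambda>x. ennreal (cmod (freq_loc \<psi> n a x)))"
      unfolding local_mass_def by (rule nn_integral_torus_le_Lp_norm[OF p]) measurable
    hence "ennreal (jap n powr s) * local_mass a n
        \<le> ennreal (jap n powr s) * (ennreal (2 * pi + 1) * Lp_norm p torus (\<lambda>x. ennreal (cmod (freq_loc \<psi> n a x))))"
      by (rule mult_left_mono) simp
    thus "ennreal (jap n powr s) * local_mass a n
        \<le> ennreal (2 * pi + 1) * (ennreal (jap n powr s) * Lp_norm p torus (\<lambda>x. ennreal (cmod (freq_loc \<psi> n a x))))"
      by (simp only: mult.left_commute)
  qed simp
  also have "\<dots> = ennreal (lower_const s) * (ennreal (2 * pi + 1) * modulation_norm \<psi> p q s a)"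
    unfolding modulation_norm_def by (subst Lp_norm_cmult[OF q]) auto
  also have "\<dots> = ennreal (lower_const s * (2 * pi + 1)) * modulation_norm \<psi> p q s a"
    by (subst ennreal_mult) (auto simp: lower_const_nonneg mult.assoc)
  finally show ?thesis .
qed

lemma measurable_torus_amalgam:
  "(\<lambda>x. lp_norm q (\<lambda>n. ennreal (jap n powr s * cmod (freq_loc \<psi> n a x)))) \<in> borel_measurable torus"
  by (rule borel_measurable_lp_norm[OF q]) measurable

lemma amalgam_norm_triangle: "amalgam_norm \<psi> p q s (a + b) \<le> amalgam_norm \<psi> p q s a + amalgam_norm \<psi> p q s b"
proof -
  let ?G = "\<lambda>a x. lp_norm q (\<lambda>n. ennreal (jap n powr s * cmod (freq_loc \<psi> n a x)))"
  have "?G (a + b) x \<le> ?G a x + ?G b x" for x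
  proof -
    have "?G (a + b) x \<le> lp_norm q (\<lambda>n. ennreal (jap n powr s * cmod (freq_loc \<psi> n a x)) + ennreal (jap n powr s * cmod (freq_loc \<psi> n b x)))"
    proof (rule lp_norm_mono[OF q])
      fix n
      have "jap n powr s * cmod (freq_loc \<psi> n (a + b) x)
          \<le> jap n powr s * cmod (freq_loc \<psi> n a x) + jap n powr s * cmod (freq_loc \<psi> n b x)"
        unfolding freq_loc_add distrib_left[symmetric] by (intro mult_left_mono norm_triangle_ineq) simp
      thus "ennreal (jap n powr s * cmod (freq_loc \<psi> n (a + b) x))
          \<le> ennreal (jap n powr s * cmod (freq_loc \<psi> n a x)) + ennreal (jap n powr s * cmod (freq_loc \<psi> n b x))"
        by (simp add: ennreal_leI flip: ennreal_plus)
    qed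
    also have "\<dots> \<le> ?G a x + ?G b x" by (rule Lp_norm_triangle[OF q]) auto
    finally show ?thesis .
  qed
  hence "amalgam_norm \<psi> p q s (a + b) \<le> Lp_norm p torus (\<lambda>x. ?G a x + ?G b x)"
    unfolding amalgam_norm_def by (intro Lp_norm_mono p measurable_torus_amalgam)
  also have "\<dots> \<le> amalgam_norm \<psi> p q s a + amalgam_norm \<psi> p q s b"
    unfolding amalgam_norm_def by (intro Lp_norm_triangle p measurable_torus_amalgam)
  finally show ?thesis .
qed

lemma amalgam_norm_scaleR: "amalgam_norm \<psi> p q s (c *\<^sub>R a) = ennreal \<bar>c\<bar> * amalgam_norm \<psi> p q s a"
proof -
  have "lp_norm q (\<lambda>n. ennreal (jap n powr s * cmod (freq_loc \<psi> n (c *\<^sub>R a) x)))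
      = ennreal \<bar>c\<bar> * lp_norm q (\<lambda>n. ennreal (jap n powr s * cmod (freq_loc \<psi> n a x)))" for x
  proof -
    have "ennreal (jap n powr s * cmod (freq_loc \<psi> n (c *\<^sub>R a) x))
        = ennreal \<bar>c\<bar> * ennreal (jap n powr s * cmod (freq_loc \<psi> n a x))" for n
      by (simp add: freq_loc_scaleR mult.left_commute flip: ennreal_mult)
    thus ?thesis by (simp only:) (rule Lp_norm_cmult[OF q], auto)
  qed
  thus ?thesis unfolding amalgam_norm_def
    by (simp only:) (rule Lp_norm_cmult[OF p measurable_torus_amalgam], simp)
qed

lemma amalgam_norm_le: "amalgam_norm \<psi> p q s a \<le> ennreal ((2 * pi + 1) * upper_const s) * fourier_lebesgue_norm s q a"
proof -
  have "lp_norm q (\<lambda>n. ennreal (jap n powr s * cmod (freq_loc \<psi> n a x)))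
      \<le> ennreal (upper_const s) * fourier_lebesgue_norm s q a" for x
  proof -
    have "lp_norm q (\<lambda>n. ennreal (jap n powr s * cmod (freq_loc \<psi> n a x)))
        \<le> lp_norm q (\<lambda>n. ennreal (jap n powr s * (\<Sum>m\<in>supp. cmod (\<psi> m) * cmod (a (n + m)))))"
      by (intro lp_norm_mono q ennreal_leI mult_left_mono cmod_freq_loc_le) simp
    also have "\<dots> \<le> ennreal (upper_const s) * fourier_lebesgue_norm s q a"
      by (rule lp_norm_window_le[OF q])
    finally show ?thesis .
  qed
  hence "amalgam_norm \<psi> p q s a \<le> ennreal (2 * pi + 1) * (ennreal (upper_const s) * fourier_lebesgue_norm s q a)"
    unfolding amalgam_norm_def by (intro Lp_norm_torus_le_const p measurable_torus_amalgam)
  also have "\<dots> = ennreal ((2 * pi + 1) * upper_const s) * fourier_lebesgue_norm s q a"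
    by (subst ennreal_mult) (auto simp: upper_const_nonneg mult.assoc)
  finally show ?thesis .
qed

text \<open>Here the integral over the torus has to be moved outside the sequence norm, which is Minkowski's
  integral inequality.\<close>

lemma amalgam_norm_ge: "fourier_lebesgue_norm s q a \<le> ennreal (lower_const s * (2 * pi + 1)) * amalgam_norm \<psi> p q s a"
proof -
  let ?G = "\<lambda>x. lp_norm q (\<lambda>n. ennreal (jap n powr s * cmod (freq_loc \<psi> n a x)))"
  have "ennreal (jap n powr s) * local_mass a n = (\<integral>\<^sup>+x. ennreal (jap n powr s * cmod (freq_loc \<psi> n a x)) \<partial>torus)" for n
    unfolding local_mass_def by (subst nn_integral_cmult[symmetric]) (auto simp: ennreal_mult)
  hence "lp_norm q (\<lambda>n. ennreal (jap n powr s) * local_mass a n) \<le> (\<integral>\<^sup>+x. ?G x \<partial>torus)"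
    by (simp only:) (rule lp_norm_nn_integral_le[OF q], auto)
  also have "\<dots> \<le> ennreal (2 * pi + 1) * amalgam_norm \<psi> p q s a"
    unfolding amalgam_norm_def by (rule nn_integral_torus_le_Lp_norm[OF p measurable_torus_amalgam])
  finally have "ennreal (lower_const s) * lp_norm q (\<lambda>n. ennreal (jap n powr s) * local_mass a n)
      \<le> ennreal (lower_const s) * (ennreal (2 * pi + 1) * amalgam_norm \<psi> p q s a)"
    by (rule mult_left_mono) simp
  also have "\<dots> = ennreal (lower_const s * (2 * pi + 1)) * amalgam_norm \<psi> p q s a"
    by (subst ennreal_mult) (auto simp: lower_const_nonneg mult.assoc)
  finally show ?thesis using fourier_lebesgue_le_local_mass[OF q, of s a] by (rule order_trans[rotated])
qed

end

end


section \<open>The four scales of spaces\<close>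

theorem corollary3p3:
  fixes p q :: ennreal and s :: real
    and \<psi> :: "int \<Rightarrow> complex" and \<phi>\<^sub>0 \<phi> :: "real \<Rightarrow> complex"
  assumes "1 \<le> p" and "1 \<le> q"
    and "finite {n. \<psi> n \<noteq> 0}"
    and "\<forall>k. (\<Sum>n | \<psi> (k - n) \<noteq> 0. \<psi> (k - n)) = 1"
    and "dyadic_partition \<phi>\<^sub>0 \<phi>"
  shows "((if q = \<infinity> then s < 1 else (s - 1) * enn2real q < - 1) \<longrightarrow>
            wiener_AWS (modulation_norm \<psi> p q s) \<and>
            wiener_AWS (amalgam_norm \<psi> p q s) \<and>
            wiener_AWS (fourier_lebesgue_norm s q))
       \<and> ((if p = \<infinity> then s < 1 else (s - 1) * enn2real p < - 1) \<longrightarrow>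
            wiener_AWS (fourier_besov_norm \<phi>\<^sub>0 \<phi> p q s))"
proof (rule conjI; rule impI)
  interpret frequency_window \<psi> by unfold_locales (fact assms)+
  assume sub: "if q = \<infinity> then s < 1 else (s - 1) * enn2real q < - 1"
  obtain \<sigma> r where FL: "admissible_norm (fourier_lebesgue_norm s q) \<sigma> r"
    by (rule admissible_fourier_lebesgue[OF assms(2) sub])
  note pq = assms(1,2)
  have "admissible_norm (modulation_norm \<psi> p q s) \<sigma> r"
    by (rule admissible_norm_equivalent[OF FL modulation_norm_triangle[OF pq] modulation_norm_scaleR[OF pq]
          modulation_norm_le[OF pq] modulation_norm_ge[OF pq]])
  moreover have "admissible_norm (amalgam_norm \<psi> p q s) \<sigma> r"
    by (rule admissible_norm_equivalent[OF FL amalgam_norm_triangle[OF pq] amalgam_norm_scaleR[OF pq]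
          amalgam_norm_le[OF pq] amalgam_norm_ge[OF pq]])
  ultimately show "wiener_AWS (modulation_norm \<psi> p q s) \<and> wiener_AWS (amalgam_norm \<psi> p q s)
      \<and> wiener_AWS (fourier_lebesgue_norm s q)"
    using FL by (intro conjI admissible_norm.wiener_AWS_nrm)
next
  assume sub: "if p = \<infinity> then s < 1 else (s - 1) * enn2real p < - 1"
  obtain \<sigma> r where "admissible_norm (fourier_besov_norm \<phi>\<^sub>0 \<phi> p q s) \<sigma> r"
    by (rule admissible_fourier_besov[OF assms(1,2) sub assms(5)])
  thus "wiener_AWS (fourier_besov_norm \<phi>\<^sub>0 \<phi> p q s)" by (rule admissible_norm.wiener_AWS_nrm)
qed

end
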